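(* In the setting described in the context, let $\widetilde{\mathcal D}_E\subset\mathcal D_E$ be the set of $E$-valued piecewise-constant càdlàg paths with no explosion in finite time. There is a one-to-one and onto correspondence between trajectories in $\widetilde{\mathcal D}_E$ and points in $H$, namely there exists a bijective map $$S\colon H\to\widetilde{\mathcal D}_E.$$ Moreover, $S$ and $S^{-1}$ are measurable and, under the conditions $$\sup_{(t,x)\in(0,+\infty)\times\mathcal D_E}\lambda^m(t,x)<+\infty\quad\text{and}\quad \mathbb E[p^m_t]<+\infty,\ \ \mathbb E[p^n_t]<+\infty\ \text{ for all } t\ge0,$$ it holds that $$X_{t\wedge\cdot}=S(\mathbf X_t),\qquad \mathbf X_t=S^{-1}(X_{t\wedge\cdot}),\qquad \mathbb P\text{-a.s.},\ t\ge0.$$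
   Context: $(E,d_E)$ is a complete separable metric space with Borel $\sigma$-algebra $\mathcal B(E)$; $(Z,\mathcal Z)$ is a Lusin space; $(\Omega,\mathcal F,\mathbb P)$ is a probability space with a complete right-continuous filtration $\mathbb F=(\mathcal F_t)_{t\ge0}$. $\mathcal D_E$ is the set of $E$-valued càdlàg functions on $[0,+\infty)$, with the Skorokhod topology and its Borel $\sigma$-algebra; $\widetilde{\mathcal D}_E\subset\mathcal D_E$ is the subset of all paths that are piecewise constant and do not explode in finite time (if $(t_n)_{n\ge1}\subset(0,+\infty]$ is the collection of discontinuity points of the path, then $\lim_n t_n=+\infty$). $\mathcal P(\cdot)$ denotes the set of probability measures, and $\int_a^b=\int_{(a,b]}$. For a càdlàg process $\eta$, $\eta_{t\wedge\cdot}$ is the stopped path $s\mapsto\eta_{t\wedge s}$, and $\eta_{t^-\wedge\cdot}$ is the path equal to $\eta_s$ for $s<t$ and to $\eta_{t^-}$ for $s\ge t$. Signal. $(T_k)_{k\ge1}$ is a sequence of $\mathbb F$-stopping times with $T_k\le T_{k+1}$ and, on $\{T_k<+\infty\}$, $T_k<T_{k+1}$; $(\zeta_k)_{k\ge0}$ are $E$-valued random variables, $\zeta_k$ being $\mathcal F_{T_k}$-measurable ($T_0:=0$). The signal is the pure-jump process $$X_t=\zeta_0\mathbf 1_{[0,T_1)}(t)+\sum_{k\ge1}\zeta_k\mathbf 1_{[T_k,T_{k+1})}(t),\qquad t\ge0,$$ and $(T_k)_{k\ge1}$ is referred to as the sequence of jump times of $X$. Its random counting measure on $(0,+\infty)\times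 E$ is $m((0,t]\times A)=\sum_{k\ge1}\mathbf 1_{T_k\le t}\mathbf 1_{X_{T_k}\in A}$, with $\mathbb F$-dual predictable projection $$\mu((0,t]\times A)=\int_0^t\int_A Q^m(s,X_{s^-\wedge\cdot};de)\,\lambda^m(s,X_{s^-\wedge\cdot})\,ds+\int_0^t\int_A R^m(s,X_{s^-\wedge\cdot};de)\,dp^m_s,$$ where $Q^m,R^m\colon(0,+\infty)\times\mathcal D_E\to\mathcal P(E)$ are probability transition kernels and $\lambda^m\colon(0,+\infty)\times\mathcal D_E\to[0,+\infty)$ is measurable. There is also a real-valued $\mathbb F$-adapted càdlàg observed process $Y$, a jump-diffusion whose coefficients depend on the path of $X$ and whose jumps are driven by $m$ and by a second $\mathbb F$-adapted random counting measure $n$ on $(0,+\infty)\times Z$, having no common jump times with $m$ and with $\mathbb F$-dual predictable projection $$\nu((0,t]\times B)=\int_0^t\int_B Q^n(s,X_{s^-\wedge\cdot},Y_{s^-};dz)\,\lambda^n(s,X_{s^-\wedge\cdot},Y_{s^-})\,ds+\int_0^t\int_B R^n(s,X_{s^-\wedge\cdot},Y_{s^-};dz)\,dp^n_s,$$ with probability transition kernels $Q^n,R^n\colon(0,+\infty)\times\mathcal D_E\times\mathbb R\to\mathcal P(Z)$ and a bounded nonnegative measurable $\lambda^n$ on $(0,+\infty)\times\mathcal D_E\times\mathbb R$. The processes $p^m,p^n$ are counting processes, predictable for the completed right-continuous natural filtration $\mathbb Y$ of $Y$. History process. Fix a point $\delta\notin E$. $H$ is the set of all sequences $h=(e_0,t_1,e_1,t_2,e_2,\dots)$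 with $e_0\in E$, $(e_n)_{n\ge1}\subset E\cup\{\delta\}$, $(t_n)_{n\ge1}\subset(0,+\infty]$, satisfying for all $n\ge1$: (1) $t_n\le t_{n+1}$; (2) $t_n<+\infty\Rightarrow t_n<t_{n+1}$; (3) $t_n=+\infty\Leftrightarrow e_n=\delta$. Put $N(h)=\sup\{n\ge1:t_n<+\infty\}$ ($0$ if the set is empty). $H$ has the Borel $\sigma$-algebra of the metric $d(h,h')=\sum_{n=0}^{N}2^{-(n+2)}[\rho(|t_n-t_n'|)+\rho(d_E(e_n,e_n'))]$ if $N(h)=N(h')=N$, and $d(h,h')=1$ otherwise, where $t_0=t_0'=0$ and $\rho(x)=x/(1+x)$. Set $\xi_0=(X_0,+\infty,\delta,+\infty,\delta,\dots)$ and, for $n\ge1$, $\xi_n=(X_0,T_1,X_{T_1},\dots,T_n,X_{T_n},+\infty,\delta,+\infty,\delta,\dots)$. The history process is $\mathbf X_t=\xi_0$ for $t\in[0,T_1)$ and $\mathbf X_t=\xi_n$ for $t\in[T_n,T_{n+1})$, $n\ge1$.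
   Formalization: Two hypotheses are added, since the claim fails without them: E has at least two points (for a singleton, D̃_E is one point but H is uncountable), and each T_k is a genuine jump, ζ_{k+1} ≠ ζ_k on {T_{k+1} < ∞} (otherwise S could not be injective). *)

theory Defs
  imports "HOL-Probability.Probability"
begin

definition borel_of :: "'a topology \<Rightarrow> 'a measure" where
  "borel_of T = sigma (topspace T) {U. openin T U}"

text \<open>Lusin spaces in the sense of Bourbaki: Hausdorff, and a continuous injective image of a
  Polish space, that is, carrying a finer Polish topology.\<close>

definition lusin_topology :: "'a topology \<Rightarrow> bool" where
  "lusin_topology T \<longleftrightarrow> Hausdorff_space T \<and>
     (\<exists>T'. topspace T' = topspace T \<and> (\<forall>U. openin T U \<longrightarrow> openin T' U) \<and>
           completely_metrizable_space T' \<and> second_countable T')"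

definition lusin_space :: "'a measure \<Rightarrow> bool" where
  "lusin_space K \<longleftrightarrow> (\<exists>T. lusin_topology T \<and> space K = topspace T \<and> sets K = sets (borel_of T))"


section \<open>Path spaces\<close>

definition cadlag :: "(real \<Rightarrow> 'e::topological_space) \<Rightarrow> bool" where
  "cadlag x \<longleftrightarrow> (\<forall>t\<ge>0. (x \<longlongrightarrow> x t) (at_right t)) \<and> (\<forall>t>0. \<exists>l. (x \<longlongrightarrow> l) (at_left t))"

text \<open>A function on \<open>[0,\<infinity>)\<close> is represented by its extension with the value \<^const>\<open>undefined\<close>
  on the negative reals.\<close>

definition cadlag_paths :: "(real \<Rightarrow> 'e::topological_space) set" where
  "cadlag_paths = {x \<in> extensional {0..}. cadlag x}"

definition time_changes :: "(real \<Rightarrow> real) set" where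
  "time_changes = {l. strict_mono_on {0..} l \<and> l ` {0..} = {0..}}"

definition skorokhod_converges ::
  "(nat \<Rightarrow> real \<Rightarrow> 'e::metric_space) \<Rightarrow> (real \<Rightarrow> 'e) \<Rightarrow> bool" where
  "skorokhod_converges xs x \<longleftrightarrow>
     (\<exists>l. (\<forall>n. l n \<in> time_changes) \<and>
          uniform_limit {0..} l (\<lambda>s. s) sequentially \<and>
          (\<forall>N::nat. uniform_limit {0..real N} (\<lambda>n s. xs n (l n s)) x sequentially))"

text \<open>The J1 topology on \<open>D[0,\<infinity>)\<close> is metrizable, hence determined by its convergent sequences: a set
  is open iff every sequence converging to one of its points is eventually in it.\<close>

definition skorokhod_topology :: "(real \<Rightarrow> 'e::metric_space) topology" where
  "skorokhod_topology = topology (\<lambda>U. U \<subseteq> cadlag_paths \<and>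
     (\<forall>x\<in>U. \<forall>xs. (\<forall>n. xs n \<in> cadlag_paths) \<longrightarrow> skorokhod_converges xs x \<longrightarrow>
        eventually (\<lambda>n. xs n \<in> U) sequentially))"

lemma istopology_skorokhod:
  "istopology (\<lambda>U. U \<subseteq> (cadlag_paths :: (real \<Rightarrow> 'e::metric_space) set) \<and>
     (\<forall>x\<in>U. \<forall>xs. (\<forall>n. xs n \<in> cadlag_paths) \<longrightarrow> skorokhod_converges xs x \<longrightarrow>
        eventually (\<lambda>n. xs n \<in> U) sequentially))" (is "istopology ?P")
proof -
  have "?P (U \<inter> V)" if "?P U" "?P V" for U V
    using that by (auto simp: eventually_conj_iff)
  moreover have "?P (\<Union>\<U>)" if "\<forall>U\<in>\<U>. ?P U" for \<U>
  proof (intro conjI ballI allI impI)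
    show "\<Union>\<U> \<subseteq> cadlag_paths" using that by blast
    fix x and xs :: "nat \<Rightarrow> real \<Rightarrow> 'e"
    assume "x \<in> \<Union>\<U>" and xs: "\<forall>n. xs n \<in> cadlag_paths" "skorokhod_converges xs x"
    then obtain U where U: "U \<in> \<U>" "x \<in> U" by blast
    then have "eventually (\<lambda>n. xs n \<in> U) sequentially" using that xs by blast
    then show "eventually (\<lambda>n. xs n \<in> \<Union>\<U>) sequentially"
      by (rule eventually_mono) (use U in blast)
  qed
  ultimately show ?thesis unfolding istopology_def by simp
qed

lemma openin_skorokhod_topology:
  "openin skorokhod_topology U \<longleftrightarrow> U \<subseteq> cadlag_paths \<and>
     (\<forall>x\<in>U. \<forall>xs. (\<forall>n. xs n \<in> cadlag_paths) \<longrightarrow> skorokhod_converges xs x \<longrightarrow>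
        eventually (\<lambda>n. xs n \<in> U) sequentially)"
  unfolding skorokhod_topology_def topology_inverse'[OF istopology_skorokhod] ..

lemma topspace_skorokhod_topology: "topspace skorokhod_topology = cadlag_paths"
proof
  show "topspace skorokhod_topology \<subseteq> (cadlag_paths :: (real \<Rightarrow> 'a) set)"
    using openin_topspace[of "skorokhod_topology :: (real \<Rightarrow> 'a) topology"]
    unfolding openin_skorokhod_topology by blast
  have "openin skorokhod_topology (cadlag_paths :: (real \<Rightarrow> 'a) set)"
    unfolding openin_skorokhod_topology by simp
  then show "cadlag_paths \<subseteq> topspace (skorokhod_topology :: (real \<Rightarrow> 'a) topology)"
    by (rule openin_subset)
qed

abbreviation skorokhod_borel :: "(real \<Rightarrow> 'e::metric_space) measure" where
  "skorokhod_borel \<equiv> borel_of skorokhod_topology"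

definition discontinuities :: "(real \<Rightarrow> 'e::topological_space) \<Rightarrow> real set" where
  "discontinuities x = {t. 0 < t \<and> \<not> isCont x t}"

text \<open>That the discontinuity times tend to infinity (non-explosion) means that only finitely many
  of them lie in any bounded interval.\<close>

definition step_paths :: "(real \<Rightarrow> 'e::topological_space) set" where
  "step_paths = {x \<in> cadlag_paths.
     (\<forall>s t. 0 \<le> s \<longrightarrow> s \<le> t \<longrightarrow> discontinuities x \<inter> {s<..t} = {} \<longrightarrow> x s = x t) \<and>
     (\<forall>t. finite (discontinuities x \<inter> {0<..t}))}"

abbreviation step_paths_borel :: "(real \<Rightarrow> 'e::metric_space) measure" where
  "step_paths_borel \<equiv> restrict_space skorokhod_borel step_paths"

text \<open>The paths written \<open>x\<^bsub>t\<and>\<cdot>\<^esub>\<close> and \<open>x\<^bsub>t-\<and>\<cdot>\<^esub>\<close>.\<close>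

definition stopped_path :: "(real \<Rightarrow> 'e) \<Rightarrow> real \<Rightarrow> real \<Rightarrow> 'e" where
  "stopped_path x t = restrict (\<lambda>s. x (min t s)) {0..}"

definition left_stopped_path :: "(real \<Rightarrow> 'e::t2_space) \<Rightarrow> real \<Rightarrow> real \<Rightarrow> 'e" where
  "left_stopped_path x t = restrict (\<lambda>s. if s < t then x s else Lim (at_left t) x) {0..}"


section \<open>The space of histories\<close>

text \<open>The sequence \<open>(e\<^sub>0, t\<^sub>1, e\<^sub>1, t\<^sub>2, e\<^sub>2, \<dots>)\<close> is the pair of the sequences \<open>(t\<^sub>n)\<close> and \<open>(e\<^sub>n)\<close>,
  with the convention \<open>t\<^sub>0 = 0\<close>; the point \<open>\<delta>\<close> outside \<open>E\<close> is \<^const>\<open>None\<close>.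
  Neither \<open>e\<^sub>n \<noteq> e\<^bsub>n-1\<^esub>\<close> nor \<open>t\<^sub>n \<rightarrow> \<infinity>\<close> is required. So the map sending a history to the step path
  with these jump times and values is a bijection onto the step paths only after restriction; it is
  one between the histories with finitely many jumps, all genuine, and the step paths with
  finitely many discontinuities.\<close>

type_synonym 'e history = "(nat \<Rightarrow> ennreal) \<times> (nat \<Rightarrow> 'e option)"

definition histories :: "'e history set" where
  "histories = {(t, e). t 0 = 0 \<and> e 0 \<noteq> None \<and>
     (\<forall>n\<ge>1. 0 < t n \<and> t n \<le> t (Suc n) \<and>
            (t n < \<infinity> \<longrightarrow> t n < t (Suc n)) \<and>
            (t n = \<infinity> \<longleftrightarrow> e n = None))}"

definition hist_length :: "'e history \<Rightarrow> enat" where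
  "hist_length h = (SUP n\<in>{n. 1 \<le> n \<and> fst h n < \<infinity>}. enat n)"

definition rho :: "real \<Rightarrow> real" where
  "rho x = x / (1 + x)"

definition hist_dist :: "'e::metric_space history \<Rightarrow> 'e history \<Rightarrow> real" where
  "hist_dist h h' =
     (if hist_length h = hist_length h' then
        (\<Sum>n. if enat n \<le> hist_length h then
               (1 / 2) ^ (n + 2) * (rho \<bar>enn2real (fst h n) - enn2real (fst h' n)\<bar> +
                                    rho (dist (the (snd h n)) (the (snd h' n))))
             else 0)
      else 1)"

abbreviation histories_borel :: "'e::metric_space history measure" where
  "histories_borel \<equiv> borel_of (Metric_space.mtopology histories hist_dist)"


section \<open>Filtrations and random measures\<close>

text \<open>Extending a filtration indexed by \<open>[0,\<infinity>)\<close> to \<open>[0,\<infinity>]\<close> gives access to the library notion of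
  stopping time for times with values in \<open>[0,\<infinity>]\<close>; the condition at \<open>\<infinity>\<close> adds nothing to
  \<^const>\<open>stopping_time\<close>.\<close>

definition extended_filtration :: "'w measure \<Rightarrow> (real \<Rightarrow> 'w measure) \<Rightarrow> ennreal \<Rightarrow> 'w measure" where
  "extended_filtration M F t = (if t = \<infinity> then M else F (enn2real t))"

definition usual_filtration :: "'w measure \<Rightarrow> (real \<Rightarrow> 'w measure) \<Rightarrow> bool" where
  "usual_filtration M F \<longleftrightarrow>
     filtration (space M) (extended_filtration M F) \<and>
     (\<forall>t\<ge>0. sets (F t) = (\<Inter>s\<in>{t<..}. sets (F s))) \<and>
     (\<forall>B\<in>null_sets M. \<forall>A. A \<subseteq> B \<longrightarrow> A \<in> sets (F 0))"

text \<open>The completed right-continuous natural filtration of a process.\<close>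

definition natural_filtration ::
  "'w measure \<Rightarrow> (real \<Rightarrow> 'w \<Rightarrow> 'y::topological_space) \<Rightarrow> real \<Rightarrow> 'w measure" where
  "natural_filtration M Y t = sigma (space M) (\<Inter>u\<in>{t<..}. sigma_sets (space M)
     ({Y s -` A \<inter> space M | s A. 0 \<le> s \<and> s \<le> u \<and> A \<in> sets borel} \<union> null_sets M))"

definition predictable_sigma :: "'w measure \<Rightarrow> (real \<Rightarrow> 'w measure) \<Rightarrow> ('w \<times> real) measure" where
  "predictable_sigma M F = sigma (space M \<times> {0<..})
     {A \<times> {s<..t} | A s t. 0 \<le> s \<and> s \<le> t \<and> A \<in> sets (F s)}"

text \<open>The measurable space \<open>(0,\<infinity>) \<times> K\<close> of times and marks.\<close>

definition time_mark_space :: "'z measure \<Rightarrow> (real \<times> 'z) measure" where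
  "time_mark_space K = restrict_space borel {0<..} \<Otimes>\<^sub>M K"

definition random_measure :: "'w measure \<Rightarrow> 'z measure \<Rightarrow> ('w \<Rightarrow> (real \<times> 'z) measure) \<Rightarrow> bool" where
  "random_measure M K m \<longleftrightarrow>
     (\<forall>\<omega>\<in>space M. sets (m \<omega>) = sets (time_mark_space K)) \<and>
     (\<forall>C\<in>sets (time_mark_space K). (\<lambda>\<omega>. emeasure (m \<omega>) C) \<in> borel_measurable M)"

definition adapted_counting_measure ::
  "'w measure \<Rightarrow> (real \<Rightarrow> 'w measure) \<Rightarrow> 'z measure \<Rightarrow> ('w \<Rightarrow> (real \<times> 'z) measure) \<Rightarrow> bool" where
  "adapted_counting_measure M F K m \<longleftrightarrow>
     random_measure M K m \<and>
     (\<forall>\<omega>\<in>space M. \<forall>C\<in>sets (time_mark_space K). emeasure (m \<omega>) C \<in> range of_nat \<union> {\<infinity>}) \<and>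
     (\<forall>t>0. \<forall>B\<in>sets K. (\<lambda>\<omega>. emeasure (m \<omega>) ({0<..t} \<times> B)) \<in> borel_measurable (F t))"

text \<open>\<open>\<mu>\<close> is the dual predictable projection (compensator) of \<open>m\<close>: it is a predictable random measure,
  and both measures give the same expected integral to all nonnegative predictable integrands.\<close>

definition dual_predictable_projection ::
  "'w measure \<Rightarrow> (real \<Rightarrow> 'w measure) \<Rightarrow> 'z measure \<Rightarrow> ('w \<Rightarrow> (real \<times> 'z) measure) \<Rightarrow>
   ('w \<Rightarrow> (real \<times> 'z) measure) \<Rightarrow> bool" where
  "dual_predictable_projection M F K m \<mu> \<longleftrightarrow>
     random_measure M K \<mu> \<and>
     (\<forall>W::('w \<times> real) \<times> 'z \<Rightarrow> ennreal. W \<in> borel_measurable (predictable_sigma M F \<Otimes>\<^sub>M K) \<longrightarrow>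
        (\<lambda>(\<omega>, t). \<integral>\<^sup>+ (s, z). W ((\<omega>, s), z) * indicator {0<..t} s \<partial>\<mu> \<omega>)
          \<in> borel_measurable (predictable_sigma M F) \<and>
        (\<integral>\<^sup>+ \<omega>. (\<integral>\<^sup>+ (s, z). W ((\<omega>, s), z) \<partial>m \<omega>) \<partial>M) =
        (\<integral>\<^sup>+ \<omega>. (\<integral>\<^sup>+ (s, z). W ((\<omega>, s), z) \<partial>\<mu> \<omega>) \<partial>M))"

definition counting_path :: "(real \<Rightarrow> nat) \<Rightarrow> bool" where
  "counting_path p \<longleftrightarrow> p 0 = 0 \<and> mono_on {0..} p \<and>
     (\<forall>t\<ge>0. (p \<longlongrightarrow> p t) (at_right t)) \<and>
     (\<forall>t>0. \<exists>s. 0 \<le> s \<and> s < t \<and> p t \<le> p s + 1)"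

definition predictable_counting_process ::
  "'w measure \<Rightarrow> (real \<Rightarrow> 'w measure) \<Rightarrow> (real \<Rightarrow> 'w \<Rightarrow> nat) \<Rightarrow> bool" where
  "predictable_counting_process M F p \<longleftrightarrow>
     (\<forall>\<omega>\<in>space M. counting_path (\<lambda>t. p t \<omega>)) \<and>
     (\<lambda>(\<omega>, t). p t \<omega>) \<in> measurable (predictable_sigma M F) (count_space UNIV)"

text \<open>The Stieltjes measure \<open>dp\<close> on the real line, with no mass outside \<open>(0,\<infinity>)\<close>.\<close>

definition counting_stieltjes :: "(real \<Rightarrow> nat) \<Rightarrow> real measure" where
  "counting_stieltjes p = interval_measure (\<lambda>s. real (p (max 0 s)))"


section \<open>Signal, observation and history processes\<close>

definition signal_at :: "(real \<Rightarrow> 'w \<Rightarrow> 'e) \<Rightarrow> (nat \<Rightarrow> 'w \<Rightarrow> ennreal) \<Rightarrow> nat \<Rightarrow> 'w \<Rightarrow> 'e" where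
  "signal_at X T k \<omega> = X (enn2real (T k \<omega>)) \<omega>"

text \<open>The sum of the Dirac masses at \<open>(T\<^sub>k, X\<^bsub>T\<^sub>k\<^esub>)\<close> over the \<open>k \<ge> 1\<close> with \<open>T\<^sub>k < \<infinity>\<close>.\<close>

definition jump_measure ::
  "(real \<Rightarrow> 'w \<Rightarrow> 'e::topological_space) \<Rightarrow> (nat \<Rightarrow> 'w \<Rightarrow> ennreal) \<Rightarrow> 'w \<Rightarrow> (real \<times> 'e) measure" where
  "jump_measure X T \<omega> = distr (count_space {k. 1 \<le> k \<and> T k \<omega> < \<infinity>}) (time_mark_space borel)
     (\<lambda>k. (enn2real (T k \<omega>), signal_at X T k \<omega>))"

definition stage_history ::
  "(real \<Rightarrow> 'w \<Rightarrow> 'e) \<Rightarrow> (nat \<Rightarrow> 'w \<Rightarrow> ennreal) \<Rightarrow> nat \<Rightarrow> 'w \<Rightarrow> 'e history" where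
  "stage_history X T n \<omega> =
     (\<lambda>k. if k \<le> n then T k \<omega> else \<infinity>, \<lambda>k. if k \<le> n then Some (signal_at X T k \<omega>) else None)"

text \<open>As \<open>T\<^sub>0 = 0\<close>, the index \<open>n\<close> below is \<open>0\<close> on \<open>[0,T\<^sub>1)\<close>; it does not exist at or after an explosion.\<close>

definition history_process ::
  "(real \<Rightarrow> 'w \<Rightarrow> 'e) \<Rightarrow> (nat \<Rightarrow> 'w \<Rightarrow> ennreal) \<Rightarrow> real \<Rightarrow> 'w \<Rightarrow> 'e history" where
  "history_process X T t \<omega> =
     stage_history X T (THE n. T n \<omega> \<le> ennreal t \<and> ennreal t < T (Suc n) \<omega>) \<omega>"

text \<open>The standing setting. The process \<open>X\<close> is left unspecified at and after an accumulation point of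
  the \<open>T\<^sub>k\<close>; that such points do not exist almost surely is a consequence of the integrability
  conditions. Nothing beyond adaptedness and cadlag paths is required of the observed process \<open>Y\<close>.\<close>

locale signal_observation = prob_space M
  for M :: "'w measure" +
  fixes F :: "real \<Rightarrow> 'w measure"
    and T :: "nat \<Rightarrow> 'w \<Rightarrow> ennreal"
    and \<zeta> :: "nat \<Rightarrow> 'w \<Rightarrow> 'e::polish_space"
    and X :: "real \<Rightarrow> 'w \<Rightarrow> 'e"
    and Y :: "real \<Rightarrow> 'w \<Rightarrow> real"
    and \<mu> :: "'w \<Rightarrow> (real \<times> 'e) measure"
    and Qm Rm :: "real \<Rightarrow> (real \<Rightarrow> 'e) \<Rightarrow> 'e measure"
    and lam_m :: "real \<Rightarrow> (real \<Rightarrow> 'e) \<Rightarrow> real"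
    and pm :: "real \<Rightarrow> 'w \<Rightarrow> nat"
    and Z :: "'z measure"
    and n \<nu> :: "'w \<Rightarrow> (real \<times> 'z) measure"
    and Qn Rn :: "real \<Rightarrow> (real \<Rightarrow> 'e) \<Rightarrow> real \<Rightarrow> 'z measure"
    and lam_n :: "real \<Rightarrow> (real \<Rightarrow> 'e) \<Rightarrow> real \<Rightarrow> real"
    and pn :: "real \<Rightarrow> 'w \<Rightarrow> nat"
  assumes filtration: "usual_filtration M F"
    and T_0: "\<And>\<omega>. \<omega> \<in> space M \<Longrightarrow> T 0 \<omega> = 0"
    and T_stopping: "\<And>k. stopping_time (extended_filtration M F) (T k)"
    and T_mono: "\<And>k \<omega>. \<omega> \<in> space M \<Longrightarrow> T k \<omega> \<le> T (Suc k) \<omega>"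
    and T_strict: "\<And>k \<omega>. \<omega> \<in> space M \<Longrightarrow> T k \<omega> < \<infinity> \<Longrightarrow> T k \<omega> < T (Suc k) \<omega>"
    and zeta_measurable:
      "\<And>k. \<zeta> k \<in> borel_measurable
               (filtration.pre_sigma (space M) (extended_filtration M F) (T k))"
    and X_eq: "\<And>k t \<omega>. \<omega> \<in> space M \<Longrightarrow> 0 \<le> t \<Longrightarrow> T k \<omega> \<le> ennreal t \<Longrightarrow> ennreal t < T (Suc k) \<omega> \<Longrightarrow>
                  X t \<omega> = \<zeta> k \<omega>"
    \<comment> \<open>the \<open>T\<^sub>k\<close> are the jump times of \<open>X\<close>\<close>
    and genuine_jumps: "\<And>k \<omega>. \<omega> \<in> space M \<Longrightarrow> T (Suc k) \<omega> < \<infinity> \<Longrightarrow> \<zeta> (Suc k) \<omega> \<noteq> \<zeta> k \<omega>"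
    and Y_adapted: "\<And>t. 0 \<le> t \<Longrightarrow> Y t \<in> borel_measurable (F t)"
    and Y_cadlag: "\<And>\<omega>. \<omega> \<in> space M \<Longrightarrow> cadlag (\<lambda>t. Y t \<omega>)"
    and pm_counting: "predictable_counting_process M (natural_filtration M Y) pm"
    and Qm_kernel:
      "(\<lambda>(s, x). Qm s x) \<in> measurable (restrict_space borel {0<..} \<Otimes>\<^sub>M skorokhod_borel)
                                      (prob_algebra borel)"
    and Rm_kernel:
      "(\<lambda>(s, x). Rm s x) \<in> measurable (restrict_space borel {0<..} \<Otimes>\<^sub>M skorokhod_borel)
                                      (prob_algebra borel)"
    and lam_m_measurable:
      "(\<lambda>(s, x). lam_m s x) \<in> borel_measurable (restrict_space borel {0<..} \<Otimes>\<^sub>M skorokhod_borel)"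
    and lam_m_nonneg: "\<And>s x. 0 < s \<Longrightarrow> x \<in> cadlag_paths \<Longrightarrow> 0 \<le> lam_m s x"
    and m_compensator: "dual_predictable_projection M F borel (jump_measure X T) \<mu>"
    and mu_eq:
      "AE \<omega> in M. \<forall>t>0. \<forall>A\<in>sets borel. emeasure (\<mu> \<omega>) ({0<..t} \<times> A) =
         (let x = left_stopped_path (\<lambda>r. X r \<omega>)
          in (\<integral>\<^sup>+ s\<in>{0<..t}. (emeasure (Qm s (x s)) A * ennreal (lam_m s (x s))) \<partial>lborel) +
             (\<integral>\<^sup>+ s\<in>{0<..t}. emeasure (Rm s (x s)) A \<partial>counting_stieltjes (\<lambda>r. pm r \<omega>)))"
    and Z_lusin: "lusin_space Z"
    and n_counting: "adapted_counting_measure M F Z n"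
    and no_common_jumps:
      "AE \<omega> in M. \<forall>t>0. emeasure (jump_measure X T \<omega>) ({t} \<times> UNIV) = 0 \<or>
                        emeasure (n \<omega>) ({t} \<times> space Z) = 0"
    and pn_counting: "predictable_counting_process M (natural_filtration M Y) pn"
    and Qn_kernel:
      "(\<lambda>(s, x, y). Qn s x y) \<in>
         measurable (restrict_space borel {0<..} \<Otimes>\<^sub>M skorokhod_borel \<Otimes>\<^sub>M borel) (prob_algebra Z)"
    and Rn_kernel:
      "(\<lambda>(s, x, y). Rn s x y) \<in>
         measurable (restrict_space borel {0<..} \<Otimes>\<^sub>M skorokhod_borel \<Otimes>\<^sub>M borel) (prob_algebra Z)"
    and lam_n_measurable:
      "(\<lambda>(s, x, y). lam_n s x y) \<in>
         borel_measurable (restrict_space borel {0<..} \<Otimes>\<^sub>M skorokhod_borel \<Otimes>\<^sub>M borel)"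
    and lam_n_nonneg: "\<And>s x y. 0 < s \<Longrightarrow> x \<in> cadlag_paths \<Longrightarrow> 0 \<le> lam_n s x y"
    and lam_n_bounded: "\<exists>C. \<forall>s>0. \<forall>x\<in>cadlag_paths. \<forall>y. lam_n s x y \<le> C"
    and n_compensator: "dual_predictable_projection M F Z n \<nu>"
    and nu_eq:
      "AE \<omega> in M. \<forall>t>0. \<forall>B\<in>sets Z. emeasure (\<nu> \<omega>) ({0<..t} \<times> B) =
         (let x = left_stopped_path (\<lambda>r. X r \<omega>); y = (\<lambda>s. Lim (at_left s) (\<lambda>r. Y r \<omega>))
          in (\<integral>\<^sup>+ s\<in>{0<..t}. (emeasure (Qn s (x s) (y s)) B * ennreal (lam_n s (x s) (y s))) \<partial>lborel) +
             (\<integral>\<^sup>+ s\<in>{0<..t}. emeasure (Rn s (x s) (y s)) B \<partial>counting_stieltjes (\<lambda>r. pn r \<omega>)))"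

end

theory Submission
  imports Defs
begin

text \<open>
  A history lists jump times and marks, and a step path is given by its jump times and
  values, so there is an obvious candidate for \<open>S\<close>: the path that takes the value \<open>e\<^sub>n\<close> on
  \<open>[t\<^sub>n, t\<^bsub>n+1\<^esub>)\<close>. It is a bijection onto the step paths only on those histories all of whose
  jumps change the value and whose jump times do not accumulate. Every other history needs
  an image too, without disturbing the histories that the history process really visits;
  these have finitely many jumps, all of which change the value.

  The rearrangement is done on codes, sequences of times and marks in a Polish space. Step
  codes (the codes of step paths) form a Borel subset of all codes. Conversely, all codes
  embed into the step codes: finite step codes are left alone, and any other code is
  interleaved with a default mark, the surplus information going into the fractional parts
  of jump times (\<open>deinterleave_interleave\<close>, \<open>interleave_step_codes\<close>). Cantor and Bernstein's
  argument (\<open>borel_cantor_bernstein\<close>) turns these two embeddings into a Borel isomorphism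
  that fixes the finite step codes (\<open>codes_isomorphic_step_codes\<close>). Then \<open>S\<close> is the
  composition of encoding, this isomorphism, and the passage from step codes to paths.

  Encoding and decoding histories is measurable because the metric on histories is, for a
  given length, a continuous function of the codes (\<open>encode_measurable\<close>, \<open>decode_measurable\<close>).
  The passage from step codes to paths is continuous: if the codes are close, a time
  change close to the identity matches the jumps (\<open>step_paths_close\<close>). The inverse need not
  be continuous, since small jumps may disappear in the limit, but it is measurable:
  visits of open sets during open intervals are Skorokhod-open events (\<open>openin_visits\<close>), by
  right continuity they determine evaluations, and evaluations at rational times determine
  the jump times and the values between them (\<open>nth_jump_Suc_le_iff\<close>, \<open>jmark_path_code_iff\<close>).

  It remains to see that the signal does not explode, because then the stopped signal at
  time \<open>t\<close> is the path of the history at time \<open>t\<close>. The jump measure and its compensator have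
  the same expected mass on \<open>(0, min t T\<^sub>k] \<times> E\<close>. It is at least \<open>k\<close> times the probability of
  \<open>T\<^sub>k \<le> t\<close>, and at most \<open>C t + E[p\<^sup>m\<^sub>t]\<close>, where \<open>C\<close> bounds the intensity. So the probability that
  \<open>T\<^sub>k \<le> t\<close> for all \<open>k\<close> vanishes (\<open>jump_probability_bound\<close>, \<open>no_explosion\<close>).
\<close>

section \<open>A Borel version of the Cantor-Bernstein theorem\<close>

text \<open>The classical back-and-forth argument: \<open>f\<close> is used on the orbit of \<open>A - B\<close> under \<open>f\<close>, the
  identity elsewhere. A Borel left inverse of \<open>f\<close> makes every set in the construction Borel.
  The last conclusion records that the bijection moves points only along \<open>f\<close>, so it fixes
  every fixed point of \<open>f\<close>.\<close>

lemma borel_cantor_bernstein: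
  fixes f g :: "'a::{second_countable_topology, t2_space} \<Rightarrow> 'a"
  assumes A: "A \<in> sets borel" and B: "B \<in> sets borel" "B \<subseteq> A"
    and f [measurable]: "f \<in> borel_measurable borel" and g [measurable]: "g \<in> borel_measurable borel"
    and f_into: "\<And>x. x \<in> A \<Longrightarrow> f x \<in> B" and left_inverse: "\<And>x. x \<in> A \<Longrightarrow> g (f x) = x"
  obtains \<phi> \<phi>' where "\<phi> \<in> borel_measurable borel" "\<phi>' \<in> borel_measurable borel"
    "\<And>x. x \<in> A \<Longrightarrow> \<phi> x \<in> B" "\<And>y. y \<in> B \<Longrightarrow> \<phi>' y \<in> A"
    "\<And>x. x \<in> A \<Longrightarrow> \<phi>' (\<phi> x) = x" "\<And>y. y \<in> B \<Longrightarrow> \<phi> (\<phi>' y) = y"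
    "\<And>x. \<phi> x = x \<or> \<phi> x = f x"
proof -
  have image_eq: "f ` K = {y. g y \<in> K \<and> f (g y) = y}" if "K \<subseteq> A" for K
    using that left_inverse by (force simp: image_iff)
  \<comment> \<open>The left inverse exhibits images of Borel sets as preimages.\<close>
  have image_borel: "f ` K \<in> sets borel" if "K \<subseteq> A" "K \<in> sets borel" for K
  proof -
    have [measurable]: "K \<in> sets borel" by fact
    have "{y \<in> space borel. g y \<in> K \<and> f (g y) = y} \<in> sets borel"
      by measurable
    then show ?thesis by (simp add: image_eq[OF that(1)])
  qed
  \<comment> \<open>Points outside \<open>B\<close> have to be moved by \<open>f\<close>, and then their images have to make room as well.\<close>
  define C where "C = (\<Union>n. (image f ^^ n) (A - B))"
  have C_n: "(image f ^^ n) (A - B) \<subseteq> A \<and> (image f ^^ n) (A - B) \<in> sets borel" for n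
  proof (induction n)
    case 0
    then show ?case using A B by auto
  next
    case (Suc n)
    then show ?case using f_into B(2) image_borel by auto
  qed
  have C_sub: "C \<subseteq> A" and C_borel [measurable]: "C \<in> sets borel"
    using C_n by (auto simp: C_def)
  have C_step: "f x \<in> C" if "x \<in> C" for x
  proof -
    from that obtain n where "x \<in> (image f ^^ n) (A - B)" by (auto simp: C_def)
    then have "f x \<in> (image f ^^ (Suc n)) (A - B)" by simp
    then show ?thesis unfolding C_def by blast
  qed
  have C_pred: "\<exists>z\<in>C. f z = y" if "y \<in> C" "y \<in> B" for y
  proof -
    from that(1) obtain n where n: "y \<in> (image f ^^ n) (A - B)" by (auto simp: C_def)
    with that(2) obtain m where "n = Suc m" by (cases n) auto
    with n show ?thesis by (auto simp: C_def)
  qed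
  define \<phi> where "\<phi> x = (if x \<in> C then f x else x)" for x
  define \<phi>' where "\<phi>' y = (if y \<in> f ` C then g y else y)" for y
  have [measurable]: "f ` C \<in> sets borel" by (intro image_borel C_sub C_borel)
  show thesis
  proof (rule that)
    show "\<phi> \<in> borel_measurable borel" unfolding \<phi>_def by measurable
    show "\<phi>' \<in> borel_measurable borel" unfolding \<phi>'_def by measurable
    show "\<phi> x \<in> B" if "x \<in> A" for x
    proof (cases "x \<in> C")
      case False
      then have "x \<notin> (image f ^^ 0) (A - B)" unfolding C_def by blast
      with that False show ?thesis by (simp add: \<phi>_def)
    qed (use that f_into in \<open>simp add: \<phi>_def\<close>)
    show "\<phi>' y \<in> A" if "y \<in> B" for y
      using that B(2) C_sub left_inverse by (auto simp: \<phi>'_def)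
    show "\<phi>' (\<phi> x) = x" if "x \<in> A" for x
      using that C_step left_inverse by (auto simp: \<phi>'_def \<phi>_def)
    show "\<phi> (\<phi>' y) = y" if "y \<in> B" for y
      using that C_pred C_sub left_inverse by (force simp: \<phi>'_def \<phi>_def)
    show "\<phi> x = x \<or> \<phi> x = f x" for x by (simp add: \<phi>_def)
  qed
qed

section \<open>Jump codes\<close>

text \<open>Histories are represented by sequences of real times and marks. A jump that never
  happens gets time \<open>-1\<close> and a default mark. The representing type is a countable product of
  Polish spaces, so that measurability can be checked coordinate by coordinate, and
  convergence of codes is convergence of the coordinates.\<close>

type_synonym 'e jump_code = "nat \<Rightarrow> real \<times> 'e"

definition jtime :: "'e jump_code \<Rightarrow> nat \<Rightarrow> real" where "jtime p n = fst (p n)"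

definition jmark :: "'e jump_code \<Rightarrow> nat \<Rightarrow> 'e" where "jmark p n = snd (p n)"

lemma jump_code_eqI:
  assumes "\<And>n. jtime p n = jtime q n" "\<And>n. jmark p n = jmark q n"
  shows "p = q"
  using assms by (auto simp: jtime_def jmark_def prod_eq_iff)

text \<open>The codes of all histories: once a jump is missing, all later ones are missing as well.\<close>

definition codes :: "'e jump_code set" where
  "codes = {p. jtime p 0 = 0 \<and>
     (\<forall>n. jtime p (Suc n) = -1 \<and> jmark p (Suc n) = undefined \<or>
          0 \<le> jtime p n \<and> jtime p n < jtime p (Suc n))}"

text \<open>The codes that can be recovered from the path they describe: every jump changes the
  value (otherwise the path does not see it), and the jump times do not accumulate.\<close>

definition step_codes :: "'e jump_code set" where
  "step_codes = {p \<in> codes. (\<forall>n. 0 \<le> jtime p (Suc n) \<longrightarrow> jmark p (Suc n) \<noteq> jmark p n) \<and>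
     (\<forall>k::nat. \<exists>n. jtime p n < 0 \<or> real k < jtime p n)}"

definition finite_step_codes :: "'e jump_code set" where
  "finite_step_codes = {p \<in> step_codes. \<exists>n. jtime p n < 0}"

lemma step_codes_subset: "step_codes \<subseteq> codes"
  by (auto simp: step_codes_def)

lemma finite_step_codes_subset: "finite_step_codes \<subseteq> step_codes"
  by (auto simp: finite_step_codes_def)

lemma jtime_0: "p \<in> codes \<Longrightarrow> jtime p 0 = 0"
  by (simp add: codes_def)

lemma jtime_Suc_cases:
  assumes "p \<in> codes"
  obtains "jtime p (Suc n) = -1" "jmark p (Suc n) = undefined"
  | "0 \<le> jtime p n" "jtime p n < jtime p (Suc n)"
  using assms unfolding codes_def by blast

lemma absent_code:
  assumes "p \<in> codes" "jtime p n < 0"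
  shows "jtime p n = -1" "jmark p n = undefined"
proof -
  have "jtime p n = -1 \<and> jmark p n = undefined"
  proof (cases n)
    case 0
    then show ?thesis using assms by (simp add: jtime_0)
  next
    case (Suc m)
    then show ?thesis using assms by (cases rule: jtime_Suc_cases[OF assms(1), of m]) auto
  qed
  then show "jtime p n = -1" "jmark p n = undefined" by auto
qed

lemma measurable_jtime [measurable]:
  "(\<lambda>p :: 'e::polish_space jump_code. jtime p n) \<in> borel_measurable borel"
  unfolding jtime_def
  by (intro borel_measurable_continuous_onI continuous_intros continuous_on_product_coordinates)

lemma measurable_jmark [measurable]:
  "(\<lambda>p :: 'e::polish_space jump_code. jmark p n) \<in> borel_measurable borel"
  unfolding jmark_def
  by (intro borel_measurable_continuous_onI continuous_intros continuous_on_product_coordinates)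

lemma pred_jmark_eq [measurable]:
  "Measurable.pred borel (\<lambda>p :: 'e::polish_space jump_code. jmark p m = jmark p n)"
  unfolding pred_def by (intro measurable_equality_set measurable_jmark)

lemma measurable_into_jump_code:
  fixes f :: "'a \<Rightarrow> 'e::polish_space jump_code"
  assumes "\<And>n. (\<lambda>x. jtime (f x) n) \<in> borel_measurable M"
    and "\<And>n. (\<lambda>x. jmark (f x) n) \<in> borel_measurable M"
  shows "f \<in> borel_measurable M"
proof (rule measurable_coordinatewise_then_product)
  fix n
  have "(\<lambda>x. (jtime (f x) n, jmark (f x) n)) \<in> borel_measurable M"
    by (intro borel_measurable_Pair assms)
  then show "(\<lambda>x. f x n) \<in> borel_measurable M" by (simp add: jtime_def jmark_def)
qed

lemma codes_borel [measurable]: "(codes :: 'e::polish_space jump_code set) \<in> sets borel"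
proof -
  have "{p \<in> space borel. jtime (p :: 'e jump_code) 0 = 0 \<and>
     (\<forall>n. jtime p (Suc n) = -1 \<and> jmark p (Suc n) = undefined \<or>
          0 \<le> jtime p n \<and> jtime p n < jtime p (Suc n))} \<in> sets borel"
    by measurable
  then show ?thesis by (simp add: codes_def)
qed

lemma step_codes_borel [measurable]: "(step_codes :: 'e::polish_space jump_code set) \<in> sets borel"
proof -
  have "{p \<in> space borel. (p :: 'e jump_code) \<in> codes \<and>
     (\<forall>n. 0 \<le> jtime p (Suc n) \<longrightarrow> jmark p (Suc n) \<noteq> jmark p n) \<and>
     (\<forall>k::nat. \<exists>n. jtime p n < 0 \<or> real k < jtime p n)} \<in> sets borel"
    by measurable
  then show ?thesis by (simp add: step_codes_def)
qed

lemma finite_step_codes_borel [measurable]: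
  "(finite_step_codes :: 'e::polish_space jump_code set) \<in> sets borel"
proof -
  have "{p \<in> space borel. (p :: 'e jump_code) \<in> step_codes \<and> (\<exists>n. jtime p n < 0)} \<in> sets borel"
    by measurable
  then show ?thesis by (simp add: finite_step_codes_def)
qed

section \<open>Embedding all codes into the step codes\<close>

text \<open>One number in \<open>[0,1)\<close> that records a time together with the information whether the mark
  is missing (value \<open>0\<close>), the default one (values in \<open>[1/4,1/2)\<close>), or another one (values from
  \<open>1/2\<close> on). Within the last two ranges the time is compressed by \<^const>\<open>rho\<close>, which maps \<open>[0,\<infinity>)\<close> onto
  \<open>[0,1)\<close>.\<close>

definition squash :: "real \<Rightarrow> 'e \<Rightarrow> real" where
  "squash t e = (if t < 0 then 0 else if e = undefined then (1 + rho t) / 4 else (2 + rho t) / 4)"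

definition unsquash :: "real \<Rightarrow> real" where
  "unsquash s = (if s < 1/4 then -1 else if s < 1/2 then (4 * s - 1) / (2 - 4 * s)
     else (4 * s - 2) / (3 - 4 * s))"

text \<open>An arbitrary code is hidden in a step code with infinitely many jumps, the \<open>k\<close>-th of them
  in \<open>[k, k+1)\<close>, so that the jump times cannot accumulate. Jumps with even index carry the
  default mark, those with odd index a different one, hence every jump changes the value,
  also when \<open>E\<close> has only two points and the marks carry no information. Whatever the marks
  cannot record sits in the fractional parts of the jump times.\<close>

definition interleave :: "'e \<Rightarrow> 'e jump_code \<Rightarrow> 'e jump_code" where
  "interleave b p = (\<lambda>k. let t = jtime p (k div 2); e = jmark p (k div 2) in
     if even k then (real k, undefined)
     else (real k + squash t e, if t < 0 \<or> e = undefined then b else e))"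

definition deinterleave :: "'e jump_code \<Rightarrow> 'e jump_code" where
  "deinterleave p = (\<lambda>n. let s = jtime p (2 * n + 1) - real (2 * n + 1) in
     (unsquash s, if s < 1/2 then undefined else jmark p (2 * n + 1)))"

lemma interleave_simps:
  "jtime (interleave b p) k =
     (if even k then real k else real k + squash (jtime p (k div 2)) (jmark p (k div 2)))"
  "jmark (interleave b p) k =
     (if even k then undefined
      else if jtime p (k div 2) < 0 \<or> jmark p (k div 2) = undefined then b else jmark p (k div 2))"
  by (simp_all add: interleave_def jtime_def jmark_def Let_def)

lemma deinterleave_simps:
  "jtime (deinterleave p) n = unsquash (jtime p (2 * n + 1) - real (2 * n + 1))"
  "jmark (deinterleave p) n =
     (if jtime p (2 * n + 1) - real (2 * n + 1) < 1/2 then undefined else jmark p (2 * n + 1))"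
  by (simp_all add: deinterleave_def jtime_def jmark_def Let_def)

lemma squash_bounds: "0 \<le> squash t e" "squash t e < 1"
proof -
  have "0 \<le> rho x" "rho x < 1" if "0 \<le> x" for x
    using that by (auto simp: rho_def field_simps)
  from this[of t] show "0 \<le> squash t e" "squash t e < 1"
    by (auto simp: squash_def)
qed

lemma unsquash_squash:
  assumes "t < 0 \<Longrightarrow> t = -1 \<and> e = undefined"
  shows "unsquash (squash t e) = t" "squash t e < 1/2 \<longleftrightarrow> e = undefined"
proof -
  have "unsquash (squash t e) = t \<and> (squash t e < 1/2 \<longleftrightarrow> e = undefined)"
  proof (cases "t < 0")
    case True
    then show ?thesis using assms by (simp add: squash_def unsquash_def)
  next
    case False
    define r where "r = rho t"
    have r: "0 \<le> r" "r < 1" "r / (1 - r) = t"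
      using False by (auto simp: r_def rho_def field_simps)
    show ?thesis
    proof (cases "e = undefined")
      case True
      have s: "squash t e = (1 + r) / 4" using False True by (simp add: squash_def r_def)
      have "unsquash ((1 + r) / 4) = r / (1 - r)"
        using r(1,2) by (simp add: unsquash_def divide_simps)
      then have "unsquash (squash t e) = t" by (simp only: s r)
      moreover have "squash t e < 1/2" unfolding s using r(2) by simp
      ultimately show ?thesis using True by blast
    next
      case F: False
      have s: "squash t e = (2 + r) / 4" using False F by (simp add: squash_def r_def)
      have "unsquash ((2 + r) / 4) = r / (1 - r)"
        using r(1,2) by (simp add: unsquash_def divide_simps)
      then have "unsquash (squash t e) = t" by (simp only: s r)
      moreover have "\<not> squash t e < 1/2" unfolding s using r(1) by simp
      ultimately show ?thesis using F by blast
    qed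
  qed
  then show "unsquash (squash t e) = t" "squash t e < 1/2 \<longleftrightarrow> e = undefined" by auto
qed

lemma deinterleave_interleave:
  assumes "p \<in> codes"
  shows "deinterleave (interleave b p) = p"
proof (rule jump_code_eqI)
  fix n
  have s: "jtime (interleave b p) (2 * n + 1) - real (2 * n + 1) = squash (jtime p n) (jmark p n)"
    by (simp add: interleave_simps)
  note u = unsquash_squash[of "jtime p n" "jmark p n"]
  show "jtime (deinterleave (interleave b p)) n = jtime p n"
    unfolding deinterleave_simps s by (rule u) (use absent_code[OF assms] in auto)
  show "jmark (deinterleave (interleave b p)) n = jmark p n"
    unfolding deinterleave_simps s
    using u(2) absent_code[OF assms, of n] by (auto simp: interleave_simps)
qed

lemma interleave_step_codes:
  assumes "b \<noteq> undefined"
  shows "interleave b p \<in> step_codes - finite_step_codes"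
proof -
  let ?q = "interleave b p"
  have t: "real k \<le> jtime ?q k" "jtime ?q k < real k + 1" for k
    using squash_bounds[of "jtime p (k div 2)" "jmark p (k div 2)"] by (auto simp: interleave_simps)
  have nn: "0 \<le> jtime ?q k" for k using t(1)[of k] by linarith
  have "?q \<in> codes"
    unfolding codes_def
  proof (intro CollectI conjI allI disjI2)
    show "jtime ?q 0 = 0" by (simp add: interleave_simps)
    show "jtime ?q n < jtime ?q (Suc n)" for n
      using t(2)[of n] t(1)[of "Suc n"] by simp
  qed (rule nn)
  moreover have "jmark ?q (Suc n) \<noteq> jmark ?q n" for n
    using assms by (auto simp: interleave_simps)
  moreover have "\<exists>n. jtime ?q n < 0 \<or> real k < jtime ?q n" for k
    using t(1)[of "Suc k"] by (intro exI[of _ "Suc k"]) auto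
  ultimately show ?thesis using nn by (auto simp: step_codes_def finite_step_codes_def not_less)
qed

lemma interleave_measurable:
  "interleave b \<in> borel_measurable (borel :: 'e::polish_space jump_code measure)"
proof (rule measurable_into_jump_code)
  fix k :: nat
  have [measurable]: "rho \<in> borel_measurable borel" unfolding rho_def by measurable
  show "(\<lambda>x. jtime (interleave b (x :: 'e jump_code)) k) \<in> borel_measurable borel"
    unfolding interleave_simps squash_def by measurable
  show "(\<lambda>x. jmark (interleave b (x :: 'e jump_code)) k) \<in> borel_measurable borel"
    unfolding interleave_simps by measurable
qed

lemma deinterleave_measurable:
  "deinterleave \<in> borel_measurable (borel :: 'e::polish_space jump_code measure)"
  by (rule measurable_into_jump_code) (simp_all add: deinterleave_simps unsquash_def)

text \<open>The embedding to which the Cantor-Bernstein argument is applied is the identity on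
  finite step codes and \<^const>\<open>interleave\<close> elsewhere. It is injective because interleaved codes
  are infinite. Finite step codes are the codes of the values of the history process, and
  there the isomorphism must not interfere.\<close>

lemma codes_isomorphic_step_codes:
  assumes "\<exists>a b :: 'e::polish_space. a \<noteq> b"
  obtains \<phi> \<phi>' :: "'e::polish_space jump_code \<Rightarrow> 'e jump_code" where
    "\<phi> \<in> borel_measurable borel" "\<phi>' \<in> borel_measurable borel"
    "\<And>p. p \<in> codes \<Longrightarrow> \<phi> p \<in> step_codes" "\<And>p. p \<in> step_codes \<Longrightarrow> \<phi>' p \<in> codes"
    "\<And>p. p \<in> codes \<Longrightarrow> \<phi>' (\<phi> p) = p" "\<And>p. p \<in> step_codes \<Longrightarrow> \<phi> (\<phi>' p) = p"
    "\<And>p. p \<in> finite_step_codes \<Longrightarrow> \<phi> p = p"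
proof -
  obtain b :: 'e where b: "b \<noteq> undefined" using assms by metis
  define f g :: "'e jump_code \<Rightarrow> 'e jump_code"
    where "f p = (if p \<in> finite_step_codes then p else interleave b p)"
      and "g p = (if p \<in> finite_step_codes then p else deinterleave p)" for p
  note [measurable] = interleave_measurable deinterleave_measurable
  have f: "f \<in> borel_measurable borel" and g: "g \<in> borel_measurable borel"
    unfolding f_def g_def by measurable
  have into: "f p \<in> step_codes" if "p \<in> codes" for p
    using interleave_step_codes[OF b, of p] finite_step_codes_subset by (auto simp: f_def)
  have linv: "g (f p) = p" if "p \<in> codes" for p
    using interleave_step_codes[OF b, of p] deinterleave_interleave[OF that] by (auto simp: f_def g_def)
  obtain \<phi> \<phi>' :: "'e jump_code \<Rightarrow> 'e jump_code" where \<phi>: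
    "\<phi> \<in> borel_measurable borel" "\<phi>' \<in> borel_measurable borel"
    "\<And>p. p \<in> codes \<Longrightarrow> \<phi> p \<in> step_codes" "\<And>p. p \<in> step_codes \<Longrightarrow> \<phi>' p \<in> codes"
    "\<And>p. p \<in> codes \<Longrightarrow> \<phi>' (\<phi> p) = p" "\<And>p. p \<in> step_codes \<Longrightarrow> \<phi> (\<phi>' p) = p"
    "\<And>p. \<phi> p = p \<or> \<phi> p = f p"
    using borel_cantor_bernstein[OF codes_borel step_codes_borel step_codes_subset f g into linv]
    by blast
  have "\<phi> p = p" if "p \<in> finite_step_codes" for p
    using \<phi>(7)[of p] that by (auto simp: f_def)
  with \<phi>(1-6) show thesis by (rule that)
qed

section \<open>Histories as codes\<close>

text \<open>The series in \<^const>\<open>hist_dist\<close>, transported to codes. The set \<open>I\<close> of indices is a separate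
  parameter: for fixed \<open>I\<close> the series is continuous on the space of all codes.\<close>

definition code_dist_term :: "(nat \<Rightarrow> bool) \<Rightarrow> 'e::metric_space jump_code \<Rightarrow> 'e jump_code \<Rightarrow> nat \<Rightarrow> real" where
  "code_dist_term I p q n = (if I n then (1 / 2) ^ (n + 2) *
     (rho \<bar>jtime p n - jtime q n\<bar> + rho (dist (jmark p n) (jmark q n))) else 0)"

definition code_dist :: "(nat \<Rightarrow> bool) \<Rightarrow> 'e::metric_space jump_code \<Rightarrow> 'e jump_code \<Rightarrow> real" where
  "code_dist I p q = (\<Sum>n. code_dist_term I p q n)"

lemma rho_nonneg: "0 \<le> x \<Longrightarrow> 0 \<le> rho x"
  and rho_le_1: "0 \<le> x \<Longrightarrow> rho x \<le> 1"
  and rho_eq_0: "0 \<le> x \<Longrightarrow> rho x = 0 \<longleftrightarrow> x = 0"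
  by (auto simp: rho_def field_simps)

lemma rho_mono: "0 \<le> x \<Longrightarrow> x \<le> y \<Longrightarrow> rho x \<le> rho y"
  by (simp add: rho_def frac_le_eq divide_simps) (simp add: algebra_simps)

lemma rho_less_iff: "0 \<le> x \<Longrightarrow> 0 \<le> y \<Longrightarrow> rho x < rho y \<longleftrightarrow> x < y"
  by (simp add: rho_def divide_simps) (simp add: algebra_simps)

lemma rho_subadditive:
  assumes "0 \<le> x" "0 \<le> y"
  shows "rho (x + y) \<le> rho x + rho y"
proof -
  have "rho (x + y) = x / (1 + (x + y)) + y / (1 + (x + y))"
    by (simp add: rho_def add_divide_distrib)
  also have "\<dots> \<le> rho x + rho y"
    unfolding rho_def using assms by (intro add_mono divide_left_mono) (auto intro!: mult_pos_pos add_pos_nonneg)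
  finally show ?thesis .
qed

lemma rho_triangle:
  assumes "0 \<le> x" "0 \<le> y" "0 \<le> z" "x \<le> y + z"
  shows "rho x \<le> rho y + rho z"
  using rho_mono[of x "y + z"] rho_subadditive[of y z] assms by linarith

lemma code_dist_term_nonneg: "0 \<le> code_dist_term I p q n"
  by (simp add: code_dist_term_def rho_nonneg)

lemma code_dist_term_le: "code_dist_term I p q n \<le> (1/2) ^ (n + 1)"
proof -
  have "(1 / 2) ^ (n + 2) * (rho \<bar>jtime p n - jtime q n\<bar> + rho (dist (jmark p n) (jmark q n)))
      \<le> (1 / 2) ^ (n + 2) * (1 + 1)"
    by (intro mult_left_mono add_mono rho_le_1) auto
  then show ?thesis by (simp add: code_dist_term_def)
qed

lemma summable_code_dist_bound: "summable (\<lambda>n. (1/2 :: real) ^ (n + 1))"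
  by (simp add: summable_geometric)

lemma summable_code_dist_term: "summable (code_dist_term I p q)"
  by (rule summable_comparison_test'[OF summable_code_dist_bound, of 0])
     (simp only: real_norm_def abs_of_nonneg code_dist_term_nonneg code_dist_term_le)

lemma code_dist_nonneg: "0 \<le> code_dist I p q"
  unfolding code_dist_def by (intro suminf_nonneg summable_code_dist_term code_dist_term_nonneg)

lemma code_dist_le_1: "code_dist I p q \<le> 1"
proof -
  have "code_dist I p q \<le> (\<Sum>n. (1/2 :: real) ^ (n + 1))"
    unfolding code_dist_def
    by (intro suminf_le code_dist_term_le summable_code_dist_term summable_code_dist_bound)
  also have "\<dots> = 1" using power_half_series by (simp add: sums_iff)
  finally show ?thesis .
qed

lemma code_dist_commute: "code_dist I p q = code_dist I q p"
  unfolding code_dist_def code_dist_term_def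
  by (subst abs_minus_commute, subst dist_commute) (rule refl)

lemma code_dist_triangle: "code_dist I p r \<le> code_dist I p q + code_dist I q r"
proof -
  have "code_dist_term I p r n \<le> code_dist_term I p q n + code_dist_term I q r n" for n
  proof (cases "I n")
    case True
    have "rho \<bar>jtime p n - jtime r n\<bar> \<le> rho \<bar>jtime p n - jtime q n\<bar> + rho \<bar>jtime q n - jtime r n\<bar>"
      by (rule rho_triangle) auto
    moreover have "rho (dist (jmark p n) (jmark r n)) \<le>
        rho (dist (jmark p n) (jmark q n)) + rho (dist (jmark q n) (jmark r n))"
      by (rule rho_triangle) (auto intro: dist_triangle)
    ultimately show ?thesis
      using True by (simp add: code_dist_term_def flip: distrib_left)
  qed (simp add: code_dist_term_def)
  then have "code_dist I p r \<le> (\<Sum>n. code_dist_term I p q n + code_dist_term I q r n)"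
    unfolding code_dist_def by (intro suminf_le summable_add summable_code_dist_term)
  then show ?thesis
    unfolding code_dist_def by (simp add: suminf_add summable_code_dist_term)
qed

lemma code_dist_term_le_dist: "code_dist_term I p q n \<le> code_dist I p q"
  using sum_le_suminf[OF summable_code_dist_term, of "{n}" I p q] code_dist_term_nonneg
  unfolding code_dist_def by force

lemma code_dist_eq_0_iff:
  "code_dist I p q = 0 \<longleftrightarrow> (\<forall>n. I n \<longrightarrow> jtime p n = jtime q n \<and> jmark p n = jmark q n)"
proof -
  have "code_dist I p q = 0 \<longleftrightarrow> (\<forall>n. code_dist_term I p q n = 0)"
    unfolding code_dist_def
    by (rule suminf_eq_zero_iff[OF summable_code_dist_term code_dist_term_nonneg])
  also have "\<dots> \<longleftrightarrow> (\<forall>n. I n \<longrightarrow> jtime p n = jtime q n \<and> jmark p n = jmark q n)"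
    by (intro all_cong1)
       (auto simp: code_dist_term_def add_nonneg_eq_0_iff rho_nonneg rho_eq_0)
  finally show ?thesis .
qed

text \<open>The terms are continuous, and dominated by a geometric series uniformly in the code.\<close>

lemma continuous_code_dist: "continuous_on UNIV (code_dist I (p :: 'e::metric_space jump_code))"
proof -
  have rho: "continuous_on UNIV (\<lambda>q :: 'e jump_code. rho (g q))"
    if "continuous_on UNIV g" "\<And>q. 0 \<le> g q" for g
  proof -
    have "1 + g q \<noteq> 0" for q using that(2)[of q] by linarith
    then show ?thesis unfolding rho_def using that(1) by (intro continuous_intros) auto
  qed
  have "continuous_on UNIV (\<lambda>q. code_dist_term I p q n)" for n
    unfolding code_dist_term_def jtime_def jmark_def
    by (cases "I n"; simp del: power_Suc)
       (intro continuous_intros rho continuous_on_product_coordinates; simp)+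
  then have "continuous_on UNIV (\<lambda>q. \<Sum>i<n. code_dist_term I p q i)" for n
    by (intro continuous_intros)
  moreover have "uniform_limit UNIV (\<lambda>n q. \<Sum>i<n. code_dist_term I p q i)
      (\<lambda>q. \<Sum>i. code_dist_term I p q i) sequentially"
    by (rule Weierstrass_m_test[OF _ summable_code_dist_bound])
       (simp only: real_norm_def abs_of_nonneg code_dist_term_nonneg code_dist_term_le)
  ultimately show ?thesis
    unfolding code_dist_def
    by (intro uniform_limit_theorem[where F = sequentially]) auto
qed

definition encode :: "'e history \<Rightarrow> 'e jump_code" where
  "encode h = (\<lambda>n. if fst h n < \<infinity> then (enn2real (fst h n), the (snd h n)) else (-1, undefined))"

definition decode :: "'e jump_code \<Rightarrow> 'e history" where
  "decode p = (\<lambda>n. if jtime p n < 0 then \<infinity> else ennreal (jtime p n),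
               \<lambda>n. if jtime p n < 0 then None else Some (jmark p n))"

lemma encode_simps:
  "jtime (encode h) n = (if fst h n < \<infinity> then enn2real (fst h n) else -1)"
  "jmark (encode h) n = (if fst h n < \<infinity> then the (snd h n) else undefined)"
  by (simp_all add: encode_def jtime_def jmark_def)

lemma jtime_encode_nonneg_iff: "0 \<le> jtime (encode h) n \<longleftrightarrow> fst h n < \<infinity>"
  by (simp add: encode_simps)

lemma histories_0: "h \<in> histories \<Longrightarrow> fst h 0 = 0"
  by (auto simp: histories_def)

lemma histories_None_iff: "h \<in> histories \<Longrightarrow> snd h n = None \<longleftrightarrow> fst h n = \<infinity>"
  by (cases n) (auto simp: histories_def)

lemma histories_mono:
  assumes "h \<in> histories" "m \<le> n"
  shows "fst h m \<le> fst h n"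
proof -
  have "fst h i \<le> fst h (Suc i)" for i
    using assms by (cases i) (auto simp: histories_def split: prod.splits)
  then show ?thesis using assms(2) by (rule lift_Suc_mono_le)
qed

lemma histories_strict:
  assumes "h \<in> histories" "fst h n < \<infinity>"
  shows "fst h n < fst h (Suc n)"
proof (cases n)
  case 0
  have "0 < fst h 1" using assms(1) by (auto simp: histories_def split: prod.splits)
  then show ?thesis using histories_0[OF assms(1)] 0 by simp
next
  case (Suc m)
  then show ?thesis using assms by (auto simp: histories_def split: prod.splits)
qed

text \<open>Since the times increase, the indices of the finite ones form an initial segment.\<close>

lemma le_hist_length_iff:
  assumes "h \<in> histories"
  shows "enat n \<le> hist_length h \<longleftrightarrow> fst h n < \<infinity>"
proof
  assume L: "enat n \<le> hist_length h"
  show "fst h n < \<infinity>"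
  proof (rule ccontr)
    assume inf: "\<not> fst h n < \<infinity>"
    then have "n \<noteq> 0" using histories_0[OF assms] by (intro notI) simp
    have "hist_length h \<le> enat (n - 1)"
      unfolding hist_length_def
    proof (rule SUP_least)
      fix m assume "m \<in> {m. 1 \<le> m \<and> fst h m < \<infinity>}"
      then have "\<not> n \<le> m" using histories_mono[OF assms, of n m] inf by auto
      then show "enat m \<le> enat (n - 1)" by simp
    qed
    with L \<open>n \<noteq> 0\<close> show False by (metis diff_less enat_ord_simps(1) leD less_one neq0_conv order_trans)
  qed
next
  assume fin: "fst h n < \<infinity>"
  show "enat n \<le> hist_length h"
  proof (cases "n = 0")
    case False
    with fin show ?thesis unfolding hist_length_def by (intro SUP_upper) auto
  qed (simp add: zero_enat_def[symmetric])
qed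

lemma hist_length_eqI:
  assumes "h \<in> histories" "\<And>n. fst h n < \<infinity> \<longleftrightarrow> enat n \<le> N"
  shows "hist_length h = N"
proof -
  have iff: "enat n \<le> hist_length h \<longleftrightarrow> enat n \<le> N" for n
    using assms by (simp add: le_hist_length_iff)
  have "a \<le> b" if "\<And>n. enat n \<le> a \<Longrightarrow> enat n \<le> b" for a b :: enat
  proof (cases a)
    case infinity
    then show ?thesis
      using that by (metis enat_ord_code(4) enat_ord_simps(5) Suc_ile_eq less_le_not_le not_infinity_eq enat.exhaust)
  qed (use that in auto)
  then show ?thesis using iff by (metis antisym)
qed

lemma encode_codes:
  assumes h: "h \<in> histories"
  shows "encode h \<in> codes"
  unfolding codes_def
proof (intro CollectI conjI allI)
  show "jtime (encode h) 0 = 0" using histories_0[OF h] by (simp add: encode_simps)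
  fix n
  show "jtime (encode h) (Suc n) = -1 \<and> jmark (encode h) (Suc n) = undefined \<or>
      0 \<le> jtime (encode h) n \<and> jtime (encode h) n < jtime (encode h) (Suc n)"
  proof (cases "fst h (Suc n) < \<infinity>")
    case True
    moreover have "fst h n \<le> fst h (Suc n)" by (rule histories_mono[OF h]) simp
    ultimately have fin: "fst h n < \<infinity>" by (rule le_less_trans[rotated])
    then have "enn2real (fst h n) < enn2real (fst h (Suc n))"
      using histories_strict[OF h fin] True by (simp add: enn2real_less_iff ennreal_enn2real_if)
    then show ?thesis using True fin by (simp add: encode_simps)
  qed (simp add: encode_simps)
qed

lemma decode_encode:
  assumes h: "h \<in> histories"
  shows "decode (encode h) = h"
proof (rule prod_eqI)
  show "fst (decode (encode h)) = fst h"
    by (rule ext) (auto simp: decode_def encode_simps ennreal_enn2real_if less_top[symmetric])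
  show "snd (decode (encode h)) = snd h"
    using histories_None_iff[OF h]
    by (auto simp: decode_def encode_simps less_top[symmetric] fun_eq_iff eq_commute[of None])
qed

lemma decode_histories:
  assumes p: "p \<in> codes"
  shows "decode p \<in> histories"
proof -
  have z: "jtime p 0 = 0" by (rule jtime_0[OF p])
  have s: "jtime p (Suc n) < 0 \<or> 0 \<le> jtime p n \<and> jtime p n < jtime p (Suc n)" for n
    by (rule jtime_Suc_cases[OF p, of n]) auto
  have "0 < jtime p (Suc n)" if "\<not> jtime p (Suc n) < 0" for n
    using s[of n] that by linarith
  then have pos: "0 < jtime p n" if "\<not> jtime p n < 0" "1 \<le> n" for n
    using that by (cases n) auto
  show ?thesis
    unfolding histories_def decode_def mem_Collect_eq prod.case
  proof (intro conjI allI impI)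
    fix n :: nat assume n: "1 \<le> n"
    show "0 < (if jtime p n < 0 then \<infinity> else ennreal (jtime p n))"
      using pos[OF _ n] by (simp add: ennreal_less_zero_iff)
    show "(if jtime p n < 0 then \<infinity> else ennreal (jtime p n))
        \<le> (if jtime p (Suc n) < 0 then \<infinity> else ennreal (jtime p (Suc n)))"
      using s[of n] by (auto intro!: ennreal_leI)
    show "(if jtime p n < 0 then \<infinity> else ennreal (jtime p n))
        < (if jtime p (Suc n) < 0 then \<infinity> else ennreal (jtime p (Suc n)))"
      if "(if jtime p n < 0 then \<infinity> else ennreal (jtime p n)) < \<infinity>"
      using s[of n] that by (auto simp: ennreal_less_iff split: if_splits)
  qed (auto simp: z)
qed

lemma encode_decode:
  assumes p: "p \<in> codes"
  shows "encode (decode p) = p"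
  by (rule jump_code_eqI) (auto simp: encode_simps decode_def absent_code[OF p])

lemma hist_dist_eq:
  assumes "h \<in> histories" "h' \<in> histories" "hist_length h = hist_length h'"
  shows "hist_dist h h' = code_dist (\<lambda>n. enat n \<le> hist_length h) (encode h) (encode h')"
  unfolding hist_dist_def code_dist_def code_dist_term_def
  using assms(3) le_hist_length_iff[OF assms(1)] le_hist_length_iff[OF assms(2)]
  by (auto intro!: suminf_cong simp: encode_simps)

text \<open>Histories of different lengths are at distance \<open>1\<close>, which bounds the series from above;
  this is what makes the triangle inequality hold across different lengths.\<close>

interpretation hist: Metric_space histories "hist_dist :: 'e::metric_space history \<Rightarrow> _"
proof
  let ?raw = "\<lambda>h :: 'e history. \<lambda>n. (enn2real (fst h n), the (snd h n))"
  have raw: "hist_dist h h' =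
      (if hist_length h = hist_length h' then code_dist (\<lambda>n. enat n \<le> hist_length h) (?raw h) (?raw h') else 1)"
    for h h' :: "'e history"
    unfolding hist_dist_def code_dist_def code_dist_term_def jtime_def jmark_def fst_conv snd_conv ..
  show nn: "0 \<le> hist_dist h h'" for h h' :: "'e history"
    by (simp add: raw code_dist_nonneg)
  show "hist_dist h h' = hist_dist h' h" for h h' :: "'e history"
    by (simp add: raw code_dist_commute)
  show "(hist_dist h h' = 0) = (h = h')" if "h \<in> histories" "h' \<in> histories" for h h' :: "'e history"
  proof
    assume d: "hist_dist h h' = 0"
    then have len: "hist_length h = hist_length h'" by (auto simp: hist_dist_def split: if_splits)
    have "jtime (encode h) n = jtime (encode h') n \<and> jmark (encode h) n = jmark (encode h') n" for n
    proof (cases "enat n \<le> hist_length h")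
      case True
      then show ?thesis using d unfolding hist_dist_eq[OF that len] code_dist_eq_0_iff by blast
    next
      case False
      then have "\<not> fst h n < \<infinity>" "\<not> fst h' n < \<infinity>"
        using le_hist_length_iff that len by metis+
      then show ?thesis by (simp add: encode_simps)
    qed
    then have "encode h = encode h'" by (intro jump_code_eqI) auto
    then show "h = h'" using decode_encode that by metis
  qed (use that in \<open>simp add: hist_dist_eq code_dist_eq_0_iff\<close>)
  show "hist_dist h h'' \<le> hist_dist h h' + hist_dist h' h''" for h h' h'' :: "'e history"
  proof (cases "hist_length h = hist_length h' \<and> hist_length h' = hist_length h''")
    case True
    then show ?thesis by (simp add: raw code_dist_triangle)
  next
    case False
    have "hist_dist h h'' \<le> 1" by (simp add: raw code_dist_le_1)
    moreover have "hist_dist h h' = 1 \<or> hist_dist h' h'' = 1" using False by (auto simp: hist_dist_def)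
    ultimately show ?thesis using nn[of h h'] nn[of h' h''] by linarith
  qed
qed

lemma space_borel_of: "space (borel_of U) = topspace U"
  unfolding borel_of_def by (rule space_measure_of) (auto dest: openin_subset)

lemma sets_borel_of: "sets (borel_of U) = sigma_sets (topspace U) {V. openin U V}"
  unfolding borel_of_def by (rule sets_measure_of) (auto dest: openin_subset)

lemma openin_in_borel_of: "openin U V \<Longrightarrow> V \<in> sets (borel_of U)"
  by (auto simp: sets_borel_of)

lemma measurable_into_borel_of:
  assumes "\<And>x. x \<in> space M \<Longrightarrow> f x \<in> topspace U"
    and "\<And>V. openin U V \<Longrightarrow> f -` V \<inter> space M \<in> sets M"
  shows "f \<in> measurable M (borel_of U)"
proof (rule measurable_sigma_sets[OF sets_borel_of])
  show "{V. openin U V} \<subseteq> Pow (topspace U)" by (auto dest: openin_subset)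
qed (use assms in auto)

text \<open>Every coordinate of the code is continuous: a distance below \<open>1\<close> forces equal lengths, and
  then the \<open>n\<close>-th term of the series controls the \<open>n\<close>-th coordinate.\<close>

lemma encode_measurable: "encode \<in> borel_measurable (histories_borel :: 'e::polish_space history measure)"
proof (rule measurable_coordinatewise_then_product)
  fix n
  show "(\<lambda>h. encode h n) \<in> borel_measurable (histories_borel :: 'e history measure)"
  proof (rule borel_measurableI)
    fix V :: "(real \<times> 'e) set" assume V: "open V"
    let ?A = "(\<lambda>h. encode h n) -` V \<inter> (histories :: 'e history set)"
    have "openin hist.mtopology ?A"
      unfolding hist.openin_mtopology
    proof (intro conjI allI impI)
      fix h assume h: "h \<in> ?A"
      then obtain r where r: "r > 0" "ball (encode h n) r \<subseteq> V"
        using V by (auto simp: open_contains_ball)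
      \<comment> \<open>In the product metric, \<open>r / 2\<close> in each component gives a distance below \<open>r\<close>.\<close>
      define s where "s = (1/2) ^ (n + 2) * rho (r / 2)"
      have "0 < rho (r / 2)" using r(1) by (simp add: rho_def)
      then have s0: "0 < s" by (simp add: s_def)
      have s1: "s < 1"
      proof -
        have "s \<le> (1/2) ^ (n + 2) * 1" unfolding s_def
          using r(1) by (intro mult_left_mono rho_le_1) auto
        also have "\<dots> < 1" by (simp add: power_less_one_iff flip: power_Suc)
        finally show ?thesis .
      qed
      have "hist.mball h s \<subseteq> ?A"
      proof
        fix h' assume "h' \<in> hist.mball h s"
        then have h': "h' \<in> histories" "hist_dist h h' < s" by auto
        have hH: "h \<in> histories" using h by simp
        have len: "hist_length h = hist_length h'"
          using h'(2) s1 by (auto simp: hist_dist_def split: if_splits)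
        have "encode h' n \<in> V"
        proof (cases "enat n \<le> hist_length h")
          case True
          let ?t = "\<bar>jtime (encode h) n - jtime (encode h') n\<bar>"
          let ?e = "dist (jmark (encode h) n) (jmark (encode h') n)"
          have "(1/2) ^ (n + 2) * (rho ?t + rho ?e) < s"
            using code_dist_term_le_dist[of "\<lambda>n. enat n \<le> hist_length h" "encode h" "encode h'" n] True h'(2)
            by (simp add: hist_dist_eq[OF hH h'(1) len] code_dist_term_def)
          then have "rho ?t + rho ?e < rho (r / 2)" by (simp add: s_def)
          then have "rho ?t < rho (r / 2)" "rho ?e < rho (r / 2)"
            using rho_nonneg[of ?t] rho_nonneg[of ?e] by (simp, simp)+
          then have "?t < r / 2" "?e < r / 2" using r(1) by (simp_all add: rho_less_iff)
          then have "dist (encode h n) (encode h' n) < r"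
            using sqrt_sum_squares_le_sum_abs[of "dist (fst (encode h n)) (fst (encode h' n))"
                "dist (snd (encode h n)) (snd (encode h' n))"]
            by (simp add: dist_prod_def jtime_def jmark_def dist_real_def)
          then show ?thesis using r(2) by auto
        next
          case False
          then have "\<not> fst h n < \<infinity>" "\<not> fst h' n < \<infinity>"
            using le_hist_length_iff hH h'(1) len by metis+
          then have "encode h' n = encode h n" by (simp add: encode_def)
          then show ?thesis using h by simp
        qed
        then show "h' \<in> ?A" using h'(1) by simp
      qed
      then show "\<exists>r>0. hist.mball h r \<subseteq> ?A" using s0 by blast
    qed simp
    then show "(\<lambda>h. encode h n) -` V \<inter> space histories_borel \<in> sets (histories_borel :: 'e history measure)"
      by (simp add: space_borel_of openin_in_borel_of)
  qed
qed

text \<open>The topology of histories is finer than that of their codes, because histories of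
  different lengths are far apart. But there are only countably many lengths, and for a
  fixed length an open set of histories is a union of balls, each of which is cut out by
  the continuous function \<^const>\<open>code_dist\<close>.\<close>

lemma decode_measurable:
  "decode \<in> measurable (restrict_space borel codes) (histories_borel :: 'e::polish_space history measure)"
proof (rule measurable_into_borel_of)
  show "decode p \<in> topspace hist.mtopology" if "p \<in> space (restrict_space borel codes)"
    for p :: "'e jump_code"
    using that by (simp add: space_restrict_space decode_histories)
  fix U :: "'e history set" assume U: "openin hist.mtopology U"
  then have "\<forall>h\<in>U. \<exists>r>0. hist.mball h r \<subseteq> U" by (auto simp: hist.openin_mtopology)
  then obtain r where r: "\<And>h. h \<in> U \<Longrightarrow> 0 < r h \<and> hist.mball h (r h) \<subseteq> U" by metis
  have UH: "U \<subseteq> histories" using openin_subset[OF U] by simp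
  define V where "V N = (\<Union>h\<in>{h \<in> U. hist_length h = N}.
      {p. code_dist (\<lambda>n. enat n \<le> N) (encode h) p < r h})" for N
  have [measurable]: "V N \<in> sets borel" for N
    unfolding V_def
    by (intro borel_open open_UN ballI open_Collect_less continuous_code_dist continuous_on_const)
  have "decode -` U \<inter> codes =
      (\<Union>N. {p \<in> space borel. p \<in> codes \<and> (\<forall>n. (0 \<le> jtime p n) = (enat n \<le> N)) \<and> p \<in> V N})"
    (is "?L = ?R")
  proof
    show "?L \<subseteq> ?R"
    proof
      fix p assume p: "p \<in> ?L"
      define h where "h = decode p"
      have hU: "h \<in> U" and enc: "encode h = p"
        using p encode_decode by (auto simp: h_def)
      then have hH: "h \<in> histories" using UH by auto
      have "p \<in> V (hist_length h)"
      proof -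
        have "code_dist (\<lambda>n. enat n \<le> hist_length h) (encode h) p = 0"
          unfolding enc code_dist_eq_0_iff by simp
        then show ?thesis unfolding V_def using hU r[OF hU] by (intro UN_I[of h]) auto
      qed
      moreover have "(0 \<le> jtime p n) = (enat n \<le> hist_length h)" for n
        using jtime_encode_nonneg_iff[of h n] by (simp add: enc le_hist_length_iff[OF hH])
      ultimately show "p \<in> ?R" using p by auto
    qed
    show "?R \<subseteq> ?L"
    proof
      fix p assume "p \<in> ?R"
      then obtain N h where p: "p \<in> codes" and N: "\<And>n. (0 \<le> jtime p n) = (enat n \<le> N)"
        and h: "h \<in> U" "hist_length h = N" and d: "code_dist (\<lambda>n. enat n \<le> N) (encode h) p < r h"
        by (auto simp: V_def)
      define h' where "h' = decode p"
      have h': "h' \<in> histories" and enc: "encode h' = p"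
        using p by (simp_all add: h'_def decode_histories encode_decode)
      have len: "hist_length h' = N"
        by (rule hist_length_eqI[OF h']) (use N jtime_encode_nonneg_iff[of h'] enc in simp)
      have hH: "h \<in> histories" using h UH by auto
      have "hist_dist h h' < r h"
        using d by (simp add: hist_dist_eq[OF hH h'] h len enc)
      then have "h' \<in> hist.mball h (r h)" using hH h' by simp
      then show "p \<in> ?L" using r[OF h(1)] p by (auto simp: h'_def)
    qed
  qed
  also have "\<dots> \<in> sets borel" by measurable
  finally have "decode -` U \<inter> codes \<in> sets borel" .
  then show "decode -` U \<inter> space (restrict_space borel codes) \<in> sets (restrict_space borel codes)"
    by (simp add: sets_restrict_space_iff space_restrict_space)
qed

section \<open>Step paths and their codes\<close>

definition pending :: "'e jump_code \<Rightarrow> nat \<Rightarrow> real \<Rightarrow> bool" where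
  "pending p n s \<longleftrightarrow> jtime p n < 0 \<or> s < jtime p n"

definition jump_index :: "'e jump_code \<Rightarrow> real \<Rightarrow> nat" where
  "jump_index p s = (LEAST n. pending p (Suc n) s)"

definition step_path :: "'e jump_code \<Rightarrow> real \<Rightarrow> 'e" where
  "step_path p = restrict (\<lambda>s. jmark p (jump_index p s)) {0..}"

lemma jtime_Suc_nonneg:
  assumes "p \<in> codes" "0 \<le> jtime p (Suc n)"
  shows "0 \<le> jtime p n" "jtime p n < jtime p (Suc n)"
  using assms(2) by (cases rule: jtime_Suc_cases[OF assms(1), of n]; simp)+

lemma jtime_less:
  assumes "p \<in> codes" "0 \<le> jtime p n" "m < n"
  shows "0 \<le> jtime p m" "jtime p m < jtime p n"
proof -
  have "0 \<le> jtime p m \<and> jtime p m < jtime p n"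
    using assms(2,3)
  proof (induction n)
    case (Suc n)
    have n: "0 \<le> jtime p n" "jtime p n < jtime p (Suc n)"
      using jtime_Suc_nonneg[OF assms(1) Suc.prems(1)] by auto
    then show ?case using Suc by (cases "m = n") force+
  qed simp
  then show "0 \<le> jtime p m" "jtime p m < jtime p n" by auto
qed

lemma jtime_less_iff:
  assumes "p \<in> codes" "0 \<le> jtime p m" "0 \<le> jtime p n"
  shows "jtime p m < jtime p n \<longleftrightarrow> m < n"
  using jtime_less(2)[OF assms(1)] assms(2,3) by (metis linorder_neqE_nat order_less_asym)

lemma jump_index_eq:
  assumes "p \<in> codes" "0 \<le> jtime p n" "jtime p n \<le> s" "pending p (Suc n) s"
  shows "jump_index p s = n"
  unfolding jump_index_def
proof (rule Least_equality)
  fix m assume m: "pending p (Suc m) s"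
  show "n \<le> m"
  proof (rule ccontr)
    assume "\<not> n \<le> m"
    then have "Suc m = n \<or> Suc m < n" by auto
    then have "0 \<le> jtime p (Suc m) \<and> jtime p (Suc m) \<le> jtime p n"
      using jtime_less[OF assms(1,2), of "Suc m"] assms(2) by auto
    with m assms(3) show False by (auto simp: pending_def)
  qed
qed fact

lemma step_path_eq:
  assumes "p \<in> codes" "0 \<le> jtime p n" "jtime p n \<le> s" "pending p (Suc n) s"
  shows "step_path p s = jmark p n"
  using jump_index_eq[OF assms] assms(2,3) by (simp add: step_path_def)

lemma step_path_at_jump:
  assumes "p \<in> codes" "0 \<le> jtime p n"
  shows "step_path p (jtime p n) = jmark p n"
proof (rule step_path_eq[OF assms order_refl])
  show "pending p (Suc n) (jtime p n)"
    by (cases rule: jtime_Suc_cases[OF assms(1), of n]) (auto simp: pending_def)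
qed

lemma step_codesD:
  assumes "p \<in> step_codes"
  shows "p \<in> codes" "0 \<le> jtime p (Suc n) \<Longrightarrow> jmark p (Suc n) \<noteq> jmark p n"
  using assms by (auto simp: step_codes_def)

text \<open>Jump times that do not accumulate leave a jump that is still pending at time \<open>s\<close>; its
  predecessor determines the value at \<open>s\<close>.\<close>

lemma last_jump:
  assumes "p \<in> step_codes" "0 \<le> s"
  obtains n where "0 \<le> jtime p n" "jtime p n \<le> s" "pending p (Suc n) s" "step_path p s = jmark p n"
proof -
  obtain k :: nat where k: "s \<le> real k" using real_arch_simple by blast
  obtain m where m: "jtime p m < 0 \<or> real k < jtime p m"
    using assms(1) by (auto simp: step_codes_def)
  have c: "p \<in> codes" by (rule step_codesD[OF assms(1)])
  have "m \<noteq> 0" using m jtime_0[OF c] by (intro notI) auto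
  then have "pending p (Suc (m - 1)) s" using m k by (auto simp: pending_def)
  then have pend: "pending p (Suc (jump_index p s)) s"
    unfolding jump_index_def by (rule LeastI)
  have "0 \<le> jtime p (jump_index p s) \<and> jtime p (jump_index p s) \<le> s"
  proof (cases "jump_index p s")
    case 0
    then show ?thesis using assms(2) jtime_0[OF c] by simp
  next
    case (Suc i)
    then have "\<not> pending p (Suc i) s"
      using not_less_Least[of i "\<lambda>n. pending p (Suc n) s"] by (simp add: jump_index_def)
    then show ?thesis using Suc by (auto simp: pending_def)
  qed
  with pend show thesis using that[of "jump_index p s"] step_path_eq[OF c] by blast
qed

lemma jump_index_mono:
  assumes "p \<in> codes" "0 \<le> jtime p m" "jtime p m \<le> s" "pending p (Suc n) s"
  shows "m \<le> n"
proof (rule ccontr)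
  assume "\<not> m \<le> n"
  then have "Suc n = m \<or> Suc n < m" by auto
  then have "0 \<le> jtime p (Suc n) \<and> jtime p (Suc n) \<le> jtime p m"
    using jtime_less[OF assms(1,2), of "Suc n"] assms(2) by auto
  with assms(3,4) show False by (auto simp: pending_def)
qed

lemma step_path_right:
  assumes "p \<in> step_codes" "0 \<le> t"
  shows "(step_path p \<longlongrightarrow> step_path p t) (at_right t)"
proof -
  obtain n where n: "0 \<le> jtime p n" "jtime p n \<le> t" "pending p (Suc n) t" "step_path p t = jmark p n"
    by (rule last_jump[OF assms])
  \<comment> \<open>The mark stays the same until the next jump, if there is one.\<close>
  define b where "b = (if jtime p (Suc n) < 0 then t + 1 else jtime p (Suc n))"
  have b: "t < b" using n(3) by (auto simp: b_def pending_def)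
  have "step_path p s = step_path p t" if "t < s" "s < b" for s
  proof -
    have "pending p (Suc n) s" using that by (auto simp: b_def pending_def split: if_splits)
    then show ?thesis using n that step_path_eq[OF step_codesD(1)[OF assms(1)], of n s] by simp
  qed
  then have "eventually (\<lambda>s. step_path p s = step_path p t) (at_right t)"
    unfolding eventually_at_right[OF b] using b by blast
  then show ?thesis by (rule tendsto_eventually)
qed

lemma step_path_before_jump:
  assumes "p \<in> codes" "0 \<le> jtime p (Suc n)" "jtime p n \<le> s" "s < jtime p (Suc n)"
  shows "step_path p s = jmark p n"
  using assms jtime_less[OF assms(1,2), of n] by (intro step_path_eq) (auto simp: pending_def)

lemma tendsto_left_of_constant:
  fixes f :: "real \<Rightarrow> 'e::topological_space"
  assumes "s < t" "\<And>u. s < u \<Longrightarrow> u < t \<Longrightarrow> f u = c"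
  shows "(f \<longlongrightarrow> c) (at_left t)"
proof (rule tendsto_eventually)
  show "eventually (\<lambda>u. f u = c) (at_left t)"
    unfolding eventually_at_left[OF assms(1)] using assms by blast
qed

lemma step_path_left:
  assumes p: "p \<in> step_codes" and t: "0 < t"
  shows "\<exists>l. (step_path p \<longlongrightarrow> l) (at_left t) \<and> ((\<exists>k. jtime p (Suc k) = t) \<or> l = step_path p t)"
proof -
  have c: "p \<in> codes" by (rule step_codesD[OF p])
  obtain n where n: "0 \<le> jtime p n" "jtime p n \<le> t" "pending p (Suc n) t" "step_path p t = jmark p n"
    using last_jump[OF p] t by (metis less_imp_le)
  show ?thesis
  proof (cases "jtime p n = t")
    case True
    then obtain m where m: "n = Suc m" using t jtime_0[OF c] by (cases n) auto
    have "jtime p m < t" using jtime_less[OF c n(1), of m] True m by simp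
    moreover have "step_path p u = jmark p m" if "jtime p m < u" "u < t" for u
      using that True m n(1) by (intro step_path_before_jump[OF c]) auto
    ultimately show ?thesis using tendsto_left_of_constant m True by blast
  next
    case False
    then have "jtime p n < t" using n(2) by simp
    moreover have "step_path p u = jmark p n" if "jtime p n < u" "u < t" for u
      using that n by (intro step_path_eq[OF c]) (auto simp: pending_def)
    ultimately show ?thesis using tendsto_left_of_constant n(4) by metis
  qed
qed

lemma step_path_cadlag_paths:
  assumes "p \<in> step_codes"
  shows "step_path p \<in> cadlag_paths"
  using step_path_right[OF assms] step_path_left[OF assms]
  by (auto simp: cadlag_paths_def cadlag_def step_path_def)

lemma isCont_iff_left_limit:
  fixes x :: "real \<Rightarrow> 'e::t2_space"
  assumes "(x \<longlongrightarrow> x t) (at_right t)" "(x \<longlongrightarrow> l) (at_left t)"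
  shows "isCont x t \<longleftrightarrow> l = x t"
proof
  assume "isCont x t"
  then have "(x \<longlongrightarrow> x t) (at_left t)"
    by (simp add: isCont_def filterlim_at_split)
  then show "l = x t" using tendsto_unique[OF _ assms(2)] by auto
next
  assume "l = x t"
  then show "isCont x t" using assms by (simp add: isCont_def filterlim_at_split)
qed

text \<open>Jumps of a step code change the mark, so each of them is visible as a discontinuity.\<close>

lemma discontinuities_step_path:
  fixes p :: "'e::t2_space jump_code"
  assumes p: "p \<in> step_codes"
  shows "discontinuities (step_path p) = {t. 0 < t \<and> (\<exists>k. jtime p (Suc k) = t)}"
proof (intro set_eqI)
  fix t
  have c: "p \<in> codes" by (rule step_codesD[OF p])
  show "t \<in> discontinuities (step_path p) \<longleftrightarrow> t \<in> {t. 0 < t \<and> (\<exists>k. jtime p (Suc k) = t)}"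
  proof (cases "0 < t")
    case True
    then have right: "(step_path p \<longlongrightarrow> step_path p t) (at_right t)"
      using step_path_right[OF p] by simp
    have "\<not> isCont (step_path p) t" if "jtime p (Suc k) = t" for k
    proof -
      have nn: "0 \<le> jtime p (Suc k)" using that True by simp
      have "(step_path p \<longlongrightarrow> jmark p k) (at_left t)"
        using jtime_less(2)[OF c nn, of k] that
        by (intro tendsto_left_of_constant[of "jtime p k"] step_path_before_jump[OF c nn]) auto
      moreover have "step_path p t = jmark p (Suc k)" using step_path_at_jump[OF c nn] that by simp
      ultimately show ?thesis
        using isCont_iff_left_limit[OF right] step_codesD(2)[OF p nn] by auto
    qed
    moreover have "isCont (step_path p) t" if "\<nexists>k. jtime p (Suc k) = t"
      using step_path_left[OF p True] that isCont_iff_left_limit[OF right] by blast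
    ultimately show ?thesis using True by (auto simp: discontinuities_def)
  qed (simp add: discontinuities_def)
qed

lemma step_path_step_paths:
  fixes p :: "'e::t2_space jump_code"
  assumes p: "p \<in> step_codes"
  shows "step_path p \<in> step_paths"
  unfolding step_paths_def
proof (intro CollectI conjI allI impI)
  have c: "p \<in> codes" by (rule step_codesD[OF p])
  show "step_path p \<in> cadlag_paths" by (rule step_path_cadlag_paths[OF p])
  show "step_path p s = step_path p t"
    if "0 \<le> s" "s \<le> t" and none: "discontinuities (step_path p) \<inter> {s<..t} = {}" for s t
  proof -
    obtain n where n: "0 \<le> jtime p n" "jtime p n \<le> s" "pending p (Suc n) s" "step_path p s = jmark p n"
      by (rule last_jump[OF p \<open>0 \<le> s\<close>])
    have "pending p (Suc n) t"
    proof (rule ccontr)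
      assume "\<not> pending p (Suc n) t"
      then have "jtime p (Suc n) \<in> discontinuities (step_path p) \<inter> {s<..t}"
        using n(3) that(1) unfolding discontinuities_step_path[OF p] pending_def by auto
      with none show False by simp
    qed
    then show ?thesis using step_path_eq[OF c n(1), of t] n that by simp
  qed
  show "finite (discontinuities (step_path p) \<inter> {0<..t})" for t
  proof (cases "0 \<le> t")
    case True
    obtain n where n: "pending p (Suc n) t" by (rule last_jump[OF p True])
    have "discontinuities (step_path p) \<inter> {0<..t} \<subseteq> jtime p ` {..n}"
    proof
      fix u assume "u \<in> discontinuities (step_path p) \<inter> {0<..t}"
      then obtain k where k: "jtime p (Suc k) = u" "0 < u" "u \<le> t"
        unfolding discontinuities_step_path[OF p] by auto
      then have "Suc k \<le> n" by (intro jump_index_mono[OF c _ _ n]) auto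
      with k show "u \<in> jtime p ` {..n}" by blast
    qed
    then show ?thesis using finite_subset by blast
  qed simp
qed

text \<open>Discontinuities of a step path are locally finite, so the least one after \<open>s\<close> exists as
  soon as there is any; otherwise the time is that of a missing jump.\<close>

definition next_jump :: "(real \<Rightarrow> 'e::topological_space) \<Rightarrow> real \<Rightarrow> real" where
  "next_jump x s = (if \<exists>u\<in>discontinuities x. s < u
     then LEAST u. u \<in> discontinuities x \<and> s < u else -1)"

fun nth_jump :: "(real \<Rightarrow> 'e::topological_space) \<Rightarrow> nat \<Rightarrow> real" where
  "nth_jump x 0 = 0"
| "nth_jump x (Suc n) = (if nth_jump x n < 0 then -1 else next_jump x (nth_jump x n))"

definition path_code :: "(real \<Rightarrow> 'e::topological_space) \<Rightarrow> 'e jump_code" where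
  "path_code x = (\<lambda>n. (nth_jump x n, if nth_jump x n < 0 then undefined else x (nth_jump x n)))"

lemma path_code_simps:
  "jtime (path_code x) n = nth_jump x n"
  "jmark (path_code x) n = (if nth_jump x n < 0 then undefined else x (nth_jump x n))"
  by (simp_all add: path_code_def jtime_def jmark_def)

lemma step_pathsD:
  assumes "x \<in> step_paths"
  shows "x \<in> extensional {0..}" "cadlag x"
    "0 \<le> s \<Longrightarrow> s \<le> t \<Longrightarrow> discontinuities x \<inter> {s<..t} = {} \<Longrightarrow> x s = x t"
    "finite (discontinuities x \<inter> {0<..t})"
  using assms by (auto simp: step_paths_def cadlag_paths_def)

lemma next_jump_least:
  assumes x: "x \<in> step_paths" and u: "u \<in> discontinuities x" "s < u" and s: "0 \<le> s"
  shows "next_jump x s \<in> discontinuities x" "s < next_jump x s" "next_jump x s \<le> u"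
proof -
  define A where "A = {v \<in> discontinuities x \<inter> {0<..u}. s < v}"
  have "A \<subseteq> discontinuities x \<inter> {0<..u}" by (auto simp: A_def)
  then have "finite A" using step_pathsD(4)[OF x] finite_subset by blast
  moreover have "u \<in> A" using u by (auto simp: A_def discontinuities_def)
  ultimately have A: "finite A" "u \<in> A" by auto
  then have min: "Min A \<in> A" "\<And>v. v \<in> A \<Longrightarrow> Min A \<le> v" using Min_in by auto
  have "(LEAST u. u \<in> discontinuities x \<and> s < u) = Min A"
  proof (rule Least_equality)
    show "Min A \<in> discontinuities x \<and> s < Min A" using min(1) by (auto simp: A_def)
    fix v assume v: "v \<in> discontinuities x \<and> s < v"
    show "Min A \<le> v"
    proof (cases "v \<le> u")
      case True
      then show ?thesis using v s by (intro min(2)) (auto simp: A_def)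
    qed (use min(2)[OF A(2)] in simp)
  qed
  then have "next_jump x s = Min A" using u by (auto simp: next_jump_def)
  then show "next_jump x s \<in> discontinuities x" "s < next_jump x s" "next_jump x s \<le> u"
    using min A(2) by (auto simp: A_def)
qed

lemma nth_jump_Suc_cases:
  assumes x: "x \<in> step_paths"
  obtains "nth_jump x (Suc n) = -1"
  | "0 \<le> nth_jump x n" "nth_jump x n < nth_jump x (Suc n)" "nth_jump x (Suc n) \<in> discontinuities x"
proof (cases "0 \<le> nth_jump x n \<and> (\<exists>u\<in>discontinuities x. nth_jump x n < u)")
  case True
  then obtain u where u: "u \<in> discontinuities x" "nth_jump x n < u" by auto
  have "nth_jump x (Suc n) = next_jump x (nth_jump x n)" using True by simp
  then show thesis using next_jump_least[OF x u] True that(2) by simp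
next
  case False
  then have "nth_jump x (Suc n) = -1" by (auto simp: next_jump_def)
  then show thesis by (rule that(1))
qed

lemma nth_jump_Suc_nonneg:
  assumes "x \<in> step_paths" "0 \<le> nth_jump x (Suc n)"
  shows "0 \<le> nth_jump x n" "nth_jump x n < nth_jump x (Suc n)"
    "nth_jump x (Suc n) \<in> discontinuities x"
  using assms(2)
  by (cases rule: nth_jump_Suc_cases[OF assms(1), of n]; simp del: nth_jump.simps)+

lemma nth_jump_le:
  assumes x: "x \<in> step_paths" and n: "0 \<le> nth_jump x n"
    and u: "u \<in> discontinuities x" "nth_jump x n < u"
  shows "0 \<le> nth_jump x (Suc n)" "nth_jump x (Suc n) \<le> u"
  using next_jump_least[OF x u n] n by auto

lemma path_code_codes:
  assumes x: "x \<in> step_paths"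
  shows "path_code x \<in> codes"
  unfolding codes_def
proof (intro CollectI conjI allI)
  show "jtime (path_code x) 0 = 0" by (simp add: path_code_simps)
  fix n
  show "jtime (path_code x) (Suc n) = -1 \<and> jmark (path_code x) (Suc n) = undefined \<or>
      0 \<le> jtime (path_code x) n \<and> jtime (path_code x) n < jtime (path_code x) (Suc n)"
    unfolding path_code_simps
    by (rule nth_jump_Suc_cases[OF x, of n]) (simp_all del: nth_jump.simps)
qed

text \<open>Left of its \<open>(n+1)\<close>-st discontinuity the path is constant; were its value there the same,
  the path would be continuous at that point. And the discontinuity times cannot all lie
  in a bounded interval, for there are only finitely many in it.\<close>

lemma path_code_step_codes:
  fixes x :: "real \<Rightarrow> 'e::t2_space"
  assumes x: "x \<in> step_paths"
  shows "path_code x \<in> step_codes"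
  unfolding step_codes_def
proof (intro CollectI conjI allI impI)
  show c: "path_code x \<in> codes" by (rule path_code_codes[OF x])
  fix n assume "0 \<le> jtime (path_code x) (Suc n)"
  then have n: "0 \<le> nth_jump x n" "nth_jump x n < nth_jump x (Suc n)"
    "nth_jump x (Suc n) \<in> discontinuities x"
    using nth_jump_Suc_nonneg[OF x, of n] by (simp_all only: path_code_simps)
  let ?s = "nth_jump x n" and ?t = "nth_jump x (Suc n)"
  have "x u = x ?s" if u: "?s < u" "u < ?t" for u
  proof -
    have "discontinuities x \<inter> {?s<..u} = {}"
      using nth_jump_le(2)[OF x n(1)] u by force
    then show ?thesis using step_pathsD(3)[OF x n(1), of u] u by simp
  qed
  then have "(x \<longlongrightarrow> x ?s) (at_left ?t)" by (rule tendsto_left_of_constant[OF n(2)])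
  moreover have "(x \<longlongrightarrow> x ?t) (at_right ?t)" "\<not> isCont x ?t"
    using step_pathsD(2)[OF x] n by (auto simp: cadlag_def discontinuities_def simp del: nth_jump.simps)
  ultimately have "x ?s \<noteq> x ?t" using isCont_iff_left_limit by blast
  then show "jmark (path_code x) (Suc n) \<noteq> jmark (path_code x) n"
    using n by (auto simp: path_code_simps simp del: nth_jump.simps)
next
  fix k :: nat
  show "\<exists>n. jtime (path_code x) n < 0 \<or> real k < jtime (path_code x) n"
  proof (rule ccontr)
    assume "\<not> ?thesis"
    then have b: "0 \<le> nth_jump x n" "nth_jump x n \<le> real k" for n
      by (simp_all add: path_code_simps not_less)
    have s: "nth_jump x n < nth_jump x (Suc n) \<and> nth_jump x (Suc n) \<in> discontinuities x" for n
      using nth_jump_Suc_nonneg[OF x b(1)] by blast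
    then have "strict_mono (\<lambda>n. nth_jump x (Suc n))"
      unfolding strict_mono_Suc_iff by blast
    moreover have "range (\<lambda>n. nth_jump x (Suc n)) \<subseteq> discontinuities x \<inter> {0<..real k}"
      using s b by (auto simp: discontinuities_def simp del: nth_jump.simps)
    then have "finite (range (\<lambda>n. nth_jump x (Suc n)))"
      using step_pathsD(4)[OF x] finite_subset by blast
    ultimately show False by (metis finite_imageD infinite_UNIV_nat strict_mono_imp_inj_on)
  qed
qed

lemma step_path_path_code:
  fixes x :: "real \<Rightarrow> 'e::t2_space"
  assumes x: "x \<in> step_paths"
  shows "step_path (path_code x) = x"
proof
  fix s
  show "step_path (path_code x) s = x s"
  proof (cases "0 \<le> s")
    case True
    obtain n where n: "0 \<le> jtime (path_code x) n" "jtime (path_code x) n \<le> s"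
      "pending (path_code x) (Suc n) s" "step_path (path_code x) s = jmark (path_code x) n"
      by (rule last_jump[OF path_code_step_codes[OF x] True])
    then have n': "0 \<le> nth_jump x n" "nth_jump x n \<le> s" by (simp_all add: path_code_simps)
    have "discontinuities x \<inter> {nth_jump x n<..s} = {}"
      using n(3) nth_jump_le[OF x n'(1)] by (force simp: pending_def path_code_simps simp del: nth_jump.simps)
    then have "x (nth_jump x n) = x s" using step_pathsD(3)[OF x n'] by simp
    then show ?thesis using n n' by (simp add: path_code_simps)
  next
    case False
    then show ?thesis using step_pathsD(1)[OF x] by (simp add: step_path_def extensional_def)
  qed
qed

lemma path_code_step_path:
  fixes p :: "'e::t2_space jump_code"
  assumes p: "p \<in> step_codes"
  shows "path_code (step_path p) = p"
proof -
  have c: "p \<in> codes" by (rule step_codesD[OF p])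
  note D = discontinuities_step_path[OF p]
  have times: "nth_jump (step_path p) n = jtime p n" for n
  proof (induction n)
    case 0
    then show ?case by (simp add: jtime_0[OF c])
  next
    case (Suc n)
    show ?case
    proof (cases "0 \<le> jtime p (Suc n)")
      case True
      note lt = jtime_less[OF c True lessI]
      have mem: "jtime p (Suc n) \<in> discontinuities (step_path p)" using lt unfolding D by auto
      have "(LEAST u. u \<in> discontinuities (step_path p) \<and> jtime p n < u) = jtime p (Suc n)"
      proof (rule Least_equality)
        fix u assume "u \<in> discontinuities (step_path p) \<and> jtime p n < u"
        then obtain k where k: "u = jtime p (Suc k)" "0 < u" "jtime p n < jtime p (Suc k)"
          unfolding D by auto
        then have "n < Suc k" using jtime_less_iff[OF c lt(1), of "Suc k"] by simp
        then show "jtime p (Suc n) \<le> u"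
          using k jtime_less(2)[OF c, of "Suc k" "Suc n"] by (cases "n = k") auto
      qed (use mem lt in simp)
      then show ?thesis using Suc lt mem by (auto simp: next_jump_def)
    next
      case False
      have "\<not> (\<exists>u\<in>discontinuities (step_path p). jtime p n < u)" if "0 \<le> jtime p n"
      proof
        assume "\<exists>u\<in>discontinuities (step_path p). jtime p n < u"
        then obtain k where k: "0 < jtime p (Suc k)" "jtime p n < jtime p (Suc k)"
          unfolding D by auto
        then have "n < Suc k" using jtime_less_iff[OF c that, of "Suc k"] by simp
        then have "0 \<le> jtime p (Suc n)"
          using k jtime_less(1)[OF c, of "Suc k" "Suc n"] by (cases "n = k") auto
        with False show False by simp
      qed
      then show ?thesis using Suc False absent_code(1)[OF c, of "Suc n"] by (auto simp: next_jump_def)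
    qed
  qed
  show ?thesis
  proof (rule jump_code_eqI)
    fix n
    show "jtime (path_code (step_path p)) n = jtime p n" by (simp add: path_code_simps times)
    show "jmark (path_code (step_path p)) n = jmark p n"
      using absent_code[OF c, of n] step_path_at_jump[OF c, of n] by (auto simp: path_code_simps times)
  qed
qed

section \<open>Continuity of the passage from codes to paths\<close>

text \<open>A time change that moves finitely many given points by small amounts: the identity plus
  a sum of tent functions supported around these points. The tents have Lipschitz constant
  \<open>1/r\<close>, so the perturbation has a Lipschitz constant below \<open>1\<close> and leaves the sum strictly
  increasing.\<close>

lemma time_change_moving_points:
  fixes a \<delta> :: "'i \<Rightarrow> real"
  assumes K: "finite K" and r: "0 < r"
    and a0: "\<And>j. j \<in> K \<Longrightarrow> r \<le> a j"
    and sep: "\<And>i j. i \<in> K \<Longrightarrow> j \<in> K \<Longrightarrow> i \<noteq> j \<Longrightarrow> r \<le> \<bar>a i - a j\<bar>"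
    and small: "(\<Sum>j\<in>K. \<bar>\<delta> j\<bar>) < r"
  obtains l where "l \<in> time_changes" "l 0 = 0" "\<And>j. j \<in> K \<Longrightarrow> l (a j) = a j + \<delta> j"
    "\<And>s. \<bar>l s - s\<bar> \<le> (\<Sum>j\<in>K. \<bar>\<delta> j\<bar>)"
proof -
  define tent where "tent j s = max 0 (1 - \<bar>s - a j\<bar> / r)" for j s
  define l where "l s = s + (\<Sum>j\<in>K. \<delta> j * tent j s)" for s
  let ?D = "\<Sum>j\<in>K. \<bar>\<delta> j\<bar>"
  have tent01: "0 \<le> tent j s" "tent j s \<le> 1" for j s
    using r by (auto simp: tent_def)
  have tent_far: "tent j s = 0" if "r \<le> \<bar>s - a j\<bar>" for j s
    using that r by (simp add: tent_def)
  have tent_lip: "\<bar>tent j s - tent j t\<bar> \<le> \<bar>s - t\<bar> / r" for j s t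
  proof -
    have "\<bar>tent j s - tent j t\<bar> \<le> \<bar>\<bar>s - a j\<bar> / r - \<bar>t - a j\<bar> / r\<bar>"
      unfolding tent_def by linarith
    also have "\<dots> = \<bar>\<bar>s - a j\<bar> - \<bar>t - a j\<bar>\<bar> / r"
      using r by (simp add: diff_divide_distrib[symmetric] abs_divide)
    also have "\<dots> \<le> \<bar>s - t\<bar> / r"
      using r by (intro divide_right_mono) auto
    finally show ?thesis .
  qed
  have close: "\<bar>l s - s\<bar> \<le> ?D" for s
  proof -
    have "\<bar>\<Sum>j\<in>K. \<delta> j * tent j s\<bar> \<le> (\<Sum>j\<in>K. \<bar>\<delta> j * tent j s\<bar>)" by (rule sum_abs)
    also have "\<dots> \<le> ?D"
    proof (rule sum_mono)
      fix j
      show "\<bar>\<delta> j * tent j s\<bar> \<le> \<bar>\<delta> j\<bar>"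
        using mult_left_le[of "tent j s" "\<bar>\<delta> j\<bar>"] tent01[of j s] by (simp add: abs_mult)
    qed
    finally show ?thesis by (simp add: l_def)
  qed
  have mono: "l s < l t" if "s < t" for s t
  proof -
    have "\<bar>(\<Sum>j\<in>K. \<delta> j * tent j s) - (\<Sum>j\<in>K. \<delta> j * tent j t)\<bar>
        = \<bar>\<Sum>j\<in>K. \<delta> j * (tent j s - tent j t)\<bar>"
      by (simp add: sum_subtractf right_diff_distrib)
    also have "\<dots> \<le> (\<Sum>j\<in>K. \<bar>\<delta> j\<bar> * \<bar>tent j s - tent j t\<bar>)"
      by (rule order_trans[OF sum_abs]) (simp add: abs_mult)
    also have "\<dots> \<le> (\<Sum>j\<in>K. \<bar>\<delta> j\<bar> * (\<bar>s - t\<bar> / r))"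
      by (intro sum_mono mult_left_mono tent_lip) auto
    also have "\<dots> = ?D * (t - s) / r" using that by (simp add: sum_distrib_right sum_divide_distrib)
    also have "\<dots> < t - s"
    proof -
      have "?D * (t - s) < r * (t - s)" using small that by (intro mult_strict_right_mono) auto
      then show ?thesis using r by (simp add: divide_less_eq mult.commute)
    qed
    finally show ?thesis by (simp add: l_def)
  qed
  have l0: "l 0 = 0"
  proof -
    have "tent j 0 = 0" if "j \<in> K" for j using a0[OF that] r by (intro tent_far) simp
    then show ?thesis by (simp add: l_def)
  qed
  have la: "l (a j) = a j + \<delta> j" if "j \<in> K" for j
  proof -
    have "(\<Sum>i\<in>K. \<delta> i * tent i (a j)) = (\<Sum>i\<in>K. if i = j then \<delta> j else 0)"
    proof (rule sum.cong[OF refl])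
      fix i assume "i \<in> K"
      then show "\<delta> i * tent i (a j) = (if i = j then \<delta> j else 0)"
        using tent_far[of "a j" i] sep[OF that, of i] by (auto simp: tent_def)
    qed
    then show ?thesis using K that by (simp add: l_def)
  qed
  have cont: "continuous_on A l" for A
    unfolding l_def tent_def using r by (intro continuous_intros) auto
  have "l ` {0..} = {0..}"
  proof
    have "0 \<le> l s" if "0 \<le> s" for s using mono[of 0 s] l0 that by (cases "s = 0") simp_all
    then show "l ` {0..} \<subseteq> {0..}" by auto
    show "{0..} \<subseteq> l ` {0..}"
    proof
      fix y :: real assume y: "y \<in> {0..}"
      have "0 \<le> ?D" by (simp add: sum_nonneg)
      moreover have "y \<le> l (y + ?D)" using close[of "y + ?D"] by linarith
      ultimately obtain s where "0 \<le> s" "l s = y"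
        using IVT'[of l 0 y "y + ?D", OF _ _ _ cont] y l0 by fastforce
      then show "y \<in> l ` {0..}" by auto
    qed
  qed
  moreover have "strict_mono_on {0..} l" by (auto simp: strict_mono_on_def mono)
  ultimately have "l \<in> time_changes" by (simp add: time_changes_def)
  then show thesis using that l0 la close by blast
qed

lemma finite_separation:
  fixes a :: "'i \<Rightarrow> real"
  assumes "finite K" "\<And>j. j \<in> K \<Longrightarrow> 0 < a j"
    "\<And>i j. i \<in> K \<Longrightarrow> j \<in> K \<Longrightarrow> i \<noteq> j \<Longrightarrow> a i \<noteq> a j"
  obtains r where "0 < r" "\<And>j. j \<in> K \<Longrightarrow> r \<le> a j"
    "\<And>i j. i \<in> K \<Longrightarrow> j \<in> K \<Longrightarrow> i \<noteq> j \<Longrightarrow> r \<le> \<bar>a i - a j\<bar>"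
proof -
  define A where "A = insert 1 (a ` K \<union> (\<lambda>(i, j). \<bar>a i - a j\<bar>) ` {(i, j) \<in> K \<times> K. i \<noteq> j})"
  have "finite {(i, j) \<in> K \<times> K. i \<noteq> j}"
    by (rule finite_subset[of _ "K \<times> K"]) (use assms(1) in auto)
  then have fin: "finite A" unfolding A_def using assms(1) by blast
  have pos: "0 < y" if "y \<in> A" for y using that assms(2,3) by (auto simp: A_def)
  have "Min A \<in> A" using fin by (intro Min_in) (auto simp: A_def)
  then have "0 < Min A" by (rule pos)
  moreover have "Min A \<le> a j" if "j \<in> K" for j
    using fin by (rule Min_le) (use that in \<open>simp add: A_def\<close>)
  moreover have "Min A \<le> \<bar>a i - a j\<bar>" if "i \<in> K" "j \<in> K" "i \<noteq> j" for i j
    using fin by (rule Min_le) (use that in \<open>auto simp: A_def\<close>)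
  ultimately show thesis by (intro that[of "Min A"])
qed

lemma tendsto_jtime: "((\<lambda>q. jtime q n) \<longlongrightarrow> jtime p n) (nhds p)"
  and tendsto_jmark: "((\<lambda>q. jmark q n) \<longlongrightarrow> jmark p n) (nhds (p :: 'e::topological_space jump_code))"
proof -
  have "continuous_on UNIV (\<lambda>q :: 'e jump_code. q n)" by (rule continuous_on_product_coordinates)
  then have "((\<lambda>q :: 'e jump_code. q n) \<longlongrightarrow> p n) (at p)" by (simp add: continuous_on_def)
  then have "((\<lambda>q :: 'e jump_code. q n) \<longlongrightarrow> p n) (nhds p)"
    by (rule tendsto_at_iff_tendsto_nhds[of "\<lambda>q. q n" p, THEN iffD1])
  then show "((\<lambda>q. jtime q n) \<longlongrightarrow> jtime p n) (nhds p)" "((\<lambda>q. jmark q n) \<longlongrightarrow> jmark p n) (nhds p)"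
    unfolding jtime_def jmark_def by (auto intro: tendsto_fst tendsto_snd)
qed

text \<open>If a code \<open>q\<close> is close to \<open>p\<close> in the first coordinates, a small time change carries the jump
  times of \<open>p\<close> up to \<open>R\<close>, and the next one, to those of \<open>q\<close>. After this change the two paths run
  through their marks simultaneously on \<open>[0,R]\<close>.\<close>

lemma step_paths_close:
  fixes p :: "'e::metric_space jump_code"
  assumes p: "p \<in> step_codes" and \<epsilon>: "0 < \<epsilon>" and R: "0 \<le> R"
  shows "eventually (\<lambda>q. q \<in> step_codes \<longrightarrow> (\<exists>l\<in>time_changes. \<forall>s\<ge>0. \<bar>l s - s\<bar> < \<epsilon> \<and>
           (s \<le> R \<longrightarrow> dist (step_path q (l s)) (step_path p s) < \<epsilon>))) (nhds p)"
proof -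
  have c: "p \<in> codes" by (rule step_codesD[OF p])
  obtain n where n: "0 \<le> jtime p n" "jtime p n \<le> R" "pending p (Suc n) R"
    by (rule last_jump[OF p R])
  define K where "K = {j \<in> {1..Suc n}. 0 \<le> jtime p j}"
  have K: "finite K" by (simp add: K_def)
  have "K \<subseteq> {1..Suc n}" by (auto simp: K_def)
  then have "card K \<le> card {1..Suc n}" by (intro card_mono) auto
  then have card: "card K \<le> Suc n" by simp
  have Kpos: "0 < jtime p j" if "j \<in> K" for j
    using jtime_less(2)[OF c, of j 0] that by (simp add: K_def jtime_0[OF c])
  have Kne: "jtime p i \<noteq> jtime p j" if "i \<in> K" "j \<in> K" "i \<noteq> j" for i j
    using that jtime_less_iff[OF c, of i j] jtime_less_iff[OF c, of j i] by (auto simp: K_def)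
  obtain r where r: "0 < r" "\<And>j. j \<in> K \<Longrightarrow> r \<le> jtime p j"
    "\<And>i j. i \<in> K \<Longrightarrow> j \<in> K \<Longrightarrow> i \<noteq> j \<Longrightarrow> r \<le> \<bar>jtime p i - jtime p j\<bar>"
    using finite_separation[of K "jtime p", OF K Kpos Kne] by blast
  \<comment> \<open>The displacements of at most \<open>n + 1\<close> points have to add up to less than \<open>\<epsilon>\<close> and \<open>r\<close>; as each
      is below \<open>1\<close>, it cannot bridge the gap between the time \<open>-1\<close> of a missing jump and the
      nonnegative times, so up to index \<open>n + 1\<close> nearby codes miss the same jumps as \<open>p\<close>.\<close>
  define \<eta> where "\<eta> = min 1 (min \<epsilon> r) / (real n + 2)"
  have \<eta>0: "0 < \<eta>" using r \<epsilon> by (simp add: \<eta>_def)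
  have \<eta>n: "(real n + 2) * \<eta> = min 1 (min \<epsilon> r)" by (simp add: \<eta>_def field_simps)
  have "1 * \<eta> \<le> (real n + 2) * \<eta>" using \<eta>0 by (intro mult_right_mono) auto
  then have \<eta>1: "\<eta> \<le> 1" using \<eta>n by simp
  have "eventually (\<lambda>q. \<forall>j\<in>{..Suc n}. dist (jtime q j) (jtime p j) < \<eta> \<and>
      dist (jmark q j) (jmark p j) < \<epsilon>) (nhds p)"
    by (intro eventually_ball_finite finite_atMost ballI eventually_conj
        tendstoD[OF tendsto_jtime \<eta>0] tendstoD[OF tendsto_jmark \<epsilon>])
  then show ?thesis
  proof (rule eventually_mono, intro impI)
    fix q assume q: "\<forall>j\<in>{..Suc n}. dist (jtime q j) (jtime p j) < \<eta> \<and> dist (jmark q j) (jmark p j) < \<epsilon>"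
      and q_step: "q \<in> step_codes"
    have cq: "q \<in> codes" by (rule step_codesD[OF q_step])
    define \<delta> where "\<delta> j = jtime q j - jtime p j" for j
    have \<delta>: "\<bar>\<delta> j\<bar> \<le> \<eta>" if "j \<in> K" for j
    proof -
      have "j \<in> {..Suc n}" using that by (auto simp: K_def)
      with q have "dist (jtime q j) (jtime p j) < \<eta>" by blast
      then show ?thesis by (simp add: \<delta>_def dist_real_def)
    qed
    have "(\<Sum>j\<in>K. \<bar>\<delta> j\<bar>) \<le> real (card K) * \<eta>"
      using sum_mono[of K "\<lambda>j. \<bar>\<delta> j\<bar>" "\<lambda>_. \<eta>"] \<delta> by simp
    also have "\<dots> \<le> real (Suc n) * \<eta>" using card \<eta>0 by (intro mult_right_mono) auto
    also have "\<dots> < (real n + 2) * \<eta>" using \<eta>0 by (intro mult_strict_right_mono) auto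
    finally have sum: "(\<Sum>j\<in>K. \<bar>\<delta> j\<bar>) < min 1 (min \<epsilon> r)" by (simp only: \<eta>n)
    then have small: "(\<Sum>j\<in>K. \<bar>\<delta> j\<bar>) < r" by simp
    obtain l where l: "l \<in> time_changes" "l 0 = 0"
      "\<And>j. j \<in> K \<Longrightarrow> l (jtime p j) = jtime p j + \<delta> j" "\<And>s. \<bar>l s - s\<bar> \<le> (\<Sum>j\<in>K. \<bar>\<delta> j\<bar>)"
      using time_change_moving_points[of K r "jtime p" \<delta>, OF K r small] by blast
    have lj: "l (jtime p j) = jtime q j" if "j \<le> Suc n" "0 \<le> jtime p j" for j
      using l(2) l(3)[of j] that jtime_0[OF c] jtime_0[OF cq]
      by (cases "j = 0") (auto simp: K_def \<delta>_def)
    have present: "0 \<le> jtime q j" if "j \<le> Suc n" "0 \<le> jtime p j" for j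
    proof -
      have "dist (jtime q j) (jtime p j) < \<eta>" using q that by auto
      then have "- 1 < jtime q j" using \<eta>1 that by (simp add: dist_real_def)
      then show ?thesis using absent_code(1)[OF cq, of j] by force
    qed
    have absent: "jtime q j < 0" if "j \<le> Suc n" "jtime p j < 0" for j
    proof -
      have "dist (jtime q j) (jtime p j) < \<eta>" using q that by auto
      then show ?thesis using \<eta>1 absent_code(1)[OF c that(2)] by (simp add: dist_real_def)
    qed
    have lmono: "l s < l t" if "0 \<le> s" "s < t" for s t
      using l(1) that by (auto simp: time_changes_def strict_mono_on_def)
    have lmono': "l s \<le> l t" if "0 \<le> s" "s \<le> t" for s t
      using lmono[of s t] that by (cases "s = t") auto
    have "\<bar>l s - s\<bar> < \<epsilon> \<and> (s \<le> R \<longrightarrow> dist (step_path q (l s)) (step_path p s) < \<epsilon>)" if s: "0 \<le> s" for s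
    proof (intro conjI impI)
      show "\<bar>l s - s\<bar> < \<epsilon>" using l(4)[of s] sum by simp
      assume "s \<le> R"
      obtain m where m: "0 \<le> jtime p m" "jtime p m \<le> s" "pending p (Suc m) s" "step_path p s = jmark p m"
        by (rule last_jump[OF p s])
      have mn: "m \<le> n" using m(2) \<open>s \<le> R\<close> by (intro jump_index_mono[OF c m(1) _ n(3)]) simp
      have "step_path q (l s) = jmark q m"
      proof (rule step_path_eq[OF cq])
        show "0 \<le> jtime q m" using present m(1) mn by simp
        show "jtime q m \<le> l s" using lmono'[OF m(1,2)] lj m(1) mn by simp
        show "pending q (Suc m) (l s)"
        proof (cases "jtime p (Suc m) < 0")
          case True
          then show ?thesis using absent[of "Suc m"] mn by (simp add: pending_def)
        next
          case False
          then have "s < jtime p (Suc m)" using m(3) by (simp add: pending_def)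
          then show ?thesis using lmono[OF s, of "jtime p (Suc m)"] lj[of "Suc m"] False mn by (simp add: pending_def)
        qed
      qed
      then show "dist (step_path q (l s)) (step_path p s) < \<epsilon>" using q mn m(4) by simp
    qed
    then show "\<exists>l\<in>time_changes. \<forall>s\<ge>0. \<bar>l s - s\<bar> < \<epsilon> \<and>
        (s \<le> R \<longrightarrow> dist (step_path q (l s)) (step_path p s) < \<epsilon>)"
      using l(1) by blast
  qed
qed

text \<open>This is sequential continuity of \<^const>\<open>step_path\<close>: codes approaching \<open>p\<close> whose paths avoid \<open>U\<close> can
  be selected, together with their time changes, along the precisions \<open>1/(i+1)\<close> on \<open>[0,i]\<close>;
  their paths then converge in the Skorokhod sense, which is impossible when \<open>U\<close> is open.\<close>

lemma openin_step_codes_vimage: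
  fixes U :: "(real \<Rightarrow> 'e::metric_space) set"
  assumes U: "openin skorokhod_topology U"
  shows "openin (top_of_set step_codes) {p \<in> step_codes. step_path p \<in> U}"
  unfolding openin_euclidean_subtopology_iff
proof (intro conjI ballI)
  fix p :: "'e jump_code" assume "p \<in> {p \<in> step_codes. step_path p \<in> U}"
  then have p: "p \<in> step_codes" "step_path p \<in> U" by auto
  show "\<exists>d>0. \<forall>q\<in>step_codes. dist q p < d \<longrightarrow> q \<in> {p \<in> step_codes. step_path p \<in> U}"
  proof (rule ccontr)
    assume none: "\<not> ?thesis"
    \<comment> \<open>A failure of openness at precision \<open>1/(i+1)\<close>, as a predicate from which sequences can be
        chosen.\<close>
    define P where "P i q l \<longleftrightarrow> q \<in> step_codes \<and> step_path q \<notin> U \<and> l \<in> time_changes \<and>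
        (\<forall>s\<ge>0. \<bar>l s - s\<bar> < inverse (real (Suc i)) \<and>
          (s \<le> real i \<longrightarrow> dist (step_path q (l s)) (step_path p s) < inverse (real (Suc i))))"
      for i q l
    have "\<exists>q l. P i q l" for i
    proof -
      obtain d where d: "0 < d" "\<And>q. dist q p < d \<Longrightarrow> q \<in> step_codes \<Longrightarrow>
          \<exists>l\<in>time_changes. \<forall>s\<ge>0. \<bar>l s - s\<bar> < inverse (real (Suc i)) \<and>
           (s \<le> real i \<longrightarrow> dist (step_path q (l s)) (step_path p s) < inverse (real (Suc i)))"
        using step_paths_close[OF p(1), of "inverse (real (Suc i))" "real i"]
        unfolding eventually_nhds_metric by force
      obtain q where q: "q \<in> step_codes" "dist q p < d" "step_path q \<notin> U"
        using none d(1) by blast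
      from d(2)[OF q(2,1)] q show ?thesis unfolding P_def by blast
    qed
    then obtain q l where "\<And>i. P i (q i) (l i)" by metis
    then have q: "\<And>i. q i \<in> step_codes" "\<And>i. step_path (q i) \<notin> U"
      and l: "\<And>i. l i \<in> time_changes"
      and close: "\<And>i s. 0 \<le> s \<Longrightarrow> \<bar>l i s - s\<bar> < inverse (real (Suc i))"
        "\<And>i s. 0 \<le> s \<Longrightarrow> s \<le> real i \<Longrightarrow> dist (step_path (q i) (l i s)) (step_path p s) < inverse (real (Suc i))"
      unfolding P_def by blast+
    have small: "eventually (\<lambda>i. inverse (real (Suc i)) < e) sequentially" if "0 < e" for e
      using LIMSEQ_inverse_real_of_nat that by (rule order_tendstoD)
    have "uniform_limit {0..} l (\<lambda>s. s) sequentially"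
    proof (rule uniform_limitI)
      fix e :: real assume "0 < e"
      from small[OF this] show "\<forall>\<^sub>F i in sequentially. \<forall>s\<in>{0..}. dist (l i s) s < e"
      proof (rule eventually_mono, intro ballI)
        fix i and s :: real assume "inverse (real (Suc i)) < e" "s \<in> {0..}"
        then show "dist (l i s) s < e" using close(1)[of s i] by (simp add: dist_real_def)
      qed
    qed
    moreover have "uniform_limit {0..real N} (\<lambda>i s. step_path (q i) (l i s)) (step_path p) sequentially" for N
    proof (rule uniform_limitI)
      fix e :: real assume "0 < e"
      from eventually_conj[OF small[OF this] eventually_ge_at_top[of N]]
      show "\<forall>\<^sub>F i in sequentially. \<forall>s\<in>{0..real N}. dist (step_path (q i) (l i s)) (step_path p s) < e"
      proof (rule eventually_mono, intro ballI)
        fix i s assume "inverse (real (Suc i)) < e \<and> N \<le> i" "s \<in> {0..real N}"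
        then show "dist (step_path (q i) (l i s)) (step_path p s) < e"
          using close(2)[of s i] by force
      qed
    qed
    ultimately have "skorokhod_converges (\<lambda>i. step_path (q i)) (step_path p)"
      unfolding skorokhod_converges_def using l by blast
    moreover have "\<forall>i. step_path (q i) \<in> cadlag_paths" using step_path_cadlag_paths[OF q(1)] by blast
    ultimately have "eventually (\<lambda>i. step_path (q i) \<in> U) sequentially"
      using U p(2) unfolding openin_skorokhod_topology by simp
    then show False using q(2) by simp
  qed
qed auto

lemma space_step_paths_borel: "space (step_paths_borel :: (real \<Rightarrow> 'e::metric_space) measure) = step_paths"
proof -
  have "(step_paths :: (real \<Rightarrow> 'e) set) \<subseteq> cadlag_paths" unfolding step_paths_def by blast
  then show ?thesis
    by (simp add: space_restrict_space space_borel_of topspace_skorokhod_topology Int_absorb2)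
qed

lemma step_path_measurable:
  "step_path \<in> measurable (restrict_space borel step_codes) (step_paths_borel :: (real \<Rightarrow> 'e::polish_space) measure)"
proof (rule measurable_restrict_space2)
  show "step_path \<in> space (restrict_space borel step_codes) \<rightarrow> (step_paths :: (real \<Rightarrow> 'e) set)"
    by (auto simp: space_restrict_space step_path_step_paths)
  show "step_path \<in> measurable (restrict_space borel step_codes) (skorokhod_borel :: (real \<Rightarrow> 'e) measure)"
  proof (rule measurable_into_borel_of)
    fix U :: "(real \<Rightarrow> 'e) set" assume "openin skorokhod_topology U"
    from openin_step_codes_vimage[OF this] obtain V where V: "open V"
      "{p \<in> step_codes. step_path p \<in> U} = step_codes \<inter> V"
      unfolding openin_open by blast
    have "step_path -` U \<inter> space (restrict_space borel step_codes) = V \<inter> step_codes"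
      using V(2) by (auto simp: space_restrict_space)
    then show "step_path -` U \<inter> space (restrict_space borel step_codes) \<in> sets (restrict_space borel step_codes)"
      using V(1) by (auto simp: sets_restrict_space_iff)
  qed (simp add: space_restrict_space topspace_skorokhod_topology step_path_cadlag_paths)
qed

section \<open>Measurability of the code of a path\<close>

lemma skorokhod_converges_pointwise:
  assumes "skorokhod_converges xs x"
  obtains l where "\<And>s. 0 \<le> s \<Longrightarrow> (\<lambda>n. l n s) \<longlonglongrightarrow> s" "\<And>s. 0 \<le> s \<Longrightarrow> (\<lambda>n. xs n (l n s)) \<longlonglongrightarrow> x s"
proof -
  obtain l where l: "uniform_limit {0..} l (\<lambda>s. s) sequentially"
    "\<And>N::nat. uniform_limit {0..real N} (\<lambda>n s. xs n (l n s)) x sequentially"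
    using assms unfolding skorokhod_converges_def by blast
  show thesis
  proof (rule that)
    fix s :: real assume s: "0 \<le> s"
    show "(\<lambda>n. l n s) \<longlonglongrightarrow> s" using tendsto_uniform_limitI[OF l(1)] s by simp
    obtain N :: nat where "s \<le> real N" using real_arch_simple by blast
    then show "(\<lambda>n. xs n (l n s)) \<longlonglongrightarrow> x s" using tendsto_uniform_limitI[OF l(2)[of N]] s by simp
  qed
qed

text \<open>A visit of the open set \<open>V\<close> during an open interval of time survives small perturbations
  of the path and of the time scale.\<close>

lemma openin_visits:
  fixes V :: "'e::metric_space set"
  assumes "0 \<le> a" "open V"
  shows "openin skorokhod_topology {x \<in> cadlag_paths. \<exists>u. a < u \<and> u < b \<and> x u \<in> V}"
  unfolding openin_skorokhod_topology
proof (intro conjI ballI allI impI)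
  fix x and xs :: "nat \<Rightarrow> real \<Rightarrow> 'e"
  assume "x \<in> {x \<in> cadlag_paths. \<exists>u. a < u \<and> u < b \<and> x u \<in> V}"
    and xs: "\<forall>n. xs n \<in> cadlag_paths" "skorokhod_converges xs x"
  then obtain u where u: "a < u" "u < b" "x u \<in> V" by auto
  obtain l where l: "\<And>s. 0 \<le> s \<Longrightarrow> (\<lambda>n. l n s) \<longlonglongrightarrow> s" "\<And>s. 0 \<le> s \<Longrightarrow> (\<lambda>n. xs n (l n s)) \<longlonglongrightarrow> x s"
    using skorokhod_converges_pointwise[OF xs(2)] by blast
  have "0 \<le> u" using u assms(1) by simp
  have "eventually (\<lambda>n. a < l n u) sequentially" "eventually (\<lambda>n. l n u < b) sequentially"
    using order_tendstoD[OF l(1)[OF \<open>0 \<le> u\<close>]] u by auto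
  moreover have "eventually (\<lambda>n. xs n (l n u) \<in> V) sequentially"
    using topological_tendstoD[OF l(2)[OF \<open>0 \<le> u\<close>] assms(2) u(3)] .
  ultimately show "eventually (\<lambda>n. xs n \<in> {x \<in> cadlag_paths. \<exists>u. a < u \<and> u < b \<and> x u \<in> V}) sequentially"
    by eventually_elim (use xs(1) in blast)
qed auto

text \<open>Evaluation at \<open>s\<close> need not be continuous, but by right continuity \<open>x s \<in> V\<close> holds exactly if
  for some margin the path keeps this distance from the complement of \<open>V\<close> during some
  interval after \<open>s\<close>, and failing to do so is a visit of an open set.\<close>

lemma evaluation_measurable_skorokhod:
  "(\<lambda>x. x s) \<in> borel_measurable (skorokhod_borel :: (real \<Rightarrow> 'e::metric_space) measure)"
proof (cases "0 \<le> s")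
  case True
  show ?thesis
  proof (rule borel_measurableI)
    fix V :: "'e set" assume V: "open V"
    define d where "d m = inverse (real (Suc m))" for m
    \<comment> \<open>\<open>W m\<close> consists of the points at distance less than \<open>1/(m+1)\<close> from the complement of \<open>V\<close>.\<close>
    define W where "W m = (\<Union>z\<in>- V. ball z (d m))" for m
    have W: "open (W m)" for m by (auto simp: W_def)
    have [measurable]: "{x \<in> cadlag_paths. \<exists>u. s < u \<and> u < s + d k \<and> x u \<in> W m} \<in> sets skorokhod_borel" for k m
      by (intro openin_in_borel_of openin_visits True W)
    have "x s \<in> V \<longleftrightarrow> (\<exists>m k. \<not> (\<exists>u. s < u \<and> u < s + d k \<and> x u \<in> W m))" if x: "x \<in> cadlag_paths" for x
    proof
      have right: "(x \<longlongrightarrow> x s) (at_right s)" using x True by (simp add: cadlag_paths_def cadlag_def)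
      have near: "eventually (\<lambda>u. dist (x u) (x s) < d m) (at_right s)" for m
        using right by (rule tendstoD) (simp add: d_def)
      show "\<exists>m k. \<not> (\<exists>u. s < u \<and> u < s + d k \<and> x u \<in> W m)" if xs: "x s \<in> V"
      proof -
        obtain e where e: "0 < e" "ball (x s) e \<subseteq> V" using V xs open_contains_ball by blast
        obtain m where m: "d m < e / 2" using reals_Archimedean[of "e / 2"] e(1) by (auto simp: d_def)
        obtain b where b: "s < b" "\<And>u. s < u \<Longrightarrow> u < b \<Longrightarrow> dist (x u) (x s) < d m"
          using near[of m] unfolding eventually_at_right_field by blast
        obtain k where k: "d k < b - s" using reals_Archimedean[of "b - s"] b(1) by (auto simp: d_def)
        have "x u \<notin> W m" if "s < u" "u < s + d k" for u
        proof
          assume "x u \<in> W m"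
          then obtain z where z: "z \<notin> V" "dist z (x u) < d m" by (auto simp: W_def)
          have "dist (x s) z \<le> dist (x u) (x s) + dist z (x u)"
            by (metis add.commute dist_commute dist_triangle)
          also have "\<dots> < e" using b(2)[of u] that k z(2) m by simp
          finally show False using e(2) z(1) by auto
        qed
        then show ?thesis by blast
      qed
      show "x s \<in> V" if avoids: "\<exists>m k. \<not> (\<exists>u. s < u \<and> u < s + d k \<and> x u \<in> W m)"
      proof (rule ccontr)
        assume nV: "x s \<notin> V"
        obtain m k where "\<not> (\<exists>u. s < u \<and> u < s + d k \<and> x u \<in> W m)" using avoids by blast
        then have mk: "\<And>u. s < u \<Longrightarrow> u < s + d k \<Longrightarrow> x u \<notin> W m" by blast
        have "s < s + d k" by (simp add: d_def)
        then have "eventually (\<lambda>u. u < s + d k) (at_right s)"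
          unfolding eventually_at_right_field by blast
        then have "eventually (\<lambda>u. False) (at_right s)"
          using near[of m] eventually_at_right_less
        proof eventually_elim
          case (elim u)
          then have "x u \<in> W m" using nV by (auto simp: W_def dist_commute)
          with mk elim show False by blast
        qed
        then show False by simp
      qed
    qed
    then have "(\<lambda>x. x s) -` V \<inter> space skorokhod_borel =
        {x \<in> cadlag_paths. \<exists>m k. \<not> (\<exists>u. s < u \<and> u < s + d k \<and> x u \<in> W m)}"
      unfolding space_borel_of topspace_skorokhod_topology by blast
    also have "\<dots> =
        (\<Union>m k. cadlag_paths - {x \<in> cadlag_paths. \<exists>u. s < u \<and> u < s + d k \<and> x u \<in> W m})"
      by blast
    also have "\<dots> \<in> sets skorokhod_borel"
      using sets.top[of "skorokhod_borel :: (real \<Rightarrow> 'e) measure"]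
      by (intro sets.countable_UN' sets.Diff) (auto simp: space_borel_of topspace_skorokhod_topology)
    finally show "(\<lambda>x. x s) -` V \<inter> space skorokhod_borel \<in> sets (skorokhod_borel :: (real \<Rightarrow> 'e) measure)" .
  qed
next
  case False
  have "(\<lambda>x. undefined) \<in> borel_measurable (skorokhod_borel :: (real \<Rightarrow> 'e) measure)" by simp
  then show ?thesis
    by (rule measurable_cong[THEN iffD1, rotated])
       (use False in \<open>auto simp: space_borel_of topspace_skorokhod_topology cadlag_paths_def extensional_def\<close>)
qed

lemma evaluation_measurable [measurable]:
  "(\<lambda>x. x s) \<in> borel_measurable (step_paths_borel :: (real \<Rightarrow> 'e::metric_space) measure)"
  by (rule measurable_restrict_space1[OF evaluation_measurable_skorokhod])

text \<open>A jump at \<open>v\<close> is detected at rational times just before and just after \<open>v\<close> (or at \<open>t\<close> itself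
  if \<open>v = t\<close>): the values there differ from each other, hence at least one of them differs
  from \<open>x s\<close>.\<close>

lemma jumps_between_iff:
  fixes x :: "real \<Rightarrow> 'e::t2_space"
  assumes x: "x \<in> step_paths" and s: "0 \<le> s" "s \<le> t"
  shows "discontinuities x \<inter> {s<..t} \<noteq> {} \<longleftrightarrow>
    x t \<noteq> x s \<or> (\<exists>u::rat. s < of_rat u \<and> of_rat u < t \<and> x (of_rat u) \<noteq> x s)"
proof
  assume "x t \<noteq> x s \<or> (\<exists>u::rat. s < of_rat u \<and> of_rat u < t \<and> x (of_rat u) \<noteq> x s)"
  then obtain u where u: "s \<le> u" "u \<le> t" "x u \<noteq> x s" using s by (auto intro: less_imp_le)
  then have "discontinuities x \<inter> {s<..u} \<noteq> {}" using step_pathsD(3)[OF x s(1), of u] by auto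
  with u(2) show "discontinuities x \<inter> {s<..t} \<noteq> {}" by auto
next
  assume "discontinuities x \<inter> {s<..t} \<noteq> {}"
  then obtain v where v: "v \<in> discontinuities x" "s < v" "v \<le> t" by auto
  define p where "p = path_code x"
  have p: "p \<in> step_codes" and xp: "x = step_path p"
    using path_code_step_codes[OF x] step_path_path_code[OF x] by (simp_all add: p_def)
  have c: "p \<in> codes" by (rule step_codesD[OF p])
  obtain k where k: "jtime p (Suc k) = v" "0 < v"
    using v(1) unfolding xp discontinuities_step_path[OF p] by auto
  then have nn: "0 \<le> jtime p (Suc k)" by simp
  have "max s (jtime p k) < v" using v(2) jtime_less(2)[OF c nn, of k] k by simp
  then obtain u :: rat where u: "max s (jtime p k) < of_rat u" "of_rat u < v"
    using of_rat_dense by blast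
  have xu: "x (of_rat u) = jmark p k"
    unfolding xp using u k by (intro step_path_before_jump[OF c nn]) auto
  have xv: "x v = jmark p (Suc k)"
    unfolding xp using step_path_at_jump[OF c nn] k by simp
  have ne: "jmark p (Suc k) \<noteq> jmark p k" by (rule step_codesD(2)[OF p nn])
  show "x t \<noteq> x s \<or> (\<exists>u::rat. s < of_rat u \<and> of_rat u < t \<and> x (of_rat u) \<noteq> x s)"
  proof (cases "v = t")
    case True
    then show ?thesis using xu xv ne u v(3) by (metis max_less_iff_conj)
  next
    case False
    define b where "b = (if jtime p (Suc (Suc k)) < 0 then t else min t (jtime p (Suc (Suc k))))"
    have "v < b"
      using False v(3) k by (cases rule: jtime_Suc_cases[OF c, of "Suc k"]) (auto simp: b_def)
    then obtain w :: rat where w: "v < of_rat w" "of_rat w < b" using of_rat_dense by blast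
    have "x (of_rat w) = jmark p (Suc k)"
      unfolding xp using w k by (intro step_path_eq[OF c nn]) (auto simp: pending_def b_def split: if_splits)
    moreover have "of_rat w < t" using w(2) by (auto simp: b_def split: if_splits)
    moreover have "s < of_rat w" using w(1) v(2) by simp
    moreover have "s < of_rat u" "of_rat u < t" using u v(3) by auto
    ultimately show ?thesis using xu ne by metis
  qed
qed

lemma jumps_between_measurable:
  assumes "0 \<le> s" "s \<le> t"
  shows "{x \<in> step_paths. discontinuities x \<inter> {s<..t} \<noteq> {}} \<in>
    sets (step_paths_borel :: (real \<Rightarrow> 'e::polish_space) measure)"
proof -
  have [measurable]: "Measurable.pred step_paths_borel (\<lambda>x :: real \<Rightarrow> 'e. x u = x v)" for u v
    unfolding pred_def by (intro measurable_equality_set evaluation_measurable)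
  have eq: "{x \<in> step_paths. discontinuities x \<inter> {s<..t} \<noteq> {}} =
      {x \<in> space (step_paths_borel :: (real \<Rightarrow> 'e) measure).
        x t \<noteq> x s \<or> (\<exists>u::rat. s < of_rat u \<and> of_rat u < t \<and> x (of_rat u) \<noteq> x s)}"
    unfolding space_step_paths_borel using jumps_between_iff[OF _ assms] by blast
  show ?thesis unfolding eq by measurable
qed

text \<open>The recursion that gives measurability of the jump times: consecutive jumps are
  separated by a rational time.\<close>

lemma nth_jump_Suc_le_iff:
  assumes x: "x \<in> step_paths"
  shows "0 \<le> nth_jump x (Suc n) \<and> nth_jump x (Suc n) \<le> t \<longleftrightarrow>
    (\<exists>q::rat. 0 \<le> real_of_rat q \<and> of_rat q \<le> t \<and> (0 \<le> nth_jump x n \<and> nth_jump x n \<le> of_rat q) \<and>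
       discontinuities x \<inter> {of_rat q<..t} \<noteq> {})"
proof
  assume L: "0 \<le> nth_jump x (Suc n) \<and> nth_jump x (Suc n) \<le> t"
  then have n: "0 \<le> nth_jump x n" "nth_jump x n < nth_jump x (Suc n)"
    "nth_jump x (Suc n) \<in> discontinuities x"
    using nth_jump_Suc_nonneg[OF x] by blast+
  obtain q :: rat where q: "nth_jump x n < of_rat q" "of_rat q < nth_jump x (Suc n)"
    using of_rat_dense[OF n(2)] by blast
  have "0 \<le> real_of_rat q" using n(1) q(1) by linarith
  with L n q show "\<exists>q::rat. 0 \<le> real_of_rat q \<and> of_rat q \<le> t \<and>
      (0 \<le> nth_jump x n \<and> nth_jump x n \<le> of_rat q) \<and> discontinuities x \<inter> {of_rat q<..t} \<noteq> {}"
    by (intro exI[of _ q]) (auto simp del: nth_jump.simps)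
next
  assume "\<exists>q::rat. 0 \<le> real_of_rat q \<and> of_rat q \<le> t \<and> (0 \<le> nth_jump x n \<and> nth_jump x n \<le> of_rat q) \<and>
       discontinuities x \<inter> {of_rat q<..t} \<noteq> {}"
  then obtain q u where "0 \<le> nth_jump x n" "nth_jump x n \<le> real_of_rat q"
    "u \<in> discontinuities x" "real_of_rat q < u" "u \<le> t"
    by auto
  then show "0 \<le> nth_jump x (Suc n) \<and> nth_jump x (Suc n) \<le> t"
    using nth_jump_le[OF x, of n u] by simp
qed

lemma nth_jump_happened_measurable [measurable]:
  "Measurable.pred (step_paths_borel :: (real \<Rightarrow> 'e::polish_space) measure)
     (\<lambda>x. 0 \<le> nth_jump x n \<and> nth_jump x n \<le> t)"
proof (induction n arbitrary: t)
  case 0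
  then show ?case by simp
next
  case (Suc n)
  have at_rational: "Measurable.pred (step_paths_borel :: (real \<Rightarrow> 'e) measure)
      (\<lambda>x. 0 \<le> real_of_rat q \<and> of_rat q \<le> t \<and> (0 \<le> nth_jump x n \<and> nth_jump x n \<le> of_rat q) \<and>
        discontinuities x \<inter> {of_rat q<..t} \<noteq> {})" for q
  proof (cases "0 \<le> real_of_rat q \<and> of_rat q \<le> t")
    case True
    have "Measurable.pred (step_paths_borel :: (real \<Rightarrow> 'e) measure) (\<lambda>x. discontinuities x \<inter> {of_rat q<..t} \<noteq> {})"
      using jumps_between_measurable[of "of_rat q" t] True by (simp add: pred_def space_step_paths_borel)
    with Suc[of "of_rat q"] have "Measurable.pred (step_paths_borel :: (real \<Rightarrow> 'e) measure)
        (\<lambda>x. (0 \<le> nth_jump x n \<and> nth_jump x n \<le> of_rat q) \<and> discontinuities x \<inter> {of_rat q<..t} \<noteq> {})"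
      unfolding pred_def by (rule sets.sets_Collect_conj[rotated])
    with True show ?thesis by simp
  next
    case False
    then have eq: "(0 \<le> real_of_rat q \<and> of_rat q \<le> t \<and> P) = False" for P by blast
    show ?thesis unfolding eq by simp
  qed
  have "Measurable.pred (step_paths_borel :: (real \<Rightarrow> 'e) measure)
      (\<lambda>x. \<exists>q::rat. 0 \<le> real_of_rat q \<and> of_rat q \<le> t \<and> (0 \<le> nth_jump x n \<and> nth_jump x n \<le> of_rat q) \<and>
        discontinuities x \<inter> {of_rat q<..t} \<noteq> {})"
    by (rule pred_intros_countable(2)[OF at_rational])
  then show ?case
    by (rule measurable_cong[THEN iffD1, rotated])
       (rule nth_jump_Suc_le_iff[symmetric], simp only: space_step_paths_borel)
qed

lemma nth_jump_absent:
  assumes "x \<in> step_paths" "nth_jump x n < 0"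
  shows "nth_jump x n = -1"
  using absent_code(1)[OF path_code_codes[OF assms(1)], of n] assms(2) by (simp add: path_code_simps)

lemma nth_jump_measurable [measurable]:
  "(\<lambda>x. nth_jump x n) \<in> borel_measurable (step_paths_borel :: (real \<Rightarrow> 'e::polish_space) measure)"
proof (rule borel_measurableI_le)
  fix c :: real
  have "nth_jump x n \<le> c \<longleftrightarrow> (-1 \<le> c \<and> (\<forall>k::nat. \<not> (0 \<le> nth_jump x n \<and> nth_jump x n \<le> real k))) \<or>
      (0 \<le> nth_jump x n \<and> nth_jump x n \<le> c)" if "x \<in> step_paths" for x :: "real \<Rightarrow> 'e"
  proof (cases "0 \<le> nth_jump x n")
    case True
    obtain k where "nth_jump x n \<le> real k" using real_arch_simple by blast
    then show ?thesis using True by auto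
  next
    case False
    then show ?thesis using nth_jump_absent[OF that, of n] by auto
  qed
  then have eq: "{x \<in> space (step_paths_borel :: (real \<Rightarrow> 'e) measure). nth_jump x n \<le> c} = {x \<in> space step_paths_borel.
      (-1 \<le> c \<and> (\<forall>k::nat. \<not> (0 \<le> nth_jump x n \<and> nth_jump x n \<le> real k))) \<or>
      (0 \<le> nth_jump x n \<and> nth_jump x n \<le> c)}"
    unfolding space_step_paths_borel by blast
  show "{x \<in> space (step_paths_borel :: (real \<Rightarrow> 'e) measure). nth_jump x n \<le> c} \<in> sets step_paths_borel"
    unfolding eq by measurable
qed

text \<open>The value after the \<open>n\<close>-th jump is taken at a rational time before the next one. In this
  way only evaluations at fixed times occur.\<close>

lemma jmark_path_code_iff:
  fixes x :: "real \<Rightarrow> 'e::t2_space"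
  assumes x: "x \<in> step_paths"
  shows "jmark (path_code x) n \<in> V \<longleftrightarrow> (nth_jump x n < 0 \<and> undefined \<in> V) \<or>
    (\<exists>q::rat. (0 \<le> nth_jump x n \<and> nth_jump x n \<le> of_rat q) \<and>
       \<not> (0 \<le> nth_jump x (Suc n) \<and> nth_jump x (Suc n) \<le> of_rat q) \<and> x (of_rat q) \<in> V)"
proof (cases "nth_jump x n < 0")
  case True
  then show ?thesis by (simp add: path_code_simps del: nth_jump.simps)
next
  case False
  define p where "p = path_code x"
  have c: "p \<in> codes" and xp: "x = step_path p"
    using path_code_codes[OF x] step_path_path_code[OF x] by (simp_all add: p_def)
  have t: "nth_jump x m = jtime p m" for m by (simp add: p_def path_code_simps)
  have nn: "0 \<le> jtime p n" using False t by simp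
  have val: "x s = jmark p n" if "jtime p n \<le> s" "\<not> (0 \<le> jtime p (Suc n) \<and> jtime p (Suc n) \<le> s)" for s
    unfolding xp using that by (intro step_path_eq[OF c nn]) (auto simp: pending_def)
  define b where "b = (if jtime p (Suc n) < 0 then jtime p n + 1 else jtime p (Suc n))"
  have "jtime p n < b" by (cases rule: jtime_Suc_cases[OF c, of n]) (auto simp: b_def)
  then obtain q :: rat where "jtime p n < of_rat q" "of_rat q < b" using of_rat_dense by blast
  then have "jtime p n \<le> of_rat q" "\<not> (0 \<le> jtime p (Suc n) \<and> jtime p (Suc n) \<le> of_rat q)"
    by (auto simp: b_def split: if_splits)
  then show ?thesis using val nn False unfolding p_def[symmetric] t by metis
qed

lemma path_code_measurable:
  "path_code \<in> borel_measurable (step_paths_borel :: (real \<Rightarrow> 'e::polish_space) measure)"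
proof (rule measurable_into_jump_code)
  fix n
  show "(\<lambda>x. jtime (path_code x) n) \<in> borel_measurable (step_paths_borel :: (real \<Rightarrow> 'e) measure)"
    unfolding path_code_simps by (rule nth_jump_measurable)
  show "(\<lambda>x. jmark (path_code x) n) \<in> borel_measurable (step_paths_borel :: (real \<Rightarrow> 'e) measure)"
  proof (rule borel_measurableI)
    fix V :: "'e set" assume "open V"
    then have [measurable]: "V \<in> sets borel" by simp
    have eq: "(\<lambda>x. jmark (path_code x) n) -` V \<inter> space (step_paths_borel :: (real \<Rightarrow> 'e) measure) =
      {x \<in> space step_paths_borel. (nth_jump x n < 0 \<and> undefined \<in> V) \<or>
        (\<exists>q::rat. (0 \<le> nth_jump x n \<and> nth_jump x n \<le> of_rat q) \<and>
         \<not> (0 \<le> nth_jump x (Suc n) \<and> nth_jump x (Suc n) \<le> of_rat q) \<and> x (of_rat q) \<in> V)}"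
      unfolding space_step_paths_borel vimage_def using jmark_path_code_iff[of _ n V] by blast
    show "(\<lambda>x. jmark (path_code x) n) -` V \<inter> space (step_paths_borel :: (real \<Rightarrow> 'e) measure)
      \<in> sets step_paths_borel"
      unfolding eq by measurable
  qed
qed

section \<open>Non-explosion of the signal\<close>

text \<open>Simple functions below \<open>c + f\<close> stay simple when \<open>c\<close> is subtracted, so this holds for every
  integrand \<open>f\<close>. It is applied to the counting process \<open>p\<^sup>m\<close>.\<close>

lemma (in prob_space) nn_integral_const_add_le:
  assumes c: "c < \<infinity>"
  shows "(\<integral>\<^sup>+ x. c + f x \<partial>M) \<le> c + (\<integral>\<^sup>+ x. f x \<partial>M)"
proof -
  have "integral\<^sup>S M g \<le> c + (\<integral>\<^sup>+ x. f x \<partial>M)" if g: "simple_function M g" "g \<le> (\<lambda>x. c + f x)" for g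
  proof -
    have [measurable]: "g \<in> borel_measurable M" using g(1) by (rule borel_measurable_simple_function)
    have "g x - c \<le> f x" for x
      using g(2) c by (auto simp: le_fun_def ennreal_minus_le_iff add.commute)
    then have "(\<integral>\<^sup>+ x. g x - c \<partial>M) \<le> (\<integral>\<^sup>+ x. f x \<partial>M)" by (intro nn_integral_mono)
    moreover have "(\<integral>\<^sup>+ x. c + (g x - c) \<partial>M) = c + (\<integral>\<^sup>+ x. g x - c \<partial>M)"
      by (subst nn_integral_add) (auto simp: emeasure_space_1)
    moreover have "integral\<^sup>S M g \<le> (\<integral>\<^sup>+ x. c + (g x - c) \<partial>M)"
    proof -
      have "g x \<le> c + (g x - c)" for x by (metis add_diff_inverse_ennreal add.right_neutral le_cases add_increasing2 order_refl zero_le)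
      then show ?thesis
        unfolding nn_integral_eq_simple_integral[OF g(1), symmetric] by (intro nn_integral_mono)
    qed
    ultimately show ?thesis by (metis add_left_mono order_trans)
  qed
  then show ?thesis unfolding nn_integral_def[of M "\<lambda>x. c + f x"] by (intro SUP_least) auto
qed

context signal_observation
begin

lemma filtration_extended: "filtration (space M) (extended_filtration M F)"
  using filtration by (simp add: usual_filtration_def)

lemma extended_filtration_real: "0 \<le> q \<Longrightarrow> extended_filtration M F (ennreal q) = F q"
  by (simp add: extended_filtration_def)

lemma sets_F_subset: "0 \<le> q \<Longrightarrow> sets (F q) \<subseteq> sets M"
  using filtration.sets_F_mono[OF filtration_extended, of "ennreal q" \<infinity>]
  by (simp add: extended_filtration_real) (simp add: extended_filtration_def)

lemma space_F: "0 \<le> q \<Longrightarrow> space (F q) = space M"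
  using filtration.space_F[OF filtration_extended, of "ennreal q"] by (simp add: extended_filtration_real)

lemma T_le_F: "0 \<le> q \<Longrightarrow> {\<omega> \<in> space M. T k \<omega> \<le> ennreal q} \<in> sets (F q)"
  using stopping_timeD[OF T_stopping[of k], of "ennreal q"]
  by (simp add: extended_filtration_real pred_def space_F)

lemma T_le_measurable: "0 \<le> q \<Longrightarrow> {\<omega> \<in> space M. T k \<omega> \<le> ennreal q} \<in> sets M"
  using T_le_F sets_F_subset by blast

lemma T_incseq: "\<omega> \<in> space M \<Longrightarrow> i \<le> j \<Longrightarrow> T i \<omega> \<le> T j \<omega>"
  using T_mono by (rule lift_Suc_mono_le)

lemma T_pos: "\<omega> \<in> space M \<Longrightarrow> 1 \<le> k \<Longrightarrow> 0 < T k \<omega>"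
  using T_strict[of \<omega> 0] T_0[of \<omega>] T_incseq[of \<omega> 1 k] by (simp add: less_le_trans)

lemma locate_right:
  assumes "\<omega> \<in> space M" "r < T k \<omega>"
  obtains j where "j < k" "T j \<omega> \<le> r" "r < T (Suc j) \<omega>"
  using assms(2)
proof (induction k arbitrary: thesis)
  case 0
  then show ?case using T_0[OF assms(1)] by simp
next
  case (Suc k)
  show ?case
  proof (cases "r < T k \<omega>")
    case True
    then show ?thesis using Suc by (metis less_Suc_eq)
  next
    case False
    then show ?thesis using Suc.prems(1)[of k] Suc.prems(2) by simp
  qed
qed

lemma locate_left:
  assumes "\<omega> \<in> space M" "0 < r" "r \<le> T k \<omega>"
  obtains j where "T j \<omega> < r" "r \<le> T (Suc j) \<omega>"
  using assms(3)
proof (induction k arbitrary: thesis)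
  case 0
  then show ?case using T_0[OF assms(1)] assms(2) by simp
next
  case (Suc k)
  show ?case
  proof (cases "r \<le> T k \<omega>")
    case True
    then show ?thesis using Suc by blast
  next
    case False
    then show ?thesis using Suc.prems(1)[of k] Suc.prems(2) by simp
  qed
qed

text \<open>Up to \<open>T\<^sub>k\<close> the signal is a step function with finitely many pieces. At or after an
  accumulation point of the jump times nothing is known about it, and the kernels and \<open>\<lambda>\<^sup>m\<close>
  are controlled on cadlag paths only; this is why the compensator is used only on \<open>(0, T\<^sub>k]\<close>
  below.\<close>

lemma left_stopped_signal_cadlag:
  assumes \<omega>: "\<omega> \<in> space M" and s: "0 < s" "ennreal s \<le> T k \<omega>"
  shows "left_stopped_path (\<lambda>r. X r \<omega>) s \<in> cadlag_paths"
proof -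
  let ?y = "left_stopped_path (\<lambda>r. X r \<omega>) s"
  have before: "?y u = X u \<omega>" if "0 \<le> u" "u < s" for u
    using that by (simp add: left_stopped_path_def)
  define L where "L = Lim (at_left s) (\<lambda>r. X r \<omega>)"
  have after: "?y u = L" if "s \<le> u" for u
    using s(1) that by (simp add: left_stopped_path_def L_def)
  have right: "(?y \<longlongrightarrow> ?y t) (at_right t)" if t: "0 \<le> t" for t
  proof (rule tendsto_eventually)
    show "eventually (\<lambda>u. ?y u = ?y t) (at_right t)"
    proof (cases "t < s")
      case False
      then have "?y u = ?y t" if "t < u" for u using after that by simp
      then show ?thesis using eventually_at_right_less[of t] by (rule eventually_mono[rotated]) blast
    next
      case True
      then have "ennreal t < ennreal s" using t by (simp add: ennreal_less_iff)
      then have "ennreal t < T k \<omega>" using s(2) by (rule less_le_trans)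
      then obtain j where j: "T j \<omega> \<le> ennreal t" "ennreal t < T (Suc j) \<omega>"
        by (rule locate_right[OF \<omega>])
      obtain b where b: "t < b" "b \<le> s" "ennreal b \<le> T (Suc j) \<omega>"
      proof (cases "T (Suc j) \<omega>")
        case (real c)
        then have "t < c" using j(2) t by (simp add: ennreal_less_iff)
        then show thesis using that[of "min s c"] True real t by (simp add: ennreal_leI)
      qed (use that[of s] True in simp)
      have "?y u = ?y t" if u: "t < u" "u < b" for u
      proof -
        have us: "u < s" using u b(2) by simp
        have "ennreal u < ennreal b" using u t by (simp add: ennreal_less_iff)
        then have "ennreal u < T (Suc j) \<omega>" using b(3) by (rule less_le_trans)
        moreover have "ennreal t \<le> ennreal u" using u(1) by (intro ennreal_leI) simp
        then have "T j \<omega> \<le> ennreal u" using j(1) by (rule order_trans[rotated])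
        ultimately have "X u \<omega> = \<zeta> j \<omega>" using u t by (intro X_eq[OF \<omega>]) auto
        moreover have "X t \<omega> = \<zeta> j \<omega>" using X_eq[OF \<omega> t j] .
        ultimately have "X u \<omega> = X t \<omega>" by simp
        then show ?thesis using before us True u t by simp
      qed
      then show ?thesis unfolding eventually_at_right[OF b(1)] using b(1) by blast
    qed
  qed
  have left: "\<exists>l. (?y \<longlongrightarrow> l) (at_left t)" if t: "0 < t" for t
  proof (cases "t \<le> s")
    case False
    then show ?thesis using after by (intro exI tendsto_left_of_constant[of s t]) auto
  next
    case True
    then have "ennreal t \<le> T k \<omega>" using s(2) by (meson ennreal_leI order_trans)
    moreover have "0 < ennreal t" using t by (simp add: ennreal_less_zero_iff)
    ultimately obtain j where j: "T j \<omega> < ennreal t" "ennreal t \<le> T (Suc j) \<omega>"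
      using locate_left[OF \<omega>] by blast
    define a where "a = enn2real (T j \<omega>)"
    have a: "0 \<le> a" "T j \<omega> = ennreal a"
      using j(1) by (auto simp: a_def ennreal_enn2real_if less_top[symmetric] top_unique)
    then have "a < t" using j(1) by (simp add: ennreal_less_iff)
    moreover have "?y u = \<zeta> j \<omega>" if u: "a < u" "u < t" for u
    proof -
      have "X u \<omega> = \<zeta> j \<omega>"
      proof (rule X_eq[OF \<omega>])
        show "ennreal u < T (Suc j) \<omega>"
          using u a j(2) by (intro less_le_trans[OF _ j(2)]) (simp add: ennreal_less_iff)
      qed (use u a in \<open>auto intro: ennreal_leI\<close>)
      then show ?thesis using before u a True by simp
    qed
    ultimately show ?thesis using tendsto_left_of_constant by blast
  qed
  have "?y \<in> extensional {0..}" by (simp add: left_stopped_path_def)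
  then show ?thesis using right left by (simp add: cadlag_paths_def cadlag_def)
qed

text \<open>The complement of the stochastic interval is a countable union of predictable
  rectangles: \<open>T\<^sub>k < s\<close> means that \<open>T\<^sub>k \<le> q < s\<close> for some rational \<open>q\<close>.\<close>

lemma stopped_interval_predictable:
  assumes t: "0 \<le> t"
  shows "{(\<omega>, s). \<omega> \<in> space M \<and> 0 < s \<and> s \<le> t \<and> ennreal s \<le> T k \<omega>} \<in> sets (predictable_sigma M F)"
    (is "?D \<in> _")
proof -
  let ?gen = "{A \<times> {s<..t} | A s t. 0 \<le> s \<and> s \<le> t \<and> A \<in> sets (F s)}"
  have "?gen \<subseteq> Pow (space M \<times> {0<..})"
    using sets.sets_into_space space_F by fastforce
  then have sets_eq: "sets (predictable_sigma M F) = sigma_sets (space M \<times> {0<..}) ?gen"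
    unfolding predictable_sigma_def by (rule sets_measure_of)
  have gen: "A \<times> {s<..u} \<in> sets (predictable_sigma M F)" if "0 \<le> s" "s \<le> u" "A \<in> sets (F s)" for A s u
    unfolding sets_eq using that by (intro sigma_sets.Basic) blast
  define B where "B q = (if 0 \<le> q \<and> q \<le> t then {\<omega> \<in> space M. T k \<omega> \<le> ennreal q} \<times> {q<..t} else {})"
    for q
  have B: "B q \<in> sets (predictable_sigma M F)" for q
    using gen[OF _ _ T_le_F] by (simp add: B_def)
  have "?D = space M \<times> {0<..t} - (\<Union>q::rat. B (of_rat q))"
  proof (intro set_eqI)
    fix z :: "'w \<times> real"
    obtain \<omega> s where z: "z = (\<omega>, s)" by (cases z)
    have "ennreal s \<le> T k \<omega> \<longleftrightarrow> (\<forall>q::rat. (\<omega>, s) \<notin> B (of_rat q))"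
      if \<omega>: "\<omega> \<in> space M" and s: "0 < s" "s \<le> t"
    proof
      assume le: "ennreal s \<le> T k \<omega>"
      show "\<forall>q::rat. (\<omega>, s) \<notin> B (of_rat q)"
      proof (intro allI notI)
        fix q :: rat assume "(\<omega>, s) \<in> B (of_rat q)"
        then have "0 \<le> real_of_rat q" "T k \<omega> \<le> ennreal (of_rat q)" "of_rat q < s"
          by (auto simp: B_def split: if_splits)
        moreover have "ennreal (of_rat q) < ennreal s" using calculation s by (simp add: ennreal_less_iff)
        ultimately show False using le by (meson leD le_less_trans)
      qed
    next
      assume none: "\<forall>q::rat. (\<omega>, s) \<notin> B (of_rat q)"
      show "ennreal s \<le> T k \<omega>"
      proof (rule ccontr)
        assume "\<not> ennreal s \<le> T k \<omega>"
        then have lt: "T k \<omega> < ennreal s" by simp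
        define a where "a = enn2real (T k \<omega>)"
        have a: "0 \<le> a" "T k \<omega> = ennreal a"
          using lt by (auto simp: a_def ennreal_enn2real_if less_top[symmetric] top_unique)
        then have "a < s" using lt by (simp add: ennreal_less_iff)
        then obtain q :: rat where q: "a < of_rat q" "of_rat q < s" using of_rat_dense by blast
        have "0 \<le> real_of_rat q" "real_of_rat q \<le> t" using q a s by linarith+
        then have "(\<omega>, s) \<in> B (of_rat q)" using q a s \<omega> unfolding B_def by (auto intro: ennreal_leI)
        with none show False by blast
      qed
    qed
    then show "z \<in> ?D \<longleftrightarrow> z \<in> space M \<times> {0<..t} - (\<Union>q::rat. B (of_rat q))"
      unfolding z by auto
  qed
  also have "\<dots> \<in> sets (predictable_sigma M F)"
  proof (intro sets.Diff sets.countable_UN' B)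
    show "space M \<times> {0<..t} \<in> sets (predictable_sigma M F)"
      using gen[of 0 t "space M"] sets.top[of "F 0"] t by (simp add: space_F)
  qed (auto simp: B)
  finally show ?thesis .
qed

lemma sets_time_mark: "A \<in> sets borel \<Longrightarrow> A \<subseteq> {0<..} \<Longrightarrow> A \<times> UNIV \<in> sets (time_mark_space (borel :: 'e measure))"
  unfolding time_mark_space_def by (intro pair_measureI) (auto simp: sets_restrict_space_iff)

text \<open>If \<open>T\<^sub>k \<le> t\<close>, the points \<open>T\<^sub>1, \<dots>, T\<^sub>k\<close> all lie in \<open>(0, min t T\<^sub>k]\<close>, so the jump measure of
  \<open>(0, min t T\<^sub>k] \<times> E\<close> is at least \<open>k\<close>.\<close>

lemma jump_count_le:
  assumes \<omega>: "\<omega> \<in> space M" and k: "1 \<le> k" and t: "0 < t"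
  shows "of_nat k * indicator {\<omega> \<in> space M. T k \<omega> \<le> ennreal t} \<omega> \<le>
    (\<integral>\<^sup>+ (s, z). indicator ({(\<omega>, s). \<omega> \<in> space M \<and> 0 < s \<and> s \<le> t \<and> ennreal s \<le> T k \<omega>} \<times> (UNIV :: 'e set)) ((\<omega>, s), z)
       \<partial>jump_measure X T \<omega>)"
proof (cases "T k \<omega> \<le> ennreal t")
  case False
  then show ?thesis by simp
next
  case True
  let ?D = "{(\<omega>, s). \<omega> \<in> space M \<and> 0 < s \<and> s \<le> t \<and> ennreal s \<le> T k \<omega>}"
  let ?K = "{k. 1 \<le> k \<and> T k \<omega> < \<infinity>}"
  let ?g = "\<lambda>k. (enn2real (T k \<omega>), signal_at X T k \<omega>)"
  let ?A = "{s. 0 < s \<and> s \<le> t \<and> ennreal s \<le> T k \<omega>}"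
  have fin: "T j \<omega> \<le> T k \<omega>" "T j \<omega> < \<infinity>" "0 < T j \<omega>" if "j \<in> {1..k}" for j
  proof -
    show "T j \<omega> \<le> T k \<omega>" using that T_incseq[OF \<omega>] by simp
    then show "T j \<omega> < \<infinity>" using True by (metis ennreal_less_top infinity_ennreal_def le_less_trans)
    show "0 < T j \<omega>" using T_pos[OF \<omega>] that by simp
  qed
  have g: "?g \<in> measurable (count_space ?K) (time_mark_space borel)"
    using T_pos[OF \<omega>]
    by (auto simp: time_mark_space_def space_pair_measure space_restrict_space enn2real_positive_iff less_top)
  have "?A \<in> sets borel" by measurable
  then have A: "?A \<times> UNIV \<in> sets (time_mark_space (borel :: 'e measure))"
    by (intro sets_time_mark) auto
  have "{1..k} \<subseteq> ?K" using fin(2) by auto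
  then have "of_nat k = (\<integral>\<^sup>+ j. indicator {1..k} j \<partial>count_space ?K)"
    by (subst nn_integral_indicator) (simp_all add: emeasure_count_space_finite)
  also have "\<dots> \<le> (\<integral>\<^sup>+ j. indicator (?A \<times> UNIV) (?g j) \<partial>count_space ?K)"
  proof (rule nn_integral_mono)
    fix j
    show "indicator {1..k} j \<le> (indicator (?A \<times> UNIV) (?g j) :: ennreal)"
    proof (cases "j \<in> {1..k}")
      case j: True
      define a where "a = enn2real (T j \<omega>)"
      have a: "0 < a" "T j \<omega> = ennreal a"
        using fin[OF j] by (auto simp: a_def ennreal_enn2real_if less_top[symmetric] enn2real_positive_iff)
      have "ennreal a \<le> ennreal t" using fin(1)[OF j] True a by simp
      then have "a \<in> ?A" using a t fin(1)[OF j] by (simp add: ennreal_le_iff)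
      then show ?thesis using j by (simp add: a_def)
    qed simp
  qed
  also have "\<dots> = (\<integral>\<^sup>+ y. indicator (?A \<times> UNIV) y \<partial>jump_measure X T \<omega>)"
    unfolding jump_measure_def using A by (intro nn_integral_distr[OF g, symmetric]) simp
  also have "\<dots> = (\<integral>\<^sup>+ (s, z). indicator (?D \<times> (UNIV :: 'e set)) ((\<omega>, s), z) \<partial>jump_measure X T \<omega>)"
    using \<omega> by (intro nn_integral_cong) (auto simp: indicator_def)
  finally show ?thesis using True \<omega> by simp
qed

lemma emeasure_kernel_le_1:
  assumes "(\<lambda>(s, x). Q s x) \<in> measurable (restrict_space borel {0<..} \<Otimes>\<^sub>M skorokhod_borel) (prob_algebra (borel :: 'e measure))"
    and "0 < s" "x \<in> cadlag_paths"
  shows "emeasure (Q s x) UNIV \<le> 1"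
proof -
  have "(s, x) \<in> space (restrict_space borel {0<..} \<Otimes>\<^sub>M skorokhod_borel)"
    using assms(2,3)
    by (simp add: space_pair_measure space_restrict_space space_borel_of topspace_skorokhod_topology)
  from measurable_space[OF assms(1) this] have "prob_space (Q s x)" by (simp add: space_prob_algebra)
  then show ?thesis using emeasure_space[of "Q s x" UNIV] by (simp add: prob_space.emeasure_space_1)
qed

lemma emeasure_counting_stieltjes:
  assumes p: "counting_path p" and t: "0 \<le> t"
  shows "emeasure (counting_stieltjes p) {0<..t} = of_nat (p t)"
proof -
  have mono: "p s \<le> p u" if "0 \<le> s" "s \<le> u" for s u
    using p that by (auto simp: counting_path_def mono_on_def)
  have "emeasure (interval_measure (\<lambda>s. real (p (max 0 s)))) {0<..t} =
      ennreal (real (p (max 0 t)) - real (p (max 0 0)))"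
  proof (rule emeasure_interval_measure_Ioc[OF t])
    show "real (p (max 0 x)) \<le> real (p (max 0 y))" if "x \<le> y" for x y
      using mono that by (simp add: max_def)
    show "continuous (at_right a) (\<lambda>s. real (p (max 0 s)))" for a
    proof (cases "0 \<le> a")
      case True
      have "(p \<longlongrightarrow> p a) (at_right a)" using p True by (simp add: counting_path_def)
      then have "eventually (\<lambda>s. p s \<in> {p a}) (at_right a)"
        by (rule topological_tendstoD) (simp_all add: discrete_topology_class.open_discrete)
      then have "((\<lambda>s. real (p s)) \<longlongrightarrow> real (p a)) (at_right a)"
        by (intro tendsto_eventually) (auto elim: eventually_mono)
      then have "((\<lambda>s. real (p (max 0 s))) \<longlongrightarrow> real (p a)) (at_right a)"
        by (rule Lim_transform_eventually)
           (use True in \<open>auto intro!: eventually_mono[OF eventually_at_right_less[of a]]\<close>)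
      then show ?thesis using True by (simp add: continuous_within)
    next
      case False
      have "eventually (\<lambda>s. real (p (max 0 s)) = real (p 0)) (at_right a)"
        unfolding eventually_at_right_field using False by (intro exI[of _ 0]) auto
      then show ?thesis using False by (auto simp: continuous_within intro: tendsto_eventually)
    qed
  qed
  then show ?thesis
    using p t by (simp add: counting_stieltjes_def counting_path_def ennreal_of_nat_eq_real_of_nat)
qed

text \<open>The kernels have total mass one, so the compensator has the mass of \<open>\<lambda>\<^sup>m ds + dp\<^sup>m\<close> at most.\<close>

lemma compensator_stopped_le:
  assumes \<omega>: "\<omega> \<in> space M" and k: "1 \<le> k" and t: "0 < t"
    and C: "\<And>s x. 0 < s \<Longrightarrow> x \<in> cadlag_paths \<Longrightarrow> lam_m s x \<le> C"
    and mu: "\<And>t A. 0 < t \<Longrightarrow> A \<in> sets borel \<Longrightarrow> emeasure (\<mu> \<omega>) ({0<..t} \<times> A) =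
         (let x = left_stopped_path (\<lambda>r. X r \<omega>)
          in (\<integral>\<^sup>+ s\<in>{0<..t}. (emeasure (Qm s (x s)) A * ennreal (lam_m s (x s))) \<partial>lborel) +
             (\<integral>\<^sup>+ s\<in>{0<..t}. emeasure (Rm s (x s)) A \<partial>counting_stieltjes (\<lambda>r. pm r \<omega>)))"
  shows "(\<integral>\<^sup>+ (s, z). indicator ({(\<omega>, s). \<omega> \<in> space M \<and> 0 < s \<and> s \<le> t \<and> ennreal s \<le> T k \<omega>} \<times> (UNIV :: 'e set)) ((\<omega>, s), z)
       \<partial>\<mu> \<omega>) \<le> ennreal C * ennreal t + of_nat (pm t \<omega>)"
proof -
  let ?x = "left_stopped_path (\<lambda>r. X r \<omega>)"
  let ?p = "counting_stieltjes (\<lambda>r. pm r \<omega>)"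
  \<comment> \<open>On \<open>(0, min t T\<^sub>k]\<close> the paths on which the kernels depend are cadlag.\<close>
  define \<tau> where "\<tau> = enn2real (min (ennreal t) (T k \<omega>))"
  have ennreal_\<tau>: "ennreal \<tau> = min (ennreal t) (T k \<omega>)"
    by (simp add: \<tau>_def ennreal_enn2real_if min_def top_unique)
  have "0 < ennreal \<tau>" using t T_pos[OF \<omega> k] by (simp add: ennreal_\<tau> ennreal_less_zero_iff)
  then have \<tau>0: "0 < \<tau>" by (simp add: ennreal_less_zero_iff)
  have le_iff: "s \<le> \<tau> \<longleftrightarrow> s \<le> t \<and> ennreal s \<le> T k \<omega>" if "0 < s" for s
  proof -
    have "s \<le> \<tau> \<longleftrightarrow> ennreal s \<le> ennreal \<tau>" using \<tau>0 by (simp add: ennreal_le_iff)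
    also have "\<dots> \<longleftrightarrow> s \<le> t \<and> ennreal s \<le> T k \<omega>" using t by (simp add: ennreal_\<tau> ennreal_le_iff)
    finally show ?thesis .
  qed
  have \<tau>t: "\<tau> \<le> t" using le_iff[OF \<tau>0] by simp
  have sets_\<mu>: "sets (\<mu> \<omega>) = sets (time_mark_space borel)"
    using m_compensator \<omega> by (auto simp: dual_predictable_projection_def random_measure_def)
  have "(\<integral>\<^sup>+ (s, z). indicator ({(\<omega>, s). \<omega> \<in> space M \<and> 0 < s \<and> s \<le> t \<and> ennreal s \<le> T k \<omega>} \<times> (UNIV :: 'e set)) ((\<omega>, s), z)
       \<partial>\<mu> \<omega>) = (\<integral>\<^sup>+ y. indicator ({0<..\<tau>} \<times> UNIV) y \<partial>\<mu> \<omega>)"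
    using \<omega> le_iff by (intro nn_integral_cong) (auto simp: indicator_def)
  also have "\<dots> = emeasure (\<mu> \<omega>) ({0<..\<tau>} \<times> UNIV)"
    by (intro nn_integral_indicator) (simp only: sets_\<mu>, rule sets_time_mark, auto)
  also have "\<dots> = (\<integral>\<^sup>+ s\<in>{0<..\<tau>}. (emeasure (Qm s (?x s)) UNIV * ennreal (lam_m s (?x s))) \<partial>lborel) +
      (\<integral>\<^sup>+ s\<in>{0<..\<tau>}. emeasure (Rm s (?x s)) UNIV \<partial>?p)"
    using mu[OF \<tau>0, of UNIV] by (simp add: Let_def)
  also have "\<dots> \<le> ennreal C * ennreal t + of_nat (pm t \<omega>)"
  proof (rule add_mono)
    have cadlag: "?x s \<in> cadlag_paths" if "s \<in> {0<..\<tau>}" for s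
      using left_stopped_signal_cadlag[OF \<omega>, of s k] le_iff[of s] that by simp
    have "(\<integral>\<^sup>+ s\<in>{0<..\<tau>}. (emeasure (Qm s (?x s)) UNIV * ennreal (lam_m s (?x s))) \<partial>lborel)
        \<le> (\<integral>\<^sup>+ s. ennreal C * indicator {0<..\<tau>} s \<partial>lborel)"
    proof (rule nn_integral_mono)
      fix s :: real
      have "emeasure (Qm s (?x s)) UNIV * ennreal (lam_m s (?x s)) \<le> 1 * ennreal C" if s: "s \<in> {0<..\<tau>}"
        using s by (intro mult_mono emeasure_kernel_le_1[OF Qm_kernel] ennreal_leI C cadlag) auto
      then show "emeasure (Qm s (?x s)) UNIV * ennreal (lam_m s (?x s)) * indicator {0<..\<tau>} s
          \<le> ennreal C * indicator {0<..\<tau>} s"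
        by (cases "s \<in> {0<..\<tau>}") auto
    qed
    also have "\<dots> = ennreal C * ennreal \<tau>" using \<tau>0 by (simp add: nn_integral_cmult_indicator)
    also have "\<dots> \<le> ennreal C * ennreal t" using \<tau>t by (intro mult_left_mono ennreal_leI) auto
    finally show "(\<integral>\<^sup>+ s\<in>{0<..\<tau>}. (emeasure (Qm s (?x s)) UNIV * ennreal (lam_m s (?x s))) \<partial>lborel)
        \<le> ennreal C * ennreal t" .
    have p: "counting_path (\<lambda>r. pm r \<omega>)"
      using pm_counting \<omega> by (simp add: predictable_counting_process_def)
    have "(\<integral>\<^sup>+ s\<in>{0<..\<tau>}. emeasure (Rm s (?x s)) UNIV \<partial>?p) \<le> (\<integral>\<^sup>+ s. indicator {0<..\<tau>} s \<partial>?p)"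
    proof (rule nn_integral_mono)
      fix s :: real
      have "emeasure (Rm s (?x s)) UNIV \<le> 1" if s: "s \<in> {0<..\<tau>}"
        using s by (intro emeasure_kernel_le_1[OF Rm_kernel] cadlag) auto
      then show "emeasure (Rm s (?x s)) UNIV * indicator {0<..\<tau>} s \<le> indicator {0<..\<tau>} s"
        by (cases "s \<in> {0<..\<tau>}") auto
    qed
    also have "\<dots> = emeasure ?p {0<..\<tau>}"
      by (intro nn_integral_indicator) (simp add: counting_stieltjes_def)
    also have "\<dots> = of_nat (pm \<tau> \<omega>)" using \<tau>0 by (intro emeasure_counting_stieltjes p) simp
    also have "\<dots> \<le> of_nat (pm t \<omega>)"
      using p \<tau>0 \<tau>t by (auto simp: counting_path_def mono_on_def)
    finally show "(\<integral>\<^sup>+ s\<in>{0<..\<tau>}. emeasure (Rm s (?x s)) UNIV \<partial>?p) \<le> of_nat (pm t \<omega>)" .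
  qed
  finally show ?thesis .
qed

text \<open>A Markov inequality for the number of jumps up to \<open>t\<close> and \<open>T\<^sub>k\<close>, whose expectation is that of
  the compensator. The right-hand side does not depend on \<open>k\<close>.\<close>

lemma jump_probability_bound:
  assumes k: "1 \<le> k" and t: "0 < t"
    and C: "\<And>s x. 0 < s \<Longrightarrow> x \<in> cadlag_paths \<Longrightarrow> lam_m s x \<le> C"
  shows "of_nat k * emeasure M {\<omega> \<in> space M. T k \<omega> \<le> ennreal t} \<le>
    ennreal C * ennreal t + (\<integral>\<^sup>+ \<omega>. of_nat (pm t \<omega>) \<partial>M)"
proof -
  let ?D = "{(\<omega>, s). \<omega> \<in> space M \<and> 0 < s \<and> s \<le> t \<and> ennreal s \<le> T k \<omega>}"
  let ?W = "indicator (?D \<times> (UNIV :: 'e set)) :: ('w \<times> real) \<times> 'e \<Rightarrow> ennreal"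
  have D: "?D \<in> sets (predictable_sigma M F)"
    using t by (intro stopped_interval_predictable) simp
  have "?D \<times> (UNIV :: 'e set) \<in> sets (predictable_sigma M F \<Otimes>\<^sub>M borel)"
    by (rule pair_measureI[OF D]) simp
  then have W: "?W \<in> borel_measurable (predictable_sigma M F \<Otimes>\<^sub>M borel)" by simp
  have "of_nat k * emeasure M {\<omega> \<in> space M. T k \<omega> \<le> ennreal t} =
      (\<integral>\<^sup>+ \<omega>. of_nat k * indicator {\<omega> \<in> space M. T k \<omega> \<le> ennreal t} \<omega> \<partial>M)"
    using T_le_measurable t by (simp add: nn_integral_cmult_indicator)
  also have "\<dots> \<le> (\<integral>\<^sup>+ \<omega>. (\<integral>\<^sup>+ (s, z). ?W ((\<omega>, s), z) \<partial>jump_measure X T \<omega>) \<partial>M)"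
    by (intro nn_integral_mono jump_count_le k t)
  also have "\<dots> = (\<integral>\<^sup>+ \<omega>. (\<integral>\<^sup>+ (s, z). ?W ((\<omega>, s), z) \<partial>\<mu> \<omega>) \<partial>M)"
    using m_compensator W unfolding dual_predictable_projection_def by blast
  also have "\<dots> \<le> (\<integral>\<^sup>+ \<omega>. ennreal C * ennreal t + of_nat (pm t \<omega>) \<partial>M)"
  proof (rule nn_integral_mono_AE)
    show "AE \<omega> in M. (\<integral>\<^sup>+ (s, z). ?W ((\<omega>, s), z) \<partial>\<mu> \<omega>) \<le> ennreal C * ennreal t + of_nat (pm t \<omega>)"
      using mu_eq AE_space
    proof eventually_elim
      case (elim \<omega>)
      show ?case by (rule compensator_stopped_le[OF elim(2) k t C]) (use elim(1) in blast)+
    qed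
  qed
  also have "\<dots> \<le> ennreal C * ennreal t + (\<integral>\<^sup>+ \<omega>. of_nat (pm t \<omega>) \<partial>M)"
    by (rule nn_integral_const_add_le) (simp add: ennreal_mult_less_top)
  finally show ?thesis .
qed

text \<open>Infinitely many jumps up to time \<open>t\<close> have a probability of at most \<open>b / k\<close> for every \<open>k\<close>.\<close>

lemma no_explosion_by:
  assumes t: "0 < t"
    and C: "\<And>s x. 0 < s \<Longrightarrow> x \<in> cadlag_paths \<Longrightarrow> lam_m s x \<le> C"
    and pm: "(\<integral>\<^sup>+ \<omega>. of_nat (pm t \<omega>) \<partial>M) < \<infinity>"
  shows "AE \<omega> in M. \<exists>k. ennreal t < T k \<omega>"
proof -
  let ?A = "{\<omega> \<in> space M. \<forall>k. T k \<omega> \<le> ennreal t}"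
  have "(\<Inter>k. {\<omega> \<in> space M. T k \<omega> \<le> ennreal t}) \<in> sets M"
    using t T_le_measurable by (intro sets.countable_INT') auto
  also have "(\<Inter>k. {\<omega> \<in> space M. T k \<omega> \<le> ennreal t}) = ?A" by auto
  finally have A: "?A \<in> sets M" .
  have "ennreal C * ennreal t + (\<integral>\<^sup>+ \<omega>. of_nat (pm t \<omega>) \<partial>M) < \<infinity>"
    using pm by (simp add: ennreal_mult_less_top)
  then obtain b where b: "0 \<le> b" "ennreal C * ennreal t + (\<integral>\<^sup>+ \<omega>. of_nat (pm t \<omega>) \<partial>M) = ennreal b"
    by (metis ennreal_cases infinity_ennreal_def less_irrefl)
  have bound: "real k * prob ?A \<le> b" if "1 \<le> k" for k :: nat
  proof -
    have "emeasure M ?A \<le> emeasure M {\<omega> \<in> space M. T k \<omega> \<le> ennreal t}"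
      using t T_le_measurable by (intro emeasure_mono) auto
    then have "of_nat k * emeasure M ?A \<le> ennreal b"
      using jump_probability_bound[OF that t C] unfolding b(2)
      by (meson mult_left_mono order_trans zero_le)
    then have "ennreal (real k * prob ?A) \<le> ennreal b"
      by (simp add: emeasure_eq_measure ennreal_mult ennreal_of_nat_eq_real_of_nat)
    then show ?thesis using b(1) by (simp add: ennreal_le_iff)
  qed
  have "prob ?A = 0"
  proof (rule ccontr)
    assume "prob ?A \<noteq> 0"
    then have pos: "0 < prob ?A" using measure_nonneg[of M ?A] by linarith
    obtain k :: nat where "b / prob ?A < real k" using reals_Archimedean2 by blast
    then have "b < real k * prob ?A" using pos by (simp add: divide_less_eq)
    moreover have "real k * prob ?A \<le> real (Suc k) * prob ?A" by (intro mult_right_mono) auto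
    ultimately show False using bound[of "Suc k"] by simp
  qed
  then have "?A \<in> null_sets M" using A by (simp add: null_sets_def emeasure_eq_measure)
  then have "AE \<omega> in M. \<omega> \<notin> ?A" by (rule AE_not_in)
  then show ?thesis using AE_space by eventually_elim (auto simp: not_le)
qed

lemma no_explosion:
  assumes bdd: "bdd_above ((\<lambda>(t, x). lam_m t x) ` ({0<..} \<times> cadlag_paths))"
    and pm: "\<And>t. 0 \<le> t \<Longrightarrow> (\<integral>\<^sup>+ \<omega>. of_nat (pm t \<omega>) \<partial>M) < \<infinity>"
  shows "AE \<omega> in M. \<forall>t. \<exists>k. ennreal t < T k \<omega>"
proof -
  obtain C where "\<And>z. z \<in> {0<..} \<times> cadlag_paths \<Longrightarrow> (case z of (t, x) \<Rightarrow> lam_m t x) \<le> C"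
    using bdd unfolding bdd_above_def by blast
  then have C: "lam_m s x \<le> C" if "0 < s" "x \<in> cadlag_paths" for s x
    using that by force
  have "AE \<omega> in M. \<exists>k. ennreal (real (Suc N)) < T k \<omega>" for N
    by (rule no_explosion_by[of "real (Suc N)" C]) (use C pm[of "real (Suc N)"] in simp_all)
  then have "AE \<omega> in M. \<forall>N::nat. \<exists>k. ennreal (real (Suc N)) < T k \<omega>"
    unfolding AE_all_countable by blast
  then show ?thesis
  proof (rule AE_mp, intro AE_I2 impI allI)
    fix \<omega> t assume all: "\<forall>N::nat. \<exists>k. ennreal (real (Suc N)) < T k \<omega>"
    obtain N :: nat where "t \<le> real N" using real_arch_simple by blast
    then have "ennreal t \<le> ennreal (real (Suc N))" by (intro ennreal_leI) simp
    then show "\<exists>k. ennreal t < T k \<omega>" using all by (meson le_less_trans)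
  qed
qed

section \<open>The history process encodes the stopped signal\<close>

text \<open>The path of the history at stage \<open>j\<close> and the stopped signal have the same value at every
  time, because both are constant between consecutive \<open>T\<^sub>k\<close> and keep their last value after
  \<open>t\<close>, when \<open>T\<^sub>j\<close> is the last jump up to \<open>t\<close>.\<close>

lemma stage_history_code:
  assumes \<omega>: "\<omega> \<in> space M" and t: "0 \<le> t" and j: "T j \<omega> \<le> ennreal t" "ennreal t < T (Suc j) \<omega>"
  defines "h \<equiv> stage_history X T j \<omega>"
  shows "h \<in> histories" "encode h \<in> finite_step_codes"
    "step_path (encode h) = stopped_path (\<lambda>s. X s \<omega>) t"
proof -
  have fin: "T k \<omega> < \<infinity>" "T k \<omega> \<le> ennreal t" if "k \<le> j" for k
  proof -
    show "T k \<omega> \<le> ennreal t" using T_incseq[OF \<omega> that] j(1) by simp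
    then show "T k \<omega> < \<infinity>" using ennreal_less_top le_less_trans by fastforce
  qed
  have real: "T k \<omega> = ennreal (enn2real (T k \<omega>))" if "k \<le> j" for k
    using fin(1)[OF that] by (simp add: ennreal_enn2real_if less_top[symmetric])
  have signal: "signal_at X T k \<omega> = \<zeta> k \<omega>" if "k \<le> j" for k
    unfolding signal_at_def
  proof (rule X_eq[OF \<omega>])
    show "T k \<omega> \<le> ennreal (enn2real (T k \<omega>))" using real[OF that] by simp
    show "ennreal (enn2real (T k \<omega>)) < T (Suc k) \<omega>"
      using T_strict[OF \<omega> fin(1)[OF that]] real[OF that] by simp
  qed simp
  show h: "h \<in> histories"
    unfolding h_def stage_history_def histories_def mem_Collect_eq prod.case
    using T_0[OF \<omega>] T_mono[OF \<omega>] T_strict[OF \<omega>] T_pos[OF \<omega>] fin(1)[THEN less_imp_neq] fin(1)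
    by auto
  have time: "jtime (encode h) k = (if k \<le> j then enn2real (T k \<omega>) else -1)"
    and mark: "jmark (encode h) k = (if k \<le> j then \<zeta> k \<omega> else undefined)" for k
    using fin signal by (simp_all add: encode_simps h_def stage_history_def)
  have code: "encode h \<in> codes" by (rule encode_codes[OF h])
  show "encode h \<in> finite_step_codes"
    unfolding finite_step_codes_def step_codes_def
  proof (intro CollectI conjI allI impI code)
    fix k assume "0 \<le> jtime (encode h) (Suc k)"
    then have k: "Suc k \<le> j" by (simp add: time split: if_splits)
    then show "jmark (encode h) (Suc k) \<noteq> jmark (encode h) k"
      using genuine_jumps[OF \<omega> fin(1)[OF k]] by (simp add: mark)
  next
    have "jtime (encode h) (Suc j) < 0" by (simp add: time)
    then show "\<exists>n. jtime (encode h) n < 0 \<or> real k < jtime (encode h) n" for k :: nat by blast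
    show "\<exists>n. jtime (encode h) n < 0" by (rule exI[of _ "Suc j"]) (simp add: time)
  qed
  show "step_path (encode h) = stopped_path (\<lambda>s. X s \<omega>) t"
  proof
    fix s
    show "step_path (encode h) s = stopped_path (\<lambda>s. X s \<omega>) t s"
    proof (cases "0 \<le> s")
      case False
      then show ?thesis by (simp add: step_path_def stopped_path_def)
    next
      case True
      define r where "r = min t s"
      have r: "0 \<le> r" "r \<le> t" "r \<le> s" using t True by (simp_all add: r_def)
      have "ennreal r < T (Suc j) \<omega>" using j(2) r(2) by (meson ennreal_leI le_less_trans)
      then obtain i where i: "i < Suc j" "T i \<omega> \<le> ennreal r" "ennreal r < T (Suc i) \<omega>"
        by (rule locate_right[OF \<omega>])
      have ij: "i \<le> j" using i(1) by simp
      have "step_path (encode h) s = jmark (encode h) i"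
      proof (rule step_path_eq[OF code])
        show "0 \<le> jtime (encode h) i" using ij by (simp add: time)
        have "ennreal (enn2real (T i \<omega>)) \<le> ennreal r" using i(2) real[OF ij] by simp
        then show "jtime (encode h) i \<le> s" using r ij by (simp add: time)
        show "pending (encode h) (Suc i) s"
        proof (cases "Suc i \<le> j")
          case S: True
          have "ennreal r < ennreal (enn2real (T (Suc i) \<omega>))" using i(3) real[OF S] by simp
          then have lt: "r < enn2real (T (Suc i) \<omega>)" using r(1) by (simp add: ennreal_less_iff)
          have "ennreal (enn2real (T (Suc i) \<omega>)) \<le> ennreal t" using fin(2)[OF S] real[OF S] by simp
          then have "enn2real (T (Suc i) \<omega>) \<le> t" using t by simp
          then have "s < enn2real (T (Suc i) \<omega>)" using lt by (auto simp: r_def min_def split: if_splits)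
          then show ?thesis using S by (simp add: pending_def time)
        qed (simp add: pending_def time)
      qed
      also have "\<dots> = X r \<omega>" using X_eq[OF \<omega> r(1) i(2,3)] ij by (simp add: mark)
      finally show ?thesis using True by (simp add: stopped_path_def r_def)
    qed
  qed
qed

lemma history_process_code:
  assumes \<omega>: "\<omega> \<in> space M" and t: "0 \<le> t" and no_explosion: "\<exists>k. ennreal t < T k \<omega>"
  defines "h \<equiv> history_process X T t \<omega>"
  shows "h \<in> histories" "encode h \<in> finite_step_codes"
    "step_path (encode h) = stopped_path (\<lambda>s. X s \<omega>) t"
proof -
  obtain j where j: "T j \<omega> \<le> ennreal t" "ennreal t < T (Suc j) \<omega>"
    using no_explosion locate_right[OF \<omega>] by blast
  have "(THE n. T n \<omega> \<le> ennreal t \<and> ennreal t < T (Suc n) \<omega>) = j"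
  proof (rule the_equality)
    fix i assume i: "T i \<omega> \<le> ennreal t \<and> ennreal t < T (Suc i) \<omega>"
    show "i = j"
    proof (rule ccontr)
      assume "i \<noteq> j"
      then have "Suc i \<le> j \<or> Suc j \<le> i" by auto
      then show False using i j T_incseq[OF \<omega>, of "Suc i" j] T_incseq[OF \<omega>, of "Suc j" i] by auto
    qed
  qed (use j in simp)
  then have h: "h = stage_history X T j \<omega>" by (simp add: h_def history_process_def)
  show "h \<in> histories" "encode h \<in> finite_step_codes"
    "step_path (encode h) = stopped_path (\<lambda>s. X s \<omega>) t"
    unfolding h by (rule stage_history_code[OF \<omega> t j])+
qed

end

theorem proposition3p1:
  assumes two_points: "\<exists>a b :: 'e::polish_space. a \<noteq> b"
  shows "\<exists>S :: 'e history \<Rightarrow> real \<Rightarrow> 'e.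
    bij_betw S histories step_paths \<and>
    S \<in> measurable histories_borel step_paths_borel \<and>
    inv_into histories S \<in> measurable step_paths_borel histories_borel \<and>
    (\<forall>(M :: 'w measure) F T \<zeta> X Y \<mu> Qm Rm lam_m pm (Z :: 'z measure) n \<nu> Qn Rn lam_n pn.
       signal_observation M F T \<zeta> X Y \<mu> Qm Rm lam_m pm Z n \<nu> Qn Rn lam_n pn \<longrightarrow>
       bdd_above ((\<lambda>(t, x). lam_m t x) ` ({0<..} \<times> cadlag_paths)) \<longrightarrow>
       (\<forall>t\<ge>0. (\<integral>\<^sup>+ \<omega>. of_nat (pm t \<omega>) \<partial>M) < \<infinity>) \<longrightarrow>
       (\<forall>t\<ge>0. (\<integral>\<^sup>+ \<omega>. of_nat (pn t \<omega>) \<partial>M) < \<infinity>) \<longrightarrow>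
       (AE \<omega> in M. \<forall>t\<ge>0.
          stopped_path (\<lambda>s. X s \<omega>) t = S (history_process X T t \<omega>) \<and>
          history_process X T t \<omega> = inv_into histories S (stopped_path (\<lambda>s. X s \<omega>) t)))"
proof -
  obtain \<phi> \<phi>' :: "'e jump_code \<Rightarrow> 'e jump_code" where
    \<phi>_borel: "\<phi> \<in> borel_measurable borel" "\<phi>' \<in> borel_measurable borel" and
    \<phi>_into: "\<And>p. p \<in> codes \<Longrightarrow> \<phi> p \<in> step_codes" "\<And>p. p \<in> step_codes \<Longrightarrow> \<phi>' p \<in> codes" and
    \<phi>_inv: "\<And>p. p \<in> codes \<Longrightarrow> \<phi>' (\<phi> p) = p" "\<And>p. p \<in> step_codes \<Longrightarrow> \<phi> (\<phi>' p) = p" and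
    \<phi>_fix: "\<And>p. p \<in> finite_step_codes \<Longrightarrow> \<phi> p = p"
    using codes_isomorphic_step_codes[OF two_points] by blast
  define S :: "'e history \<Rightarrow> real \<Rightarrow> 'e" where "S h = step_path (\<phi> (encode h))" for h
  define S' :: "(real \<Rightarrow> 'e) \<Rightarrow> 'e history" where "S' x = decode (\<phi>' (path_code x))" for x
  have S_into: "S h \<in> step_paths" if "h \<in> histories" for h
    unfolding S_def by (intro step_path_step_paths \<phi>_into encode_codes that)
  have S'_into: "S' x \<in> histories" if "x \<in> step_paths" for x
    unfolding S'_def by (intro decode_histories \<phi>_into path_code_step_codes that)
  have S'S: "S' (S h) = h" if h: "h \<in> histories" for h
    using encode_codes[OF h] by (simp add: S_def S'_def path_code_step_path \<phi>_into \<phi>_inv decode_encode h)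
  have SS': "S (S' x) = x" if x: "x \<in> step_paths" for x
    using path_code_step_codes[OF x]
    by (simp add: S_def S'_def encode_decode \<phi>_into \<phi>_inv step_path_path_code x)
  have bij: "bij_betw S histories step_paths"
    by (rule bij_betw_byWitness[where f' = S']) (use S_into S'_into S'S SS' in auto)
  have inv: "inv_into histories S x = S' x" if "x \<in> step_paths" for x
    using bij_betw_imp_inj_on[OF bij] S'_into[OF that] SS'[OF that] by (metis inv_into_f_f)
  have enc: "encode \<in> measurable histories_borel (restrict_space borel (codes :: 'e jump_code set))"
    using encode_measurable
    by (rule measurable_restrict_space2[rotated]) (simp add: space_borel_of encode_codes)
  have \<phi>: "\<phi> \<in> measurable (restrict_space borel codes) (restrict_space borel step_codes)"
    using \<phi>_borel(1) by (rule measurable_restrict_space3) (simp add: \<phi>_into)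
  have S: "S \<in> measurable histories_borel step_paths_borel"
    unfolding S_def by (rule measurable_compose[OF measurable_compose[OF enc \<phi>] step_path_measurable])
  have code: "path_code \<in> measurable step_paths_borel (restrict_space borel (step_codes :: 'e jump_code set))"
    using path_code_measurable
    by (rule measurable_restrict_space2[rotated]) (simp add: space_step_paths_borel path_code_step_codes)
  have \<phi>': "\<phi>' \<in> measurable (restrict_space borel step_codes) (restrict_space borel codes)"
    using \<phi>_borel(2) by (rule measurable_restrict_space3) (simp add: \<phi>_into)
  have "S' \<in> measurable step_paths_borel histories_borel"
    unfolding S'_def by (rule measurable_compose[OF measurable_compose[OF code \<phi>'] decode_measurable])
  then have S': "inv_into histories S \<in> measurable step_paths_borel histories_borel"
    by (rule measurable_cong[THEN iffD1, rotated]) (simp add: space_step_paths_borel inv)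
  show ?thesis
  proof (intro exI[of _ S] conjI bij S S' allI impI)
    fix M :: "'w measure" and F T \<zeta> and X :: "real \<Rightarrow> 'w \<Rightarrow> 'e" and Y \<mu> Qm Rm lam_m pm and Z :: "'z measure" and n \<nu> Qn Rn lam_n pn
    assume "signal_observation M F T \<zeta> X Y \<mu> Qm Rm lam_m pm Z n \<nu> Qn Rn lam_n pn"
    then interpret signal_observation M F T \<zeta> X Y \<mu> Qm Rm lam_m pm Z n \<nu> Qn Rn lam_n pn .
    assume bdd: "bdd_above ((\<lambda>(t, x). lam_m t x) ` ({0<..} \<times> cadlag_paths))"
      and pm: "\<forall>t\<ge>0. (\<integral>\<^sup>+ \<omega>. of_nat (pm t \<omega>) \<partial>M) < \<infinity>"
    have "AE \<omega> in M. \<forall>t. \<exists>k. ennreal t < T k \<omega>" by (rule no_explosion[OF bdd]) (use pm in simp)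
    then show "AE \<omega> in M. \<forall>t\<ge>0.
        stopped_path (\<lambda>s. X s \<omega>) t = S (history_process X T t \<omega>) \<and>
        history_process X T t \<omega> = inv_into histories S (stopped_path (\<lambda>s. X s \<omega>) t)"
      using AE_space
    proof eventually_elim
      case (elim \<omega>)
      show ?case
      proof (intro allI impI)
        fix t :: real assume t: "0 \<le> t"
        note h = history_process_code[OF elim(2) t elim(1)[rule_format]]
        have "S (history_process X T t \<omega>) = stopped_path (\<lambda>s. X s \<omega>) t"
          using h(2,3) by (simp add: S_def \<phi>_fix)
        moreover have "inv_into histories S (S (history_process X T t \<omega>)) = history_process X T t \<omega>"
          using bij_betw_imp_inj_on[OF bij] h(1) by (rule inv_into_f_f)
        ultimately show "stopped_path (\<lambda>s. X s \<omega>) t = S (history_process X T t \<omega>) \<and>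
            history_process X T t \<omega> = inv_into histories S (stopped_path (\<lambda>s. X s \<omega>) t)"
          by simp
      qed
    qed
  qed
qed

end
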